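(* Let $\mu$ be a finite positive Borel measure on $\mathbb{D}$, let $0<p\leq 1$ and $-1<\alpha,\beta<\infty$. Then $T_{\mu,\beta}:L_a^p(\omega_\alpha)\to L_a^1(\omega_\beta)$ is bounded if and only if $\mu$ is a $\frac1p$-Carleson measure for $L_a^1(\omega_\alpha)$ and $T_{\mu,\frac{2+\alpha}{p}-2}(1)\in\mathcal{LB}^1$.
   Context: $\mathbb{D}$ is the open unit disk in $\mathbb{C}$ and $dA$ is the normalized area measure on $\mathbb{D}$. For $-1<\alpha<\infty$, $\omega_\alpha(z)=(1+\alpha)(1-|z|^2)^\alpha$. For $0<p<\infty$, the weighted Bergman space $L_a^p(\omega_\alpha)$ consists of the analytic functions $f$ on $\mathbb{D}$ with $\|f\|_{L^p(\omega_\alpha)}:=\big(\int_{\mathbb{D}}|f(z)|^p\omega_\alpha(z)\,dA(z)\big)^{1/p}<\infty$. For a finite positive Borel measure $\mu$ on $\mathbb{D}$ and $\gamma>-1$, the Toeplitz operator is $T_{\mu,\gamma}(f)(z)=\int_{\mathbb{D}}\frac{f(w)}{(1-z\bar w)^{2+\gamma}}\,d\mu(w)$, $z\in\mathbb{D}$. The operator $T_{\mu,\beta}:L_a^p(\omega_\alpha)\to L_a^q(\omega_\beta)$ is called bounded if there is a constant $C$ such that $\|T_{\mu,\beta}(f)\|_{L^q(\omega_\beta)}\leq C\|f\|_{L^p(\omega_\alpha)}$ for all polynomials $f$. For $0<s,p<\infty$ (here $s$ denotes the exponent), a finite positive Borel measure $\mu$ on $\mathbb{D}$ is an $s$-Carleson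 measure for $L_a^p(\omega_\alpha)$ if there is a constant $C>0$ with $\big(\int_{\mathbb{D}}|f|^s\,d\mu\big)^{1/s}\leq C\|f\|_{L^p(\omega_\alpha)}$ for all $f\in L_a^p(\omega_\alpha)$. $\mathcal{LB}^1$ is the space of analytic functions $f$ on $\mathbb{D}$ with $|f(0)|+\sup_{z\in\mathbb{D}}(1-|z|^2)\big(\log\frac{2}{1-|z|^2}\big)|f'(z)|<\infty$. The symbol $T_{\mu,\gamma}(1)$ denotes $T_{\mu,\gamma}$ applied to the constant function $1$. *)

theory Defs
  imports "HOL-Complex_Analysis.Complex_Analysis"
begin

abbreviation unit_disk :: "complex set" ("\<D>") where
  "\<D> \<equiv> ball 0 1"

definition finite_borel_measure_on_disk :: "complex measure \<Rightarrow> bool" where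
  "finite_borel_measure_on_disk \<mu> \<longleftrightarrow> sets \<mu> = sets (restrict_space borel \<D>) \<and> finite_measure \<mu>"

definition area_measure :: "complex measure" where
  "area_measure = scale_measure (ennreal (1 / pi)) (restrict_space lborel \<D>)"

definition weight :: "real \<Rightarrow> complex \<Rightarrow> real" where
  "weight \<alpha> z = (1 + \<alpha>) * (1 - (cmod z)\<^sup>2) powr \<alpha>"

definition weighted_area :: "real \<Rightarrow> complex measure" where
  "weighted_area \<alpha> = density area_measure (\<lambda>z. ennreal (weight \<alpha> z))"

text \<open>The \<open>L\<^sup>p\<close> (quasi-)norm, with value \<open>\<infinity>\<close> allowed, so that an inequality with a finite
  right-hand side includes finiteness of the left-hand side.\<close>

definition Lp_norm :: "real \<Rightarrow> complex measure \<Rightarrow> (complex \<Rightarrow> complex) \<Rightarrow> ennreal" where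
  "Lp_norm p M f =
     (let I = (\<integral>\<^sup>+z. ennreal (cmod (f z) powr p) \<partial>M)
      in if I = \<infinity> then \<infinity> else ennreal (enn2real I powr (1 / p)))"

text \<open>As for all function spaces here, only the values on the disk matter; elements are arbitrary
  outside it.\<close>

definition bergman_space :: "real \<Rightarrow> real \<Rightarrow> (complex \<Rightarrow> complex) set" where
  "bergman_space p \<alpha> = {f. f holomorphic_on \<D> \<and> Lp_norm p (weighted_area \<alpha>) f < \<infinity>}"

text \<open>The power is the principal branch: \<open>1 - z * cnj w\<close> has positive real part for
  \<open>z\<close>, \<open>w\<close> in the disk.\<close>

definition toeplitz :: "complex measure \<Rightarrow> real \<Rightarrow> (complex \<Rightarrow> complex) \<Rightarrow> complex \<Rightarrow> complex" where
  "toeplitz \<mu> \<gamma> f z = (\<integral>w. f w / (1 - z * cnj w) powr complex_of_real (2 + \<gamma>) \<partial>\<mu>)"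

text \<open>Boundedness of \<open>T\<^bsub>\<mu>,\<beta>\<^esub>\<close> from \<open>L\<^sub>a\<^sup>p(\<omega>\<^sub>\<alpha>)\<close> to \<open>L\<^sub>a\<^sup>q(\<omega>\<^sub>\<beta>)\<close>, tested on polynomials.\<close>

definition toeplitz_bounded :: "complex measure \<Rightarrow> real \<Rightarrow> real \<Rightarrow> real \<Rightarrow> real \<Rightarrow> bool" where
  "toeplitz_bounded \<mu> p \<alpha> q \<beta> \<longleftrightarrow>
     (\<exists>C::real. C \<ge> 0 \<and> (\<forall>P::complex poly.
        Lp_norm q (weighted_area \<beta>) (toeplitz \<mu> \<beta> (poly P))
          \<le> ennreal C * Lp_norm p (weighted_area \<alpha>) (poly P)))"

definition carleson_measure :: "complex measure \<Rightarrow> real \<Rightarrow> real \<Rightarrow> real \<Rightarrow> bool" where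
  "carleson_measure \<mu> s p \<alpha> \<longleftrightarrow>
     (\<exists>C::real. C > 0 \<and> (\<forall>f\<in>bergman_space p \<alpha>.
        Lp_norm s \<mu> f \<le> ennreal C * Lp_norm p (weighted_area \<alpha>) f))"

definition LB1 :: "(complex \<Rightarrow> complex) set" where
  "LB1 = {f. f holomorphic_on \<D> \<and>
     ennreal (cmod (f 0)) +
     (SUP z\<in>\<D>. ennreal ((1 - (cmod z)\<^sup>2) * ln (2 / (1 - (cmod z)\<^sup>2)) * cmod (deriv f z))) < \<infinity>}"

end

(*
Write t = (2 + \<alpha>) / p.  By Bergman duality and Fubini, the integral of T f times the conjugate of
a bounded function \<phi> against \<omega>_\<beta> equals the integral of f times the conjugate of h against \<mu>,
where h is the Bergman projection of \<phi>, a Bloch function.  Since p \<le> 1, the space L_a^p(\<omega>_\<alpha>) embeds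
into L_a^1(\<omega>_(t-2)); reproducing f by the kernel of order t + 1 reduces boundedness of T to
|integral of h(w) / (1 - z cnj w)^(t+1) d\<mu>(w)| \<le> C / (1 - |z|^2).  Replacing h(w) by h(z) costs
a bounded amount for a Carleson measure, because h is Lipschitz for the hyperbolic metric, and the
remaining factor |h(z)|, of size log (2 / (1 - |z|^2)), is what the logarithmic condition on the
derivative of T_(\<mu>,t-2)(1) absorbs.  Conversely, kernels as test functions f and \<phi> give the
Carleson property, and \<phi>(u) = (1 - |u|^2) / (1 - u cnj z), whose projection is comparable to the
logarithm at z, gives the logarithmic condition.
*)

theory Submission
  imports Defs
begin

subsection \<open>The Bergman kernel\<close>

text \<open>The target is L^1, so duality supplies merely bounded functions, and their projections
  need not be bounded; this is where the logarithm comes from. Two approximations shape the proof.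
  Boundedness of T is given on polynomials, so kernels enter as bounded pointwise limits of their
  Taylor polynomials. And the dual function \<phi> is cut off to a ball of radius r < 1, which makes
  its projection bounded and Fubini applicable; the final constants must not depend on r, and r
  tends to 1 by Fatou's lemma or dominated convergence. There are no Carleson squares or hyperbolic
  disks. The Carleson property is used through integrals of |1 - z cnj w|^-(t + e) against \<mu>, of
  size (1 - |z|^2)^-e for every e > 0, and through variants with a Bloch difference; it is recovered
  from the single case e = t + 2. The order t + 1 is natural twice: a kernel of that order has
  L_a^p(\<omega>_\<alpha>) quasi-norm of size 1 / (1 - |z|^2), and it occurs in the derivative of
  T_(\<mu>,t-2)(1), whose own kernel has order t. After the pairing, \<beta> survives only in the
  projection.\<close>

definition kernel :: "real \<Rightarrow> complex \<Rightarrow> complex \<Rightarrow> complex" where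
  "kernel s z w = 1 / (1 - z * cnj w) powr complex_of_real s"

lemma norm_one_minus_mult_cnj_ge:
  assumes "cmod w \<le> 1"
  shows "1 - cmod z \<le> cmod (1 - z * cnj w)"
proof -
  have "cmod z * cmod w \<le> cmod z"
    using assms by (simp add: mult_left_le)
  moreover have "cmod 1 - cmod (z * cnj w) \<le> cmod (1 - z * cnj w)"
    by (rule norm_triangle_ineq2)
  ultimately show ?thesis by (simp add: norm_mult)
qed

lemma norm_one_minus_mult_cnj_commute: "cmod (1 - z * cnj w) = cmod (1 - w * cnj z)"
proof -
  have "cnj (1 - z * cnj w) = 1 - w * cnj z" by simp
  then show ?thesis by (metis complex_mod_cnj)
qed

lemma norm_mult_cnj_less_1:
  assumes "cmod z < 1" "cmod w \<le> 1"
  shows "cmod (z * cnj w) < 1"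
proof -
  have "cmod z * cmod w \<le> cmod z"
    using assms by (simp add: mult_left_le)
  then show ?thesis using assms by (simp add: norm_mult)
qed

lemma Re_one_minus_mult_cnj_pos:
  assumes "cmod z < 1" "cmod w \<le> 1"
  shows "0 < Re (1 - z * cnj w)"
  using norm_mult_cnj_less_1[OF assms] abs_Re_le_cmod[of "z * cnj w"] by simp

lemma one_minus_mult_cnj_not_nonpos:
  assumes "cmod z < 1" "cmod w \<le> 1"
  shows "1 - z * cnj w \<notin> \<real>\<^sub>\<le>\<^sub>0"
  using Re_one_minus_mult_cnj_pos[OF assms] by (auto simp: complex_nonpos_Reals_iff)

lemma one_minus_mult_cnj_nonzero:
  assumes "cmod z < 1" "cmod w \<le> 1"
  shows "1 - z * cnj w \<noteq> 0"
proof
  assume "1 - z * cnj w = 0"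
  then show False using Re_one_minus_mult_cnj_pos[OF assms] by (simp only:) simp
qed

lemma norm_one_minus_mult_cnj_le:
  assumes "cmod z < 1" "cmod w \<le> 1"
  shows "cmod (1 - z * cnj w) \<le> 2"
  using norm_triangle_ineq4[of 1 "z * cnj w"] norm_mult_cnj_less_1[OF assms] by simp

lemma one_minus_norm_bounds:
  assumes "cmod z < 1"
  shows "1 - (cmod z)\<^sup>2 > 0" "1 - (cmod z)\<^sup>2 \<le> 1" "1 - (cmod z)\<^sup>2 \<le> 2 * (1 - cmod z)"
    "1 - cmod z \<le> 1 - (cmod z)\<^sup>2"
proof -
  have *: "1 - (cmod z)\<^sup>2 = (1 - cmod z) * (1 + cmod z)"
    by (simp add: power2_eq_square algebra_simps)
  show "1 - (cmod z)\<^sup>2 > 0" "1 - (cmod z)\<^sup>2 \<le> 1"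
    using assms by (auto simp: abs_square_less_1)
  show "1 - (cmod z)\<^sup>2 \<le> 2 * (1 - cmod z)"
    unfolding * using assms mult_left_mono[of "1 + cmod z" 2 "1 - cmod z"] by simp
  show "1 - cmod z \<le> 1 - (cmod z)\<^sup>2"
    unfolding * using assms mult_left_mono[of 1 "1 + cmod z" "1 - cmod z"] by simp
qed

lemma norm_kernel: "cmod (kernel s z w) = cmod (1 - z * cnj w) powr - s"
  by (simp add: kernel_def norm_divide norm_powr_real_powr' powr_minus_divide)

lemma norm_kernel_commute: "cmod (kernel s z w) = cmod (kernel s w z)"
  by (simp only: norm_kernel norm_one_minus_mult_cnj_commute[of z])

lemma cnj_kernel:
  assumes "cmod z < 1" "cmod w \<le> 1"
  shows "cnj (kernel s z w) = kernel s w z"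
proof -
  have "cnj ((1 - z * cnj w) powr complex_of_real s) = cnj (1 - z * cnj w) powr complex_of_real s"
    using Re_one_minus_mult_cnj_pos[OF assms] by (subst cnj_powr) auto
  then show ?thesis by (simp add: kernel_def mult.commute)
qed

lemma norm_kernel_le:
  assumes "cmod z < 1" "cmod w \<le> 1" "s \<ge> 0"
  shows "cmod (kernel s z w) \<le> (1 - cmod z) powr - s"
  unfolding norm_kernel
  using norm_one_minus_mult_cnj_ge[OF assms(2), of z] assms by (intro powr_mono2') auto

lemma norm_kernel_le':
  assumes "cmod w < 1" "cmod z \<le> 1" "s \<ge> 0"
  shows "cmod (kernel s z w) \<le> (1 - cmod w) powr - s"
  using norm_kernel_le[OF assms] by (simp only: norm_kernel_commute[of s z])

text \<open>With \<open>s = t\<close> this expresses the \<mu>-integral of the kernel of order t + 1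
  through T(1) and z times its derivative, since differentiation in z produces cnj w times that
  kernel.\<close>

lemma kernel_Suc:
  assumes "cmod z < 1" "cmod w \<le> 1"
  shows "kernel s z w = (1 - z * cnj w) * kernel (s + 1) z w"
  using one_minus_mult_cnj_nonzero[OF assms]
  by (simp add: kernel_def powr_add)

lemma kernel_zero [simp]: "kernel s 0 w = 1" "kernel s z 0 = 1"
  by (simp_all add: kernel_def)

lemma has_field_derivative_kernel:
  assumes "cmod z < 1" "cmod w \<le> 1"
  shows "((\<lambda>z. kernel s z w) has_field_derivative s * cnj w * kernel (s + 1) z w) (at z within A)"
proof -
  note nz = one_minus_mult_cnj_nonzero[OF assms]
  have 1: "((\<lambda>z. 1 - z * cnj w) has_field_derivative - cnj w) (at z)"
    by (auto intro!: derivative_eq_intros)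
  have "((\<lambda>z. (1 - z * cnj w) powr (- complex_of_real s)) has_field_derivative
     (complex_of_real (- s) * (1 - z * cnj w) powr complex_of_real (- s - 1)) * (- cnj w)) (at z)"
    using DERIV_chain2[OF has_field_derivative_powr[OF one_minus_mult_cnj_not_nonpos[OF assms], of "- complex_of_real s"] 1]
    by simp
  moreover have "(complex_of_real (- s) * (1 - z * cnj w) powr complex_of_real (- s - 1)) * (- cnj w) = s * cnj w * kernel (s + 1) z w"
  proof -
    have "complex_of_real (- s - 1) = - complex_of_real (s + 1)" by simp
    then show ?thesis
      unfolding kernel_def by (simp only: powr_minus_divide of_real_minus) (simp add: mult_ac)
  qed
  ultimately show ?thesis
    by (simp add: kernel_def powr_minus_divide has_field_derivative_at_within)
qed

lemma holomorphic_kernel: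
  assumes "cmod w \<le> 1"
  shows "(\<lambda>z. kernel s z w) holomorphic_on \<D>"
  unfolding holomorphic_on_def field_differentiable_def
  using has_field_derivative_kernel[OF _ assms] by (metis dist_0_norm mem_ball)

lemma continuous_on_kernel1:
  assumes "cmod w \<le> 1"
  shows "continuous_on \<D> (\<lambda>z. kernel s z w)"
  using holomorphic_on_imp_continuous_on[OF holomorphic_kernel[OF assms]] .

lemma continuous_on_inverse_powr:
  assumes "continuous_on S f" "\<And>x. x \<in> S \<Longrightarrow> f x \<notin> \<real>\<^sub>\<le>\<^sub>0"
  shows "continuous_on S (\<lambda>x. 1 / f x powr complex_of_real s)"
proof -
  have "f x \<noteq> 0" "0 \<le> Re (f x) \<or> Im (f x) \<noteq> 0" if "x \<in> S" for x
    using assms(2)[OF that] by (auto simp: complex_nonpos_Reals_iff)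
  then show ?thesis
    using assms(1) by (intro continuous_intros) auto
qed

lemma continuous_on_kernel2:
  assumes "cmod z < 1"
  shows "continuous_on \<D> (\<lambda>w. kernel s z w)"
  unfolding kernel_def
  by (intro continuous_on_inverse_powr one_minus_mult_cnj_not_nonpos assms) (auto intro!: continuous_intros)

lemma continuous_on_kernel_pair:
  "continuous_on (\<D> \<times> \<D>) (\<lambda>(z, w). kernel s z w)"
  unfolding kernel_def case_prod_unfold
  by (intro continuous_on_inverse_powr one_minus_mult_cnj_not_nonpos) (auto intro!: continuous_intros)

text \<open>Newton's series with exponent -s: the sign of the generalised binomial coefficient
  cancels that of (-z cnj w)^k. For s > 0 the coefficients are positive, which later allows
  comparing kernels coefficientwise.\<close>

lemma kernel_sums:
  assumes "cmod z < 1" "cmod w \<le> 1"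
  shows "(\<lambda>k. of_real (pochhammer s k / fact k) * (z * cnj w) ^ k) sums kernel s z w"
proof -
  have "(\<lambda>k. (- complex_of_real s gchoose k) * (- (z * cnj w)) ^ k) sums (1 + - (z * cnj w)) powr (- complex_of_real s)"
    by (rule gen_binomial_complex) (use norm_mult_cnj_less_1[OF assms] in simp)
  moreover have "(- complex_of_real s gchoose k) * (- (z * cnj w)) ^ k =
       of_real (pochhammer s k / fact k) * (z * cnj w) ^ k" for k
  proof -
    have "(- (z * cnj w)) ^ k = (- 1) ^ k * (z * cnj w) ^ k"
      by (rule power_minus)
    moreover have "(- 1 :: complex) ^ k * (- 1) ^ k = 1"
      by (simp flip: power_mult_distrib)
    ultimately show ?thesis
      by (simp add: gbinomial_pochhammer pochhammer_of_real)
  qed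
  ultimately show ?thesis
    by (simp add: kernel_def powr_minus_divide)
qed

lemma summable_kernel_coeffs:
  fixes x s :: real
  assumes "0 \<le> x" "x < 1" "s > 0"
  shows "summable (\<lambda>k. pochhammer s k / fact k * x ^ k)"
    and "(\<Sum>k. pochhammer s k / fact k * x ^ k) = (1 - x) powr - s"
proof -
  \<comment> \<open>The boundary point w = 1 is admissible: the kernel lemmas ask only for cmod w
    \<le> 1.\<close>
  have "(\<lambda>k. of_real (pochhammer s k / fact k * x ^ k)) sums kernel s (of_real x) 1"
    using kernel_sums[of "of_real x" 1 s] assms by simp
  moreover have "kernel s (of_real x) 1 = of_real ((1 - x) powr - s)"
    using assms powr_of_real[of "1 - x" s] by (simp add: kernel_def powr_minus_divide)
  ultimately have "(\<lambda>k. pochhammer s k / fact k * x ^ k) sums ((1 - x) powr - s)"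
    by (simp only: sums_of_real_iff)
  then show "summable (\<lambda>k. pochhammer s k / fact k * x ^ k)"
    "(\<Sum>k. pochhammer s k / fact k * x ^ k) = (1 - x) powr - s"
    by (auto simp: sums_iff)
qed

subsection \<open>Area measure on the disk\<close>

text \<open>Lebesgue measure is determined by its values on boxes, and a box in the plane is the
  image of a product of two intervals. This opens the way to iterated integrals in the real and
  imaginary parts.\<close>

lemma lborel_complex_eq:
  "(lborel :: complex measure) = distr (lborel \<Otimes>\<^sub>M lborel) borel (\<lambda>(x, y). Complex x y)"
proof (rule lborel_eqI)
  fix l u :: complex
  assume le: "\<And>b. b \<in> Basis \<Longrightarrow> l \<bullet> b \<le> u \<bullet> b"
  have le': "Re l \<le> Re u" "Im l \<le> Im u"
    using le[of 1] le[of \<i>] by (auto simp: Basis_complex_def inner_complex_def)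
  have eq: "(\<lambda>(x, y). Complex x y) -` box l u \<inter> space (lborel \<Otimes>\<^sub>M lborel) = {Re l<..<Re u} \<times> {Im l<..<Im u}"
    by (auto simp: box_def Basis_complex_def inner_complex_def space_pair_measure)
  have m: "(\<lambda>(x, y). Complex x y) \<in> borel_measurable (lborel \<Otimes>\<^sub>M lborel)"
    unfolding Complex_eq by measurable
  have "emeasure (distr (lborel \<Otimes>\<^sub>M lborel) borel (\<lambda>(x, y). Complex x y)) (box l u) =
    emeasure (lborel \<Otimes>\<^sub>M lborel) ({Re l<..<Re u} \<times> {Im l<..<Im u})"
    using m by (subst emeasure_distr) (auto simp: eq)
  also have "\<dots> = ennreal (Re u - Re l) * ennreal (Im u - Im l)"
    by (subst lborel.emeasure_pair_measure_Times) (use le' in auto)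
  also have "\<dots> = (\<Prod>b\<in>Basis. (u - l) \<bullet> b)"
    using le' by (simp add: Basis_complex_def inner_complex_def ennreal_mult)
  finally show "emeasure (distr (lborel \<Otimes>\<^sub>M lborel) borel (\<lambda>(x, y). Complex x y)) (box l u) = (\<Prod>b\<in>Basis. (u - l) \<bullet> b)" .
qed simp

text \<open>Both orders of integration are recorded because the rotation argument substitutes in one
  variable at a time.\<close>

lemma nn_integral_complex_eq:
  fixes f :: "complex \<Rightarrow> ennreal"
  assumes [measurable]: "f \<in> borel_measurable borel"
  shows "(\<integral>\<^sup>+z. f z \<partial>lborel) = (\<integral>\<^sup>+x. (\<integral>\<^sup>+y. f (Complex x y) \<partial>lborel) \<partial>lborel)"
    and "(\<integral>\<^sup>+z. f z \<partial>lborel) = (\<integral>\<^sup>+y. (\<integral>\<^sup>+x. f (Complex x y) \<partial>lborel) \<partial>lborel)"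
proof -
  have [measurable]: "(\<lambda>(x, y). Complex x y) \<in> borel_measurable (lborel \<Otimes>\<^sub>M lborel)"
    unfolding Complex_eq by measurable
  have "(\<integral>\<^sup>+z. f z \<partial>lborel) = (\<integral>\<^sup>+p. f (case p of (x, y) \<Rightarrow> Complex x y) \<partial>(lborel \<Otimes>\<^sub>M lborel))"
    by (subst lborel_complex_eq) (simp add: nn_integral_distr)
  also have "\<dots> = (\<integral>\<^sup>+x. (\<integral>\<^sup>+y. f (Complex x y) \<partial>lborel) \<partial>lborel)"
    by (subst lborel.nn_integral_fst[symmetric]) simp_all
  finally show 1: "(\<integral>\<^sup>+z. f z \<partial>lborel) = (\<integral>\<^sup>+x. (\<integral>\<^sup>+y. f (Complex x y) \<partial>lborel) \<partial>lborel)" .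
  also have "\<dots> = (\<integral>\<^sup>+y. (\<integral>\<^sup>+x. f (Complex x y) \<partial>lborel) \<partial>lborel)"
    by (rule lborel_pair.Fubini') (simp add: case_prod_unfold)
  finally show "(\<integral>\<^sup>+z. f z \<partial>lborel) = (\<integral>\<^sup>+y. (\<integral>\<^sup>+x. f (Complex x y) \<partial>lborel) \<partial>lborel)" .
qed

text \<open>As \<open>Re c \<noteq> 0\<close>, a rotation is a composition of affine substitutions in one variable each.\<close>

lemma nn_integral_complex_rotation:
  fixes f :: "complex \<Rightarrow> ennreal"
  assumes [measurable]: "f \<in> borel_measurable borel" and c: "cmod c = 1" "Re c \<noteq> 0"
  shows "(\<integral>\<^sup>+z. f (c * z) \<partial>lborel) = (\<integral>\<^sup>+z. f z \<partial>lborel)"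
proof -
  define a b where "a = Re c" and "b = Im c"
  have ab: "a * a + b * b = 1" "a \<noteq> 0"
    using c cmod_power2[of c] by (auto simp: a_def b_def power2_eq_square)
  have [measurable]: "(\<lambda>(x, y). Complex x y) \<in> borel_measurable (lborel \<Otimes>\<^sub>M lborel)"
    unfolding Complex_eq by measurable
  have [measurable]: "Complex x \<in> borel_measurable borel" "(\<lambda>x. Complex x y) \<in> borel_measurable borel" for x y
    unfolding Complex_eq by measurable
  have "(\<integral>\<^sup>+z. f (c * z) \<partial>lborel) = (\<integral>\<^sup>+y. (\<integral>\<^sup>+x. f (Complex (a * x - b * y) (a * y + b * x)) \<partial>lborel) \<partial>lborel)"
    by (subst nn_integral_complex_eq(2))
      (auto intro!: nn_integral_cong arg_cong[of _ _ f] simp: complex_eq_iff a_def b_def)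
  \<comment> \<open>For fixed y, substitute x' = a x - b y; then a y + b x = (b / a) x' + y / a
    because a^2 + b^2 = 1. After the integrals are exchanged, y is rescaled by 1 / a, and the
    factors 1 / |a| and |a| cancel.\<close>
  also have "\<dots> = (\<integral>\<^sup>+y. ennreal (1 / \<bar>a\<bar>) * (\<integral>\<^sup>+x. f (Complex x ((b / a) * x + y / a)) \<partial>lborel) \<partial>lborel)"
  proof (rule nn_integral_cong)
    fix y :: real
    have "(\<integral>\<^sup>+x. f (Complex x ((b / a) * x + y / a)) \<partial>lborel) =
      \<bar>a\<bar> * (\<integral>\<^sup>+x. f (Complex (- b * y + a * x) ((b / a) * (- b * y + a * x) + y / a)) \<partial>lborel)"
      by (rule nn_integral_real_affine) (use ab in \<open>auto simp: Complex_eq\<close>)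
    also have "(\<lambda>x. Complex (- b * y + a * x) ((b / a) * (- b * y + a * x) + y / a)) = (\<lambda>x. Complex (a * x - b * y) (a * y + b * x))"
    proof -
      have "(b / a) * (- b * y + a * x) + y / a = a * y + b * x" for x
      proof -
        have "(b / a) * (- b * y + a * x) + y / a = (y * (1 - b * b) + a * b * x) / a"
          using ab by (simp add: field_simps)
        also have "1 - b * b = a * a" using ab by simp
        finally show ?thesis using ab by (simp add: field_simps)
      qed
      then show ?thesis by auto
    qed
    finally show "(\<integral>\<^sup>+x. f (Complex (a * x - b * y) (a * y + b * x)) \<partial>lborel) =
        ennreal (1 / \<bar>a\<bar>) * (\<integral>\<^sup>+x. f (Complex x ((b / a) * x + y / a)) \<partial>lborel)"
      using ab by (simp add: mult.assoc[symmetric] ennreal_mult'[symmetric])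
  qed
  also have "\<dots> = ennreal (1 / \<bar>a\<bar>) * (\<integral>\<^sup>+y. (\<integral>\<^sup>+x. f (Complex x ((b / a) * x + y / a)) \<partial>lborel) \<partial>lborel)"
    unfolding Complex_eq by (rule nn_integral_cmult) measurable
  also have "(\<integral>\<^sup>+y. (\<integral>\<^sup>+x. f (Complex x ((b / a) * x + y / a)) \<partial>lborel) \<partial>lborel) =
    (\<integral>\<^sup>+x. (\<integral>\<^sup>+y. f (Complex x ((b / a) * x + y / a)) \<partial>lborel) \<partial>lborel)"
    unfolding Complex_eq by (rule lborel_pair.Fubini') measurable
  also have "\<dots> = (\<integral>\<^sup>+x. ennreal \<bar>a\<bar> * (\<integral>\<^sup>+y. f (Complex x y) \<partial>lborel) \<partial>lborel)"
  proof (rule nn_integral_cong)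
    fix x :: real
    have "(\<integral>\<^sup>+y. f (Complex x y) \<partial>lborel) = \<bar>1 / a\<bar> * (\<integral>\<^sup>+y. f (Complex x ((b / a) * x + 1 / a * y)) \<partial>lborel)"
      by (rule nn_integral_real_affine) (use ab in auto)
    then show "(\<integral>\<^sup>+y. f (Complex x ((b / a) * x + y / a)) \<partial>lborel) = ennreal \<bar>a\<bar> * (\<integral>\<^sup>+y. f (Complex x y) \<partial>lborel)"
      using ab by (simp add: mult.assoc[symmetric] ennreal_mult'[symmetric])
  qed
  also have "\<dots> = ennreal \<bar>a\<bar> * (\<integral>\<^sup>+x. (\<integral>\<^sup>+y. f (Complex x y) \<partial>lborel) \<partial>lborel)"
    unfolding Complex_eq by (rule nn_integral_cmult) measurable
  also have "\<dots> = ennreal \<bar>a\<bar> * (\<integral>\<^sup>+z. f z \<partial>lborel)"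
    by (simp add: nn_integral_complex_eq(1))
  finally show ?thesis
    using ab by (simp add: mult.assoc[symmetric] ennreal_mult'[symmetric])
qed

section \<open>Normalised area on the disk: rotations and the distribution of the modulus\<close>

lemma space_area_measure [simp]: "space area_measure = \<D>"
  by (simp add: area_measure_def space_scale_measure space_restrict_space)

lemma sets_area_measure [measurable_cong]: "sets area_measure = sets (restrict_space borel \<D>)"
  by (simp add: area_measure_def sets_restrict_space)

lemma space_disk_measure:
  assumes "sets M = sets (restrict_space borel (S :: complex set))"
  shows "space M = S"
  using sets_eq_imp_space_eq[OF assms] by (simp add: space_restrict_space)

lemma borel_measurable_area_continuous:
  fixes f :: "complex \<Rightarrow> 'a :: topological_space"
  assumes "continuous_on \<D> f"
  shows "f \<in> borel_measurable area_measure"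
  using borel_measurable_continuous_on_restrict[OF assms]
  by (simp cong: measurable_cong_sets[OF sets_area_measure refl])

lemma nn_integral_area:
  assumes [measurable]: "f \<in> borel_measurable area_measure"
  shows "(\<integral>\<^sup>+z. f z \<partial>area_measure) = ennreal (1 / pi) * (\<integral>\<^sup>+z. f z * indicator \<D> z \<partial>lborel)"
proof -
  have [measurable]: "f \<in> borel_measurable (restrict_space lborel \<D>)"
    using assms by (simp add: area_measure_def)
  show ?thesis
    by (simp add: area_measure_def nn_integral_scale_measure nn_integral_restrict_space)
qed

lemma nn_integral_area_rotation:
  assumes f: "f \<in> borel_measurable area_measure" and c: "cmod c = 1" "Re c \<noteq> 0"
  shows "(\<integral>\<^sup>+z. f (c * z) \<partial>area_measure) = (\<integral>\<^sup>+z. f z \<partial>area_measure)"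
proof -
  have fm [measurable]: "(\<lambda>z. f z * indicator \<D> z) \<in> borel_measurable borel"
    using f by (simp add: borel_measurable_restrict_space_iff_ennreal cong: measurable_cong_sets[OF sets_area_measure refl])
  have "(\<lambda>z. c * z) \<in> measurable area_measure area_measure"
    unfolding measurable_cong_sets[OF sets_area_measure sets_area_measure]
    by (rule measurable_restrict_space3) (use c in \<open>auto simp: norm_mult\<close>)
  from measurable_compose[OF this f] have [measurable]: "(\<lambda>z. f (c * z)) \<in> borel_measurable area_measure" .
  have "indicator \<D> z = (indicator \<D> (c * z) :: ennreal)" for z
    using c by (auto simp: indicator_def norm_mult)
  then have "(\<integral>\<^sup>+z. f (c * z) * indicator \<D> z \<partial>lborel) = (\<integral>\<^sup>+z. f z * indicator \<D> z \<partial>lborel)"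
    using nn_integral_complex_rotation[OF fm c] by simp
  then show ?thesis
    using f by (simp add: nn_integral_area)
qed

lemma emeasure_area_ball:
  assumes "0 \<le> r" "r \<le> 1"
  shows "emeasure area_measure (ball 0 r) = ennreal (r\<^sup>2)"
proof -
  have "ball 0 r \<subseteq> (\<D> :: complex set)" using assms by auto
  then have "emeasure area_measure (ball 0 r) = ennreal (1 / pi) * emeasure lborel (ball (0::complex) r)"
    by (simp add: area_measure_def emeasure_scale_measure emeasure_restrict_space)
  also have "emeasure lborel (ball (0::complex) r) = ennreal (pi * r\<^sup>2)"
    using assms by (simp add: emeasure_ball eval_unit_ball_vol)
  finally show ?thesis using assms by (simp add: ennreal_mult'[symmetric])
qed

lemma emeasure_area_cball:
  assumes "0 \<le> r" "r < 1"
  shows "emeasure area_measure (cball 0 r) = ennreal (r\<^sup>2)"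
proof -
  have "cball 0 r \<subseteq> (\<D> :: complex set)" using assms by auto
  then have "emeasure area_measure (cball 0 r) = ennreal (1 / pi) * emeasure lborel (cball (0::complex) r)"
    by (simp add: area_measure_def emeasure_scale_measure emeasure_restrict_space)
  also have "emeasure lborel (cball (0::complex) r) = ennreal (pi * r\<^sup>2)"
    using assms by (simp add: emeasure_cball eval_unit_ball_vol)
  finally show ?thesis using assms by (simp add: ennreal_mult'[symmetric])
qed

lemma finite_measure_area_measure: "finite_measure area_measure"
  by (rule finite_measureI) (use emeasure_area_ball[of 1] in simp)

text \<open>A disk of radius r has normalised area r^2, so the squared modulus is uniformly
  distributed on [0, 1]. For radial integrands this does the work of polar coordinates.\<close>

lemma distr_area_measure_norm:
  "distr area_measure borel (\<lambda>z. (cmod z)\<^sup>2) = density lborel (indicator {0..1})"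
proof (rule measure_eqI_lessThan)
  interpret finite_measure area_measure by (rule finite_measure_area_measure)
  have [measurable]: "(\<lambda>z. (cmod z)\<^sup>2) \<in> borel_measurable area_measure"
    by (intro borel_measurable_area_continuous continuous_intros)
  let ?M = "distr area_measure borel (\<lambda>z. (cmod z)\<^sup>2)"
  have M: "emeasure ?M {x <..} = emeasure area_measure {z \<in> \<D>. x < (cmod z)\<^sup>2}" for x
    by (subst emeasure_distr) (auto intro!: arg_cong[of _ _ "emeasure area_measure"])
  show "emeasure ?M {x <..} < \<infinity>" for x
    unfolding M by (metis emeasure_finite infinity_ennreal_def top.not_eq_extremum)
  fix x :: real
  have N: "emeasure (density lborel (indicator {0..1})) {x <..} = emeasure lborel ({0..1} \<inter> {x<..})"
    by (subst emeasure_density) (auto simp: indicator_inter_arith[symmetric])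
  show "emeasure ?M {x <..} = emeasure (density lborel (indicator {0..1})) {x <..}"
  proof (cases "x < 0"; cases "x < 1")
    assume "x < 0" "x < 1"
    then have "{z \<in> \<D>. x < (cmod z)\<^sup>2} = ball 0 1" "{0..1} \<inter> {x<..} = {0..1}"
      by (auto intro: less_le_trans)
    then show ?thesis unfolding M N using emeasure_area_ball[of 1] by simp
  next
    assume x: "\<not> x < 0" "x < 1"
    have *: "sqrt x \<ge> cmod z \<longleftrightarrow> (cmod z)\<^sup>2 \<le> x" for z
      using real_sqrt_le_iff[of "(cmod z)\<^sup>2" x] by simp
    have "{z \<in> \<D>. x < (cmod z)\<^sup>2} = \<D> - cball 0 (sqrt x)"
      by (auto simp: *)
    moreover have sub: "cball 0 (sqrt x) \<subseteq> (\<D> :: complex set)"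
    proof -
      have "sqrt x < 1" using x by simp
      then show ?thesis by (metis cball_subset_ball_iff less_imp_le dist_self add_0)
    qed
    moreover have "cball 0 (sqrt x) \<in> sets area_measure"
      unfolding sets_area_measure using sub by (subst sets_restrict_space_iff) auto
    ultimately have "emeasure ?M {x<..} = emeasure area_measure \<D> - emeasure area_measure (cball 0 (sqrt x))"
      unfolding M using sets.top[of area_measure] by (simp, subst emeasure_Diff) simp_all
    also have "\<dots> = 1 - ennreal x"
      using x emeasure_area_ball[of 1] emeasure_area_cball[of "sqrt x"] by simp
    also have "\<dots> = ennreal (1 - x)"
      using x by (simp add: ennreal_minus flip: ennreal_1)
    also have "{0..1} \<inter> {x<..} = {x<..1}" using x by auto
    then have "ennreal (1 - x) = emeasure (density lborel (indicator {0..1})) {x <..}"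
      unfolding N using x by simp
    finally show ?thesis .
  next
    assume "\<not> x < 0" "\<not> x < 1"
    moreover have "(cmod z)\<^sup>2 < 1" if "z \<in> \<D>" for z
      using one_minus_norm_bounds(1)[of z] that by simp
    ultimately have "{z \<in> \<D>. x < (cmod z)\<^sup>2} = {}" "{0..1} \<inter> {x<..} = {}"
      by force+
    then show ?thesis unfolding M N by (simp only: emeasure_empty)
  qed simp
qed simp_all

lemma nn_integral_area_radial:
  assumes [measurable]: "g \<in> borel_measurable borel"
  shows "(\<integral>\<^sup>+z. g ((cmod z)\<^sup>2) \<partial>area_measure) = (\<integral>\<^sup>+x. indicator {0..1} x * g x \<partial>lborel)"
proof -
  have [measurable]: "(\<lambda>z. (cmod z)\<^sup>2) \<in> borel_measurable area_measure"
    by (intro borel_measurable_area_continuous continuous_intros)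
  have "(\<integral>\<^sup>+z. g ((cmod z)\<^sup>2) \<partial>area_measure) = (\<integral>\<^sup>+x. g x \<partial>distr area_measure borel (\<lambda>z. (cmod z)\<^sup>2))"
    by (subst nn_integral_distr) auto
  also have "\<dots> = (\<integral>\<^sup>+x. indicator {0..1} x * g x \<partial>lborel)"
    unfolding distr_area_measure_norm by (subst nn_integral_density) auto
  finally show ?thesis .
qed

section \<open>Weighted area measures, their moments, and orthogonality of monomials\<close>

lemma space_weighted_area [simp]: "space (weighted_area \<alpha>) = \<D>"
  by (simp add: weighted_area_def)

lemma sets_weighted_area [measurable_cong]: "sets (weighted_area \<alpha>) = sets (restrict_space borel \<D>)"
  by (simp add: weighted_area_def sets_area_measure)

lemma borel_measurable_weight [measurable]: "weight \<alpha> \<in> borel_measurable borel"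
  unfolding weight_def by measurable

lemma borel_measurable_weight_area [measurable]: "weight \<alpha> \<in> borel_measurable area_measure"
  by (simp add: measurable_restrict_space1 cong: measurable_cong_sets[OF sets_area_measure refl])

lemma weight_nonneg: "\<alpha> > -1 \<Longrightarrow> weight \<alpha> z \<ge> 0"
  by (simp add: weight_def)

lemma nn_integral_weighted_area:
  assumes "f \<in> borel_measurable area_measure"
  shows "(\<integral>\<^sup>+z. f z \<partial>weighted_area \<alpha>) = (\<integral>\<^sup>+z. ennreal (weight \<alpha> z) * f z \<partial>area_measure)"
  unfolding weighted_area_def by (rule nn_integral_density) (use assms in auto)

text \<open>In the variable |z|^2 this is (1 + \<alpha>) B(k + 1, \<alpha> + 1), and the Gamma
  factors collapse to the reciprocal of the k-th coefficient of the kernel of order 2 + \<alpha>.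
  That reciprocity is what makes this kernel reproducing.\<close>

lemma nn_integral_weighted_area_moment:
  assumes "\<alpha> > -1"
  shows "(\<integral>\<^sup>+z. ennreal (cmod z ^ (2 * k)) \<partial>weighted_area \<alpha>) = ennreal (fact k / pochhammer (\<alpha> + 2) k)"
proof -
  have nz: "\<alpha> + 1 \<notin> \<int>\<^sub>\<le>\<^sub>0" "\<alpha> + 2 \<notin> \<int>\<^sub>\<le>\<^sub>0"
    using assms by (auto elim!: nonpos_Ints_cases)
  have "(\<integral>\<^sup>+z. ennreal (cmod z ^ (2 * k)) \<partial>weighted_area \<alpha>) =
    (\<integral>\<^sup>+z. ennreal ((1 + \<alpha>) * (((cmod z)\<^sup>2) ^ k * (1 - (cmod z)\<^sup>2) powr \<alpha>)) \<partial>area_measure)"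
  proof (subst nn_integral_weighted_area)
    show "(\<lambda>z. ennreal (cmod z ^ (2 * k))) \<in> borel_measurable area_measure"
      by (intro measurable_compose[OF _ measurable_ennreal] borel_measurable_area_continuous continuous_intros)
  qed (use assms in \<open>auto intro!: nn_integral_cong simp: weight_def ennreal_mult'[symmetric] power_mult power2_eq_square power_mult_distrib mult_ac\<close>)
  also have "\<dots> = (\<integral>\<^sup>+x. indicator {0..1} x * ennreal ((1 + \<alpha>) * (x ^ k * (1 - x) powr \<alpha>)) \<partial>lborel)"
    by (rule nn_integral_area_radial) measurable
  also have "\<dots> = ennreal ((1 + \<alpha>) * Beta (real k + 1) (\<alpha> + 1))"
  proof -
    have "((\<lambda>t. t powr (real k) * (1 - t) powr \<alpha>) has_integral Beta (real k + 1) (\<alpha> + 1)) {0<..<1}"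
      using has_integral_Beta_real[of "real k + 1" "\<alpha> + 1"] assms by (simp add: has_integral_Icc_iff_Ioo)
    then have "((\<lambda>t. t ^ k * (1 - t) powr \<alpha>) has_integral Beta (real k + 1) (\<alpha> + 1)) {0<..<1}"
      by (rule has_integral_eq[rotated]) (auto simp: powr_realpow)
    then have "((\<lambda>t. (1 + \<alpha>) * (t ^ k * (1 - t) powr \<alpha>)) has_integral (1 + \<alpha>) * Beta (real k + 1) (\<alpha> + 1)) {0..1}"
      by (intro has_integral_mult_right) (simp add: has_integral_Icc_iff_Ioo)
    then have "((\<lambda>t. if t \<in> {0..1} then (1 + \<alpha>) * (t ^ k * (1 - t) powr \<alpha>) else 0) has_integral (1 + \<alpha>) * Beta (real k + 1) (\<alpha> + 1)) UNIV"
      by (simp only: has_integral_restrict_UNIV)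
    then have "(\<integral>\<^sup>+x. ennreal (if x \<in> {0..1} then (1 + \<alpha>) * (x ^ k * (1 - x) powr \<alpha>) else 0) \<partial>lborel) =
       ennreal ((1 + \<alpha>) * Beta (real k + 1) (\<alpha> + 1))"
      by (intro nn_integral_has_integral_lborel) (use assms in auto)
    then show ?thesis
      by (rule trans[rotated]) (auto intro!: nn_integral_cong simp: indicator_def)
  qed
  also have "(1 + \<alpha>) * Beta (real k + 1) (\<alpha> + 1) = fact k / pochhammer (\<alpha> + 2) k"
  proof -
    have "Gamma (\<alpha> + 2) = (\<alpha> + 1) * Gamma (\<alpha> + 1)"
      using Gamma_plus1[OF nz(1)] by (simp add: add.assoc)
    moreover have "pochhammer (\<alpha> + 2) k = Gamma (\<alpha> + 2 + real k) / Gamma (\<alpha> + 2)"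
      using nz(2) by (rule pochhammer_Gamma)
    moreover have pos: "Gamma (\<alpha> + 1) > 0" "Gamma (\<alpha> + 2) > 0" "pochhammer (\<alpha> + 2) k > 0"
      using assms by (auto intro!: Gamma_real_pos pochhammer_pos)
    moreover have "real k + 1 + (\<alpha> + 1) = \<alpha> + 2 + real k" by simp
    ultimately have eq: "Gamma (real k + 1 + (\<alpha> + 1)) = pochhammer (\<alpha> + 2) k * ((\<alpha> + 1) * Gamma (\<alpha> + 1))"
      by (metis less_irrefl nonzero_eq_divide_eq)
    have "Gamma (real k + 1) = fact k"
      using Gamma_fact[of k, where 'a=real] by (simp add: add.commute)
    then show ?thesis
      unfolding Beta_def eq using assms pos less_imp_neq[OF pos(1)] by (simp add: add.commute)
  qed
  finally show ?thesis .
qed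

lemma emeasure_weighted_area_disk: "\<alpha> > -1 \<Longrightarrow> emeasure (weighted_area \<alpha>) \<D> = 1"
  using nn_integral_weighted_area_moment[of \<alpha> 0] by simp

lemma finite_measure_weighted_area: "\<alpha> > -1 \<Longrightarrow> finite_measure (weighted_area \<alpha>)"
  by (rule finite_measureI) (simp add: emeasure_weighted_area_disk)

text \<open>The weight is radial, so invariance of area suffices. The condition on
  \<open>Re c\<close> is inherited from the affine substitutions behind the rotation of area;
  rotations by small angles are enough for orthogonality.\<close>

lemma distr_weighted_area_rotation:
  assumes c: "cmod c = 1" "Re c \<noteq> 0"
  shows "distr (weighted_area \<alpha>) (weighted_area \<alpha>) (\<lambda>z. c * z) = weighted_area \<alpha>"
proof (rule measure_eqI)
  fix A assume "A \<in> sets (distr (weighted_area \<alpha>) (weighted_area \<alpha>) (\<lambda>z. c * z))"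
  then have A: "A \<in> sets area_measure" by (simp add: sets_weighted_area sets_area_measure)
  have m: "(\<lambda>z. c * z) \<in> measurable area_measure area_measure"
    unfolding measurable_cong_sets[OF sets_area_measure sets_area_measure]
    by (rule measurable_restrict_space3) (use c in \<open>auto simp: norm_mult\<close>)
  have i [measurable]: "(\<lambda>z. indicator A z :: ennreal) \<in> borel_measurable area_measure"
    using A by simp
  note [measurable] = measurable_compose[OF m i]
  have "emeasure (distr (weighted_area \<alpha>) (weighted_area \<alpha>) (\<lambda>z. c * z)) A
      = (\<integral>\<^sup>+z. indicator A z \<partial>distr (weighted_area \<alpha>) (weighted_area \<alpha>) (\<lambda>z. c * z))"
    using A by (simp add: sets_weighted_area sets_area_measure)
  also have "\<dots> = (\<integral>\<^sup>+z. indicator A (c * z) \<partial>weighted_area \<alpha>)"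
    by (rule nn_integral_distr) (use m i in \<open>simp_all add: weighted_area_def\<close>)
  also have "\<dots> = (\<integral>\<^sup>+z. ennreal (weight \<alpha> z) * indicator A (c * z) \<partial>area_measure)"
    by (rule nn_integral_weighted_area) measurable
  also have "\<dots> = (\<integral>\<^sup>+z. ennreal (weight \<alpha> (c * z)) * indicator A (c * z) \<partial>area_measure)"
    using c by (simp add: weight_def norm_mult)
  also have "\<dots> = (\<integral>\<^sup>+z. ennreal (weight \<alpha> z) * indicator A z \<partial>area_measure)"
    by (rule nn_integral_area_rotation[OF _ c]) measurable
  also have "\<dots> = (\<integral>\<^sup>+z. indicator A z \<partial>weighted_area \<alpha>)"
    by (rule nn_integral_weighted_area[symmetric]) measurable
  finally show "emeasure (distr (weighted_area \<alpha>) (weighted_area \<alpha>) (\<lambda>z. c * z)) A = emeasure (weighted_area \<alpha>) A"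
    using A by (simp add: sets_weighted_area sets_area_measure)
qed simp

lemma borel_measurable_cnj [measurable]: "cnj \<in> borel_measurable borel"
  by (intro borel_measurable_continuous_onI continuous_intros)

lemma ball_in_sets_borel [measurable]: "ball (x :: complex) r \<in> sets borel"
  by simp

lemma borel_measurable_weighted_iff:
  "f \<in> borel_measurable (weighted_area \<alpha>) \<longleftrightarrow> f \<in> borel_measurable area_measure"
  by (simp add: weighted_area_def)

lemma borel_measurable_weighted_continuous:
  fixes f :: "complex \<Rightarrow> 'a :: topological_space"
  assumes "continuous_on \<D> f"
  shows "f \<in> borel_measurable (weighted_area \<alpha>)"
  using borel_measurable_area_continuous[OF assms] by (simp add: borel_measurable_weighted_iff)

lemma borel_measurable_weighted_borel:
  assumes "f \<in> borel_measurable borel"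
  shows "f \<in> borel_measurable (weighted_area \<alpha>)"
  using assms by (simp add: measurable_restrict_space1 cong: measurable_cong_sets[OF sets_weighted_area refl])

lemma integrable_weighted_area_bounded:
  fixes f :: "complex \<Rightarrow> complex"
  assumes "\<alpha> > -1" "f \<in> borel_measurable (weighted_area \<alpha>)" "\<And>u. u \<in> \<D> \<Longrightarrow> cmod (f u) \<le> B"
  shows "integrable (weighted_area \<alpha>) f"
proof -
  interpret finite_measure "weighted_area \<alpha>" by (rule finite_measure_weighted_area[OF assms(1)])
  show ?thesis
    by (rule integrable_const_bound[of _ B]) (use assms in auto)
qed

lemma measure_weighted_area_disk: "\<alpha> > -1 \<Longrightarrow> measure (weighted_area \<alpha>) \<D> = 1"
  by (simp add: measure_def emeasure_weighted_area_disk)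

text \<open>Weierstrass majorant: the weighted measure has total mass 1, so \<open>c k\<close> also
  bounds the integral of the modulus of the k-th term.\<close>

lemma integral_weighted_area_suminf:
  fixes f :: "nat \<Rightarrow> complex \<Rightarrow> complex"
  assumes "\<alpha> > -1" and f: "\<And>k. f k \<in> borel_measurable (weighted_area \<alpha>)"
    and c: "summable c" "\<And>k u. u \<in> \<D> \<Longrightarrow> cmod (f k u) \<le> c k"
  shows "(\<lambda>k. \<integral>u. f k u \<partial>weighted_area \<alpha>) sums (\<integral>u. (\<Sum>k. f k u) \<partial>weighted_area \<alpha>)"
proof (rule sums_integral)
  interpret finite_measure "weighted_area \<alpha>" by (rule finite_measure_weighted_area[OF assms(1)])
  show int: "integrable (weighted_area \<alpha>) (f k)" for k
    by (rule integrable_weighted_area_bounded[OF assms(1) f c(2)])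
  have "summable (\<lambda>k. cmod (f k u))" if "u \<in> \<D>" for u
    by (rule summable_comparison_test'[OF c(1), of 0]) (use c(2)[OF that] in auto)
  then show "AE u in weighted_area \<alpha>. summable (\<lambda>k. cmod (f k u))"
    by (intro AE_I2) simp
  have "(\<integral>u. cmod (f k u) \<partial>weighted_area \<alpha>) \<le> (\<integral>u. c k \<partial>weighted_area \<alpha>)" for k
    by (intro integral_mono integrable_norm int) (use c in auto)
  then have "(\<integral>u. cmod (f k u) \<partial>weighted_area \<alpha>) \<le> c k" for k
    using measure_weighted_area_disk[OF assms(1)] by simp
  then show "summable (\<lambda>k. \<integral>u. cmod (f k u) \<partial>weighted_area \<alpha>)"
    by (intro summable_comparison_test'[OF c(1), of 0]) simp
qed

text \<open>Moments over a smaller ball are needed because the Taylor series of a general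
  holomorphic function converges uniformly only there; r tends to 1 afterwards.\<close>

definition trunc_moment :: "real \<Rightarrow> real \<Rightarrow> nat \<Rightarrow> real" where
  "trunc_moment \<alpha> r k = (\<integral>u. indicator (ball 0 r) u * cmod u ^ (2 * k) \<partial>weighted_area \<alpha>)"

text \<open>A rotation by c leaves the measure and the ball alone and multiplies the integrand by
  \<open>c ^ j * cnj c ^ k\<close>, so the integral vanishes as soon as that factor differs from
  1.\<close>

lemma integral_weighted_area_orthogonal:
  assumes "\<alpha> > -1"
  shows "(\<integral>u. indicator (ball 0 r) u * (u ^ j * cnj u ^ k) \<partial>weighted_area \<alpha>) =
     (if j = k then complex_of_real (trunc_moment \<alpha> r k) else 0)"
proof (cases "j = k")
  case True
  have "indicator (ball 0 r) u * (u ^ k * cnj u ^ k) = complex_of_real (indicator (ball 0 r) u * cmod u ^ (2 * k))" for u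
    by (simp add: power_mult of_real_indicator flip: power_mult_distrib complex_norm_square)
  then show ?thesis
    using True by (simp only: integral_complex_of_real trunc_moment_def) simp
next
  case False
  \<comment> \<open>This angle makes the factor equal to \<open>cis 1\<close> for all j and k. Its
    modulus is at most 1, hence below pi / 2, so \<open>Re c\<close> is positive as the rotation
    lemma requires.\<close>
  define \<theta> where "\<theta> = 1 / (real j - real k)"
  define c where "c = cis \<theta>"
  have "\<bar>real j - real k\<bar> \<ge> 1" using False by linarith
  then have "\<bar>\<theta>\<bar> \<le> 1" by (simp add: \<theta>_def)
  then have "cos \<theta> > 0" using pi_gt3 by (intro cos_gt_zero_pi) auto
  then have c: "cmod c = 1" "Re c \<noteq> 0" by (auto simp: c_def)
  let ?W = "weighted_area \<alpha>"
  let ?F = "\<lambda>u. indicator (ball 0 r) u * (u ^ j * cnj u ^ k) :: complex"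
  have m: "(\<lambda>u. c * u) \<in> measurable ?W ?W"
    unfolding measurable_cong_sets[OF sets_weighted_area sets_weighted_area]
    by (rule measurable_restrict_space3) (use c in \<open>auto simp: norm_mult\<close>)
  have F: "?F \<in> borel_measurable ?W"
    by (rule borel_measurable_weighted_borel) measurable
  have "(\<integral>u. ?F u \<partial>?W) = (\<integral>u. ?F u \<partial>distr ?W ?W (\<lambda>u. c * u))"
    using distr_weighted_area_rotation[OF c] by simp
  also have "\<dots> = (\<integral>u. ?F (c * u) \<partial>?W)"
    by (rule integral_distr[OF m F])
  also have "?F (c * u) = (c ^ j * cnj c ^ k) * ?F u" for u
    using c by (auto simp: indicator_def norm_mult power_mult_distrib)
  then have "(\<integral>u. ?F (c * u) \<partial>?W) = (\<integral>u. (c ^ j * cnj c ^ k) * ?F u \<partial>?W)"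
    by simp
  also have "\<dots> = (c ^ j * cnj c ^ k) * (\<integral>u. ?F u \<partial>?W)"
    by simp
  also have "c ^ j * cnj c ^ k = cis 1"
    using False by (simp add: c_def Complex.DeMoivre cis_mult \<theta>_def cis_cnj diff_divide_distrib[symmetric])
  finally have "(\<integral>u. ?F u \<partial>?W) * (1 - cis 1) = 0"
    by (simp add: algebra_simps)
  moreover have "cis 1 \<noteq> 1"
  proof
    assume "cis 1 = 1"
    then have "cos (1::real) = 1" by (metis cis.sel(1) one_complex.sel(1))
    then show False using cos_monotone_0_pi[of 0 1] pi_gt3 by simp
  qed
  ultimately show ?thesis using False by simp
qed

lemma trunc_moment_nonneg: "trunc_moment \<alpha> r k \<ge> 0"
  unfolding trunc_moment_def by (intro integral_nonneg_AE) simp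

lemma trunc_moment_1:
  assumes "\<alpha> > -1"
  shows "trunc_moment \<alpha> 1 k = fact k / pochhammer (\<alpha> + 2) k"
proof -
  have "trunc_moment \<alpha> 1 k = (\<integral>u. cmod u ^ (2 * k) \<partial>weighted_area \<alpha>)"
    unfolding trunc_moment_def by (rule Bochner_Integration.integral_cong) auto
  also have "\<dots> = enn2real (\<integral>\<^sup>+u. ennreal (cmod u ^ (2 * k)) \<partial>weighted_area \<alpha>)"
    by (rule integral_eq_nn_integral) (auto intro!: borel_measurable_weighted_borel)
  also have "\<dots> = fact k / pochhammer (\<alpha> + 2) k"
    unfolding nn_integral_weighted_area_moment[OF assms]
    using assms by (intro enn2real_ennreal divide_nonneg_nonneg less_imp_le[OF pochhammer_pos]) auto
  finally show ?thesis .
qed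

lemma trunc_moment_le:
  assumes "\<alpha> > -1" "r \<le> 1"
  shows "trunc_moment \<alpha> r k \<le> fact k / pochhammer (\<alpha> + 2) k"
proof -
  interpret finite_measure "weighted_area \<alpha>" by (rule finite_measure_weighted_area[OF assms(1)])
  have int: "integrable (weighted_area \<alpha>) (\<lambda>u. indicator (ball 0 s) u * cmod u ^ (2 * k) :: real)" for s
    by (rule integrable_const_bound[of _ 1])
      (auto intro!: borel_measurable_weighted_borel mult_le_one power_le_one simp: indicator_def)
  have "trunc_moment \<alpha> r k \<le> trunc_moment \<alpha> 1 k"
    unfolding trunc_moment_def
    by (intro integral_mono int) (use assms in \<open>auto simp: indicator_def\<close>)
  then show ?thesis using trunc_moment_1[OF assms(1)] by simp
qed

text \<open>Parseval on a ball. Absolute convergence at radius r permits two interchanges of sum and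
  integral, first for the series of b against a single monomial, then for the series of a. The case
  r = 1 covers absolutely summable coefficients.\<close>

lemma integral_weighted_area_power_series:
  fixes a b :: "nat \<Rightarrow> complex"
  assumes "\<alpha> > -1" "0 < r" "r \<le> 1"
    and a: "summable (\<lambda>k. cmod (a k) * r ^ k)" and b: "summable (\<lambda>k. cmod (b k) * r ^ k)"
  shows "(\<lambda>k. a k * cnj (b k) * trunc_moment \<alpha> r k) sums
    (\<integral>u. indicator (ball 0 r) u * ((\<Sum>k. a k * u ^ k) * cnj (\<Sum>k. b k * u ^ k)) \<partial>weighted_area \<alpha>)"
proof -
  let ?W = "weighted_area \<alpha>"
  let ?I = "\<lambda>u. indicator (ball 0 r) u :: complex"
  let ?G = "\<lambda>u. \<Sum>k. b k * u ^ k"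
  have I: "?I \<in> borel_measurable ?W"
    by (intro borel_measurable_weighted_borel borel_measurable_indicator) auto
  have bound: "cmod (x * u ^ k) \<le> cmod x * r ^ k" if "u \<in> ball 0 r" for x u k
    using that by (auto simp: norm_mult norm_power intro!: mult_left_mono power_mono)
  have sumG: "summable (\<lambda>k. cmod (b k * u ^ k))" if "u \<in> ball 0 r" for u
    by (rule summable_comparison_test'[OF b, of 0]) (use bound[OF that] in auto)
  have sumF: "summable (\<lambda>k. cmod (a k * u ^ k))" if "u \<in> ball 0 r" for u
    by (rule summable_comparison_test'[OF a, of 0]) (use bound[OF that] in auto)
  define B where "B = (\<Sum>k. cmod (b k) * r ^ k)"
  have "B \<ge> 0" unfolding B_def by (intro suminf_nonneg b) (use assms in auto)
  have G_le: "cmod (?G u) \<le> B" if "u \<in> ball 0 r" for u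
  proof -
    have "cmod (?G u) \<le> (\<Sum>k. cmod (b k * u ^ k))"
      by (rule summable_norm[OF sumG[OF that]])
    also have "\<dots> \<le> B" unfolding B_def
      by (intro suminf_le sumG b bound that)
    finally show ?thesis .
  qed
  \<comment> \<open>For a fixed monomial, orthogonality leaves the single term k = j.\<close>
  have step: "(\<integral>u. ?I u * (a j * u ^ j * cnj (?G u)) \<partial>?W) = a j * cnj (b j) * trunc_moment \<alpha> r j" for j
  proof -
    have "(\<lambda>k. \<integral>u. ?I u * (a j * u ^ j * cnj (b k * u ^ k)) \<partial>?W) sums
        (\<integral>u. (\<Sum>k. ?I u * (a j * u ^ j * cnj (b k * u ^ k))) \<partial>?W)"
    proof (rule integral_weighted_area_suminf[OF assms(1)])
      show "(\<lambda>u. ?I u * (a j * u ^ j * cnj (b k * u ^ k))) \<in> borel_measurable ?W" for k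
        by (rule borel_measurable_weighted_borel) measurable
      show "summable (\<lambda>k. cmod (a j) * r ^ j * (cmod (b k) * r ^ k))"
        by (intro summable_mult b)
      show "cmod (?I u * (a j * u ^ j * cnj (b k * u ^ k))) \<le> cmod (a j) * r ^ j * (cmod (b k) * r ^ k)" if "u \<in> \<D>" for k u
      proof (cases "u \<in> ball 0 r")
        case True
        have "cmod (a j * u ^ j) * cmod (b k * u ^ k) \<le> (cmod (a j) * r ^ j) * (cmod (b k) * r ^ k)"
          by (intro mult_mono bound True) (use assms in auto)
        then show ?thesis using True by (simp add: norm_mult norm_power)
      qed (use assms in auto)
    qed
    moreover have "(\<integral>u. ?I u * (a j * u ^ j * cnj (b k * u ^ k)) \<partial>?W) =
       (if k = j then a j * cnj (b j) * trunc_moment \<alpha> r j else 0)" for k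
    proof -
      have "(\<integral>u. ?I u * (a j * u ^ j * cnj (b k * u ^ k)) \<partial>?W) =
         (\<integral>u. (a j * cnj (b k)) * (?I u * (u ^ j * cnj u ^ k)) \<partial>?W)"
        by (simp add: mult_ac)
      also have "\<dots> = (a j * cnj (b k)) * (\<integral>u. ?I u * (u ^ j * cnj u ^ k) \<partial>?W)"
        by simp
      finally show ?thesis
        unfolding integral_weighted_area_orthogonal[OF assms(1)] by auto
    qed
    ultimately have "(\<lambda>k. if k = j then a j * cnj (b j) * trunc_moment \<alpha> r j else 0) sums
        (\<integral>u. (\<Sum>k. ?I u * (a j * u ^ j * cnj (b k * u ^ k))) \<partial>?W)"
      by simp
    then have "(\<integral>u. (\<Sum>k. ?I u * (a j * u ^ j * cnj (b k * u ^ k))) \<partial>?W) = a j * cnj (b j) * trunc_moment \<alpha> r j"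
      by (rule sums_unique2[OF _ sums_single[of j "\<lambda>_. a j * cnj (b j) * trunc_moment \<alpha> r j"]])
    moreover have "(\<Sum>k. ?I u * (a j * u ^ j * cnj (b k * u ^ k))) = ?I u * (a j * u ^ j * cnj (?G u))" for u
    proof (cases "u \<in> ball 0 r")
      case True
      have "(\<lambda>k. b k * u ^ k) sums ?G u"
        using sumG[OF True] by (simp add: summable_norm_cancel summable_sums)
      then have "(\<lambda>k. cnj (b k * u ^ k)) sums cnj (?G u)"
        by (simp only: sums_cnj)
      from sums_mult[OF this, of "a j * u ^ j"] show ?thesis
        using True by (simp add: sums_iff)
    qed simp
    ultimately show ?thesis by simp
  qed
  have "(\<lambda>k. \<integral>u. ?I u * (a k * u ^ k * cnj (?G u)) \<partial>?W) sums
      (\<integral>u. (\<Sum>k. ?I u * (a k * u ^ k * cnj (?G u))) \<partial>?W)"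
  proof (rule integral_weighted_area_suminf[OF assms(1)])
    show "(\<lambda>u. ?I u * (a k * u ^ k * cnj (?G u))) \<in> borel_measurable ?W" for k
      by (rule borel_measurable_weighted_borel) measurable
    show "summable (\<lambda>k. cmod (a k) * r ^ k * B)"
      by (intro summable_mult2 a)
    show "cmod (?I u * (a k * u ^ k * cnj (?G u))) \<le> cmod (a k) * r ^ k * B" if "u \<in> \<D>" for k u
    proof (cases "u \<in> ball 0 r")
      case True
      have "cmod (a k * u ^ k) * cmod (?G u) \<le> (cmod (a k) * r ^ k) * B"
        by (intro mult_mono bound G_le True) (use assms in auto)
      then show ?thesis using True by (simp add: norm_mult norm_power)
    qed (use assms \<open>B \<ge> 0\<close> in auto)
  qed
  moreover have "(\<Sum>k. ?I u * (a k * u ^ k * cnj (?G u))) = ?I u * ((\<Sum>k. a k * u ^ k) * cnj (?G u))" for u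
  proof (cases "u \<in> ball 0 r")
    case True
    have "(\<lambda>k. a k * u ^ k) sums (\<Sum>k. a k * u ^ k)"
      using sumF[OF True] by (simp add: summable_norm_cancel summable_sums)
    from sums_mult2[OF this, of "cnj (?G u)"] show ?thesis
      using True by (simp add: sums_iff)
  qed simp
  ultimately show ?thesis unfolding step by simp
qed

subsection \<open>Forelli--Rudin estimates and the reproducing formula\<close>

text \<open>Factor by factor, ((a + b) / 2 + j)^2 exceeds (a + j)(b + j) by ((a - b) / 2)^2, a
  relative excess \<open>e j\<close> of order 1 / j^2. The product of the \<open>1 + e j\<close> is
  therefore bounded by the exponential of a convergent sum. This replaces Stirling's formula in
  comparing coefficients.\<close>

lemma pochhammer_square_le:
  fixes a b :: real
  assumes "a > 0" "b > 0"
  obtains C where "C > 0" "\<And>k. (pochhammer ((a + b) / 2) k)\<^sup>2 \<le> C * (pochhammer a k * pochhammer b k)"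
proof -
  define e where "e j = ((a - b) / 2)\<^sup>2 / ((a + real j) * (b + real j))" for j :: nat
  have e0: "e j \<ge> 0" for j using assms by (simp add: e_def)
  have sum: "summable e"
  proof (rule summable_comparison_test')
    show "summable (\<lambda>j. ((a - b) / 2)\<^sup>2 * inverse (real j ^ 2))"
      by (intro summable_mult inverse_power_summable) auto
    fix j :: nat assume j: "j \<ge> 1"
    have "real j ^ 2 \<le> (a + real j) * (b + real j)"
      unfolding power2_eq_square using assms by (intro mult_mono) auto
    then have "inverse ((a + real j) * (b + real j)) \<le> inverse (real j ^ 2)"
      using j by (intro le_imp_inverse_le) auto
    then have "e j \<le> ((a - b) / 2)\<^sup>2 * inverse (real j ^ 2)"
      unfolding e_def divide_inverse[of _ "(a + real j) * (b + real j)"] by (rule mult_left_mono) (rule zero_le_power2)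
    then show "norm (e j) \<le> ((a - b) / 2)\<^sup>2 * inverse (real j ^ 2)"
      using e0[of j] by (simp only: real_norm_def abs_of_nonneg)
  qed
  have eq: "(pochhammer ((a + b) / 2) k)\<^sup>2 = (\<Prod>j<k. 1 + e j) * (pochhammer a k * pochhammer b k)" for k
  proof (induction k)
    case (Suc k)
    have "((a + b) / 2 + real k)\<^sup>2 = (1 + e k) * ((a + real k) * (b + real k))"
    proof -
      have nz: "(a + real k) * (b + real k) \<noteq> 0" using assms by simp
      have "(1 + e k) * ((a + real k) * (b + real k)) = (a + real k) * (b + real k) + ((a - b) / 2)\<^sup>2"
        unfolding e_def using nz by (metis distrib_right mult_1 nonzero_eq_divide_eq)
      then show ?thesis by (simp add: power2_eq_square field_simps)
    qed
    then show ?case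
      unfolding pochhammer_Suc power_mult_distrib Suc prod.lessThan_Suc by (simp add: mult_ac)
  qed simp
  show thesis
  proof
    show "exp (suminf e) > 0" by simp
    fix k
    have "(\<Prod>j<k. 1 + e j) \<le> exp (sum e {..<k})"
      by (rule prod_le_exp_sum) (rule e0)
    also have "\<dots> \<le> exp (suminf e)"
      using sum_le_suminf[OF sum] e0 by simp
    finally show "(pochhammer ((a + b) / 2) k)\<^sup>2 \<le> exp (suminf e) * (pochhammer a k * pochhammer b k)"
      unfolding eq using assms by (intro mult_right_mono mult_nonneg_nonneg pochhammer_nonneg) auto
  qed
qed

text \<open>Conjugating \<open>kernel_sums\<close> exchanges the variables: u may range over the
  closed disk, while |z| < 1 keeps the coefficients absolutely summable for s > 0.\<close>

lemma kernel_power_series: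
  assumes "cmod z < 1" "cmod u \<le> 1"
  shows "kernel s u z = (\<Sum>k. complex_of_real (pochhammer s k / fact k) * cnj z ^ k * u ^ k)"
proof -
  have "(\<lambda>k. cnj (of_real (pochhammer s k / fact k) * (z * cnj u) ^ k)) sums cnj (kernel s z u)"
    using kernel_sums[OF assms, of s] by (simp only: sums_cnj)
  moreover have "cnj (of_real (pochhammer s k / fact k) * (z * cnj u) ^ k) =
      complex_of_real (pochhammer s k / fact k) * cnj z ^ k * u ^ k" for k
    by (simp add: power_mult_distrib)
  ultimately show ?thesis
    by (simp only: cnj_kernel[OF assms] sums_unique)
qed

lemma summable_norm_kernel_power_series:
  assumes "cmod z < 1" "s > 0"
  shows "summable (\<lambda>k. cmod (complex_of_real (pochhammer s k / fact k) * cnj z ^ k))"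
  using summable_kernel_coeffs(1)[of "cmod z" s] assms
  by (simp add: norm_mult norm_power norm_divide pochhammer_nonneg)

text \<open>Parseval turns the integral into a power series in \<open>\<bar>z\<bar>\<^sup>2\<close>, whose coefficients are
  compared with those of \<open>(1 - x) powr - b\<close>.\<close>

lemma Forelli_Rudin:
  assumes "\<alpha> > -1" "b > 0"
  obtains C where "C > 0" "\<And>z. cmod z < 1 \<Longrightarrow>
    (\<integral>\<^sup>+u. ennreal (cmod (kernel (2 + \<alpha> + b) z u)) \<partial>weighted_area \<alpha>) \<le> ennreal (C * (1 - (cmod z)\<^sup>2) powr - b)"
proof -
  \<comment> \<open>Half the order, so that the modulus of the kernel is a square and Parseval
    applies. It is also the arithmetic mean of 2 + \<alpha> and b, which is the situation of
    \<open>pochhammer_square_le\<close>.\<close>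
  define s where "s = (2 + \<alpha> + b) / 2"
  obtain C where C: "C > 0" "\<And>k. (pochhammer ((2 + \<alpha> + b) / 2) k)\<^sup>2 \<le> C * (pochhammer (2 + \<alpha>) k * pochhammer b k)"
    using pochhammer_square_le[of "2 + \<alpha>" b] assms by auto
  have s: "s > 0" using assms by (simp add: s_def)
  show thesis
  proof
    fix z assume z: "cmod z < 1"
    let ?W = "weighted_area \<alpha>"
    define a where "a k = complex_of_real (pochhammer s k / fact k) * cnj z ^ k" for k
    have e: "2 + \<alpha> + b = s + s" by (simp add: s_def)
    have nsq: "cmod (kernel (2 + \<alpha> + b) z u) = (cmod (kernel s u z))\<^sup>2" for u
      by (simp only: e norm_kernel norm_one_minus_mult_cnj_commute[of u] minus_add_distrib powr_add power2_eq_square)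
    have m: "(\<lambda>u. kernel s u z) \<in> borel_measurable ?W"
      by (rule borel_measurable_weighted_continuous[OF continuous_on_kernel1]) (use z in auto)
    have b: "cmod (kernel s u z) \<le> (1 - cmod z) powr - s" if "u \<in> \<D>" for u
      using norm_kernel_le'[of z u s] that z s by simp
    have int: "integrable ?W (\<lambda>u. kernel s u z * cnj (kernel s u z))"
    proof (rule integrable_weighted_area_bounded[OF assms(1)])
      show "(\<lambda>u. kernel s u z * cnj (kernel s u z)) \<in> borel_measurable ?W"
        using m by measurable
      show "cmod (kernel s u z * cnj (kernel s u z)) \<le> (1 - cmod z) powr - s * (1 - cmod z) powr - s" if "u \<in> \<D>" for u
        unfolding norm_mult complex_mod_cnj using b[OF that] by (intro mult_mono) auto
    qed
    have "(\<lambda>k. a k * cnj (a k) * trunc_moment \<alpha> 1 k) sums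
       (\<integral>u. indicator (ball 0 1) u * ((\<Sum>k. a k * u ^ k) * cnj (\<Sum>k. a k * u ^ k)) \<partial>?W)"
      by (rule integral_weighted_area_power_series)
        (use summable_norm_kernel_power_series[OF z s] assms in \<open>auto simp: a_def\<close>)
    also have "(\<integral>u. indicator (ball 0 1) u * ((\<Sum>k. a k * u ^ k) * cnj (\<Sum>k. a k * u ^ k)) \<partial>?W) =
       (\<integral>u. kernel s u z * cnj (kernel s u z) \<partial>?W)"
      by (rule Bochner_Integration.integral_cong) (use kernel_power_series[OF z, of _ s] in \<open>auto simp: a_def\<close>)
    also have "\<dots> = complex_of_real (\<integral>u. (cmod (kernel s u z))\<^sup>2 \<partial>?W)"
      by (simp only: complex_norm_square[symmetric] integral_complex_of_real)
    finally have "(\<lambda>k. complex_of_real ((pochhammer s k / fact k)\<^sup>2 * ((cmod z)\<^sup>2) ^ k * trunc_moment \<alpha> 1 k)) sums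
       complex_of_real (\<integral>u. (cmod (kernel s u z))\<^sup>2 \<partial>?W)"
    proof (rule back_subst[of "\<lambda>f. f sums _"], intro ext)
      fix k
      have "a k * cnj (a k) = complex_of_real ((cmod (a k))\<^sup>2)"
        by (rule complex_norm_square[symmetric])
      also have "(cmod (a k))\<^sup>2 = (pochhammer s k / fact k)\<^sup>2 * ((cmod z)\<^sup>2) ^ k"
        by (simp add: a_def norm_mult norm_power norm_divide power2_eq_square power_mult_distrib)
      finally show "a k * cnj (a k) * trunc_moment \<alpha> 1 k = complex_of_real ((pochhammer s k / fact k)\<^sup>2 * ((cmod z)\<^sup>2) ^ k * trunc_moment \<alpha> 1 k)"
        by simp
    qed
    then have S: "(\<lambda>k. (pochhammer s k / fact k)\<^sup>2 * ((cmod z)\<^sup>2) ^ k * trunc_moment \<alpha> 1 k) sums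
       (\<integral>u. (cmod (kernel s u z))\<^sup>2 \<partial>?W)"
      by (simp only: sums_of_real_iff)
    have x: "0 \<le> (cmod z)\<^sup>2" "(cmod z)\<^sup>2 < 1" using one_minus_norm_bounds(1)[OF z] by auto
    have "(\<integral>u. (cmod (kernel s u z))\<^sup>2 \<partial>?W) \<le> (\<Sum>k. C * (pochhammer b k / fact k * ((cmod z)\<^sup>2) ^ k))"
      unfolding sums_unique[OF S]
    proof (rule suminf_le)
      fix k
      have p: "pochhammer (\<alpha> + 2) k > 0" using assms by (intro pochhammer_pos) auto
      have "(pochhammer s k / fact k)\<^sup>2 * trunc_moment \<alpha> 1 k = (pochhammer s k)\<^sup>2 / (fact k * pochhammer (\<alpha> + 2) k)"
        unfolding trunc_moment_1[OF assms(1)] by (simp add: power2_eq_square)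
      also have "\<dots> \<le> C * (pochhammer (2 + \<alpha>) k * pochhammer b k) / (fact k * pochhammer (\<alpha> + 2) k)"
        using C(2)[of k] p by (intro divide_right_mono) (auto simp: s_def)
      also have "\<dots> = C * (pochhammer b k / fact k)"
        using p by (simp add: add.commute)
      finally have "((cmod z)\<^sup>2) ^ k * ((pochhammer s k / fact k)\<^sup>2 * trunc_moment \<alpha> 1 k) \<le> ((cmod z)\<^sup>2) ^ k * (C * (pochhammer b k / fact k))"
        by (rule mult_left_mono) simp
      then show "(pochhammer s k / fact k)\<^sup>2 * ((cmod z)\<^sup>2) ^ k * trunc_moment \<alpha> 1 k \<le> C * (pochhammer b k / fact k * ((cmod z)\<^sup>2) ^ k)"
        by (simp only: mult_ac)
      show "summable (\<lambda>k. C * (pochhammer b k / fact k * ((cmod z)\<^sup>2) ^ k))"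
        by (rule summable_mult[OF summable_kernel_coeffs(1)[OF x assms(2)]])
    qed (use S in \<open>simp add: sums_iff\<close>)
    also have "\<dots> = C * (1 - (cmod z)\<^sup>2) powr - b"
      using suminf_mult[OF summable_kernel_coeffs(1)[OF x assms(2)], of C] summable_kernel_coeffs(2)[OF x assms(2)] by simp
    finally have le: "(\<integral>u. (cmod (kernel s u z))\<^sup>2 \<partial>?W) \<le> C * (1 - (cmod z)\<^sup>2) powr - b" .
    have "(\<integral>\<^sup>+u. ennreal (cmod (kernel (2 + \<alpha> + b) z u)) \<partial>?W) = (\<integral>\<^sup>+u. ennreal ((cmod (kernel s u z))\<^sup>2) \<partial>?W)"
      by (rule nn_integral_cong) (use nsq in auto)
    also have "\<dots> = ennreal (\<integral>u. (cmod (kernel s u z))\<^sup>2 \<partial>?W)"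
    proof (rule nn_integral_eq_integral)
      show "integrable ?W (\<lambda>u. (cmod (kernel s u z))\<^sup>2)"
        using integrable_norm[OF int] by (simp add: norm_mult power2_eq_square)
    qed simp
    also have "\<dots> \<le> ennreal (C * (1 - (cmod z)\<^sup>2) powr - b)"
      by (rule ennreal_leI[OF le])
    finally show "(\<integral>\<^sup>+u. ennreal (cmod (kernel (2 + \<alpha> + b) z u)) \<partial>?W) \<le> ennreal (C * (1 - (cmod z)\<^sup>2) powr - b)" .
  qed (rule C)
qed

text \<open>One sequence of radii tending to 1 serves all truncations; a sequence suits dominated
  convergence and Fatou, and the halving makes the first radius 1 / 2 instead of 0.\<close>

definition rad :: "nat \<Rightarrow> real" where "rad n = 1 - inverse (real (Suc n)) / 2"

lemma rad: "0 < rad n" "rad n < 1" "rad \<longlonglongrightarrow> 1"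
proof -
  show "0 < rad n" "rad n < 1" by (auto simp: rad_def field_simps)
  have "(\<lambda>n. 1 - inverse (real (Suc n)) / 2) \<longlonglongrightarrow> 1 - 0 / 2"
    by (intro tendsto_intros LIMSEQ_inverse_real_of_nat) auto
  then show "rad \<longlonglongrightarrow> 1" by (simp add: rad_def[abs_def])
qed

lemma eventually_less_rad:
  assumes "x < 1"
  shows "\<forall>\<^sub>F n in sequentially. x < rad n"
  using order_tendstoD(1)[OF rad(3) assms] .

lemma indicator_ball_rad_tendsto:
  assumes "u \<in> \<D>"
  shows "(\<lambda>n. indicator (ball 0 (rad n)) u :: 'a :: {zero_neq_one, t1_space}) \<longlonglongrightarrow> 1"
proof (rule tendsto_eventually)
  have "cmod u < 1" using assms by simp
  from eventually_less_rad[OF this] show "\<forall>\<^sub>F n in sequentially. indicator (ball 0 (rad n)) u = (1 :: 'a)"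
    by eventually_elim simp
qed

lemma integral_indicator_ball_rad_tendsto:
  fixes g :: "complex \<Rightarrow> complex"
  assumes "sets M = sets (restrict_space borel \<D>)" "integrable M g"
  shows "(\<lambda>n. \<integral>u. indicator (ball 0 (rad n)) u * g u \<partial>M) \<longlonglongrightarrow> (\<integral>u. g u \<partial>M)"
proof -
  have space: "space M = \<D>" by (rule space_disk_measure[OF assms(1)])
  have "(\<lambda>n. \<integral>u. indicator (ball 0 (rad n)) u * g u \<partial>M) \<longlonglongrightarrow> (\<integral>u. 1 * g u \<partial>M)"
  proof (rule integral_dominated_convergence[where w = "\<lambda>u. cmod (g u)"])
    have "(\<lambda>u. indicator (ball 0 (rad n)) u :: complex) \<in> borel_measurable M" for n
      using assms(1) by (simp add: measurable_restrict_space1 cong: measurable_cong_sets)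
    then show "(\<lambda>u. indicator (ball 0 (rad n)) u * g u) \<in> borel_measurable M" for n
      using assms(2) by auto
    show "AE u in M. (\<lambda>n. indicator (ball 0 (rad n)) u * g u) \<longlonglongrightarrow> 1 * g u"
      by (intro AE_I2 tendsto_mult tendsto_const indicator_ball_rad_tendsto) (simp add: space)
  qed (use assms(2) in \<open>auto simp: indicator_def\<close>)
  then show ?thesis by simp
qed

lemma trunc_moment_tendsto:
  assumes "\<alpha> > -1"
  shows "(\<lambda>n. trunc_moment \<alpha> (rad n) k) \<longlonglongrightarrow> fact k / pochhammer (\<alpha> + 2) k"
proof -
  interpret finite_measure "weighted_area \<alpha>" by (rule finite_measure_weighted_area[OF assms(1)])
  have "(\<lambda>n. trunc_moment \<alpha> (rad n) k) \<longlonglongrightarrow> (\<integral>u. 1 * cmod u ^ (2 * k) \<partial>weighted_area \<alpha>)"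
    unfolding trunc_moment_def
  proof (rule integral_dominated_convergence[where w = "\<lambda>_. 1"])
    show "AE u in weighted_area \<alpha>. (\<lambda>n. indicator (ball 0 (rad n)) u * cmod u ^ (2 * k)) \<longlonglongrightarrow> 1 * cmod u ^ (2 * k)"
      by (intro AE_I2 tendsto_mult tendsto_const indicator_ball_rad_tendsto) simp
    show "AE u in weighted_area \<alpha>. norm (indicator (ball 0 (rad n)) u * cmod u ^ (2 * k) :: real) \<le> 1" for n
      by (intro AE_I2) (auto simp: indicator_def intro!: power_le_one)
  qed (auto intro!: borel_measurable_weighted_borel)
  also have "(\<integral>u. 1 * cmod u ^ (2 * k) \<partial>weighted_area \<alpha>) = trunc_moment \<alpha> 1 k"
    unfolding trunc_moment_def by (rule Bochner_Integration.integral_cong) auto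
  finally show ?thesis using trunc_moment_1[OF assms] by simp
qed

text \<open>This quotient of a truncated by a full moment is the multiplier by which the truncated
  projection acts on the k-th Taylor coefficient; the bounds give majorants independent of
  r.\<close>

lemma trunc_moment_ratio_le_1:
  assumes "\<alpha> > -1" "r \<le> 1"
  shows "0 \<le> pochhammer (2 + \<alpha>) k / fact k * trunc_moment \<alpha> r k"
    "pochhammer (2 + \<alpha>) k / fact k * trunc_moment \<alpha> r k \<le> 1"
proof -
  have p: "pochhammer (2 + \<alpha>) k > 0" using assms by (intro pochhammer_pos) auto
  show "0 \<le> pochhammer (2 + \<alpha>) k / fact k * trunc_moment \<alpha> r k"
    using p trunc_moment_nonneg[of \<alpha> r k] by simp
  have "pochhammer (2 + \<alpha>) k / fact k * trunc_moment \<alpha> r k \<le> pochhammer (2 + \<alpha>) k / fact k * (fact k / pochhammer (\<alpha> + 2) k)"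
    using p trunc_moment_le[OF assms, of k] by (intro mult_left_mono) auto
  also have "\<dots> = 1" using p by (simp add: add.commute)
  finally show "pochhammer (2 + \<alpha>) k / fact k * trunc_moment \<alpha> r k \<le> 1" .
qed

text \<open>Monomials stay orthogonal on every centred ball, so truncating the Bergman projection
  keeps it diagonal on Taylor coefficients.\<close>

lemma integral_kernel_power_series:
  fixes a :: "nat \<Rightarrow> complex"
  assumes "\<alpha> > -1" "0 < r" "r \<le> 1" "cmod w < 1" and a: "summable (\<lambda>k. cmod (a k) * r ^ k)"
  shows "(\<lambda>k. a k * w ^ k * complex_of_real (pochhammer (2 + \<alpha>) k / fact k * trunc_moment \<alpha> r k)) sums
    (\<integral>u. indicator (ball 0 r) u * ((\<Sum>k. a k * u ^ k) * kernel (2 + \<alpha>) w u) \<partial>weighted_area \<alpha>)"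
proof -
  define b where "b k = complex_of_real (pochhammer (2 + \<alpha>) k / fact k) * cnj w ^ k" for k
  have b: "summable (\<lambda>k. cmod (b k) * r ^ k)"
  proof (rule summable_comparison_test')
    show "summable (\<lambda>k. cmod (b k))"
      unfolding b_def by (rule summable_norm_kernel_power_series) (use assms in auto)
    show "norm (cmod (b k) * r ^ k) \<le> cmod (b k)" for k
      using assms by (simp add: mult_left_le power_le_one)
  qed
  have "(\<lambda>k. a k * cnj (b k) * trunc_moment \<alpha> r k) sums
    (\<integral>u. indicator (ball 0 r) u * ((\<Sum>k. a k * u ^ k) * cnj (\<Sum>k. b k * u ^ k)) \<partial>weighted_area \<alpha>)"
    by (rule integral_weighted_area_power_series[OF assms(1-3) a b])
  also have "(\<integral>u. indicator (ball 0 r) u * ((\<Sum>k. a k * u ^ k) * cnj (\<Sum>k. b k * u ^ k)) \<partial>weighted_area \<alpha>) =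
    (\<integral>u. indicator (ball 0 r) u * ((\<Sum>k. a k * u ^ k) * kernel (2 + \<alpha>) w u) \<partial>weighted_area \<alpha>)"
  proof (rule Bochner_Integration.integral_cong)
    fix u assume u: "u \<in> space (weighted_area \<alpha>)"
    then have "(\<Sum>k. b k * u ^ k) = kernel (2 + \<alpha>) u w"
      unfolding b_def using kernel_power_series[of w u] assms by simp
    moreover have "cnj (kernel (2 + \<alpha>) u w) = kernel (2 + \<alpha>) w u"
      using u assms by (intro cnj_kernel) auto
    ultimately show "indicator (ball 0 r) u * ((\<Sum>k. a k * u ^ k) * cnj (\<Sum>k. b k * u ^ k)) =
      indicator (ball 0 r) u * ((\<Sum>k. a k * u ^ k) * kernel (2 + \<alpha>) w u)" by simp
  qed simp
  finally show ?thesis by (simp add: b_def mult_ac)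
qed

text \<open>Over the ball of radius \<open>rad n\<close> the integral is the Taylor series of f at w
  with multipliers \<open>q n k\<close>. As n grows these tend to 1 and Tannery's theorem gives f w,
  while integrability of f and boundedness of the kernel at fixed w carry the truncated integrals to
  the full one.\<close>

theorem bergman_reproducing:
  assumes "\<alpha> > -1" and f: "f holomorphic_on \<D>" "integrable (weighted_area \<alpha>) f" and w: "cmod w < 1"
  shows "f w = (\<integral>u. f u * kernel (2 + \<alpha>) w u \<partial>weighted_area \<alpha>)"
proof -
  let ?W = "weighted_area \<alpha>"
  define a where "a k = (deriv ^^ k) f 0 / fact k" for k
  have fs: "(\<lambda>k. a k * u ^ k) sums f u" if "u \<in> \<D>" for u
    using holomorphic_power_series[OF f(1) that] by (simp add: a_def)
  have a: "summable (\<lambda>k. cmod (a k) * r ^ k)" if r: "0 < r" "r < 1" for r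
  proof -
    obtain r' where r': "r < r'" "r' < 1" using dense r by blast
    have "summable (\<lambda>k. a k * complex_of_real r' ^ k)"
      using fs[of "of_real r'"] r r' by (auto simp: sums_iff)
    then have "summable (\<lambda>k. norm (a k * complex_of_real r ^ k))"
      by (rule powser_insidea) (use r r' in auto)
    then show ?thesis using r by (simp add: norm_mult norm_power)
  qed
  define q where "q n k = pochhammer (2 + \<alpha>) k / fact k * trunc_moment \<alpha> (rad n) k" for n k
  have q01: "0 \<le> q n k" "q n k \<le> 1" for n k
    unfolding q_def using trunc_moment_ratio_le_1[OF assms(1), of "rad n" k] rad(2)[of n] by auto
  have q: "(\<lambda>n. q n k) \<longlonglongrightarrow> 1" for k
  proof -
    have p: "pochhammer (2 + \<alpha>) k > 0" using assms by (intro pochhammer_pos) auto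
    have "(\<lambda>n. q n k) \<longlonglongrightarrow> pochhammer (2 + \<alpha>) k / fact k * (fact k / pochhammer (\<alpha> + 2) k)"
      unfolding q_def by (intro tendsto_intros trunc_moment_tendsto assms)
    then show ?thesis using p by (simp add: add.commute)
  qed
  have eq: "(\<integral>u. indicator (ball 0 (rad n)) u * (f u * kernel (2 + \<alpha>) w u) \<partial>?W) =
     (\<Sum>k. a k * w ^ k * complex_of_real (q n k))" for n
  proof -
    have "(\<integral>u. indicator (ball 0 (rad n)) u * (f u * kernel (2 + \<alpha>) w u) \<partial>?W) =
       (\<integral>u. indicator (ball 0 (rad n)) u * ((\<Sum>k. a k * u ^ k) * kernel (2 + \<alpha>) w u) \<partial>?W)"
      by (rule Bochner_Integration.integral_cong) (use fs in \<open>auto simp: sums_iff\<close>)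
    also have "\<dots> = (\<Sum>k. a k * w ^ k * complex_of_real (q n k))"
      using integral_kernel_power_series[OF assms(1), of "rad n" w a] a[of "rad n"] rad(1,2)[of n] w
      by (simp add: sums_iff q_def)
    finally show ?thesis .
  qed
  have "(\<lambda>n. \<Sum>k. a k * w ^ k * complex_of_real (q n k)) \<longlonglongrightarrow> (\<Sum>k. a k * w ^ k)"
  proof -
    obtain r where r: "cmod w < r" "r < 1" using dense w by blast
    have "summable (\<lambda>k. cmod (a k * w ^ k))"
    proof (rule summable_comparison_test')
      show "summable (\<lambda>k. cmod (a k) * r ^ k)"
        using a[of r] r le_less_trans[OF norm_ge_zero r(1)] by auto
      show "norm (cmod (a k * w ^ k)) \<le> cmod (a k) * r ^ k" for k
        using r by (auto simp: norm_mult norm_power intro!: mult_left_mono power_mono)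
    qed
    moreover have "(\<lambda>n. a k * w ^ k * complex_of_real (q n k)) \<longlonglongrightarrow> a k * w ^ k" for k
      using tendsto_mult[OF tendsto_const[of "a k * w ^ k"] tendsto_of_real[OF q[of k], where 'a=complex]] by simp
    moreover have le: "norm (a k * w ^ k * complex_of_real (q n k)) \<le> cmod (a k * w ^ k)" for k n
      using q01[of n k] mult_left_mono[of "q n k" 1 "cmod (a k * w ^ k)"] by (simp add: norm_mult)
    moreover from le have "\<forall>\<^sub>F (k, n) in at_top \<times>\<^sub>F sequentially. norm (a k * w ^ k * complex_of_real (q n k)) \<le> cmod (a k * w ^ k)"
      by (intro always_eventually) auto
    ultimately have "(\<forall>\<^sub>F n in sequentially. summable (\<lambda>k. cmod (a k * w ^ k * complex_of_real (q n k)))) \<and>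
        summable (\<lambda>n. cmod (a n * w ^ n)) \<and>
        (\<lambda>n. \<Sum>k. a k * w ^ k * complex_of_real (q n k)) \<longlonglongrightarrow> (\<Sum>k. a k * w ^ k)"
      by (intro tannerys_theorem) auto
    then show ?thesis by blast
  qed
  also have "(\<Sum>k. a k * w ^ k) = f w"
    using fs[of w] w by (simp add: sums_iff)
  finally have 1: "(\<lambda>n. \<integral>u. indicator (ball 0 (rad n)) u * (f u * kernel (2 + \<alpha>) w u) \<partial>?W) \<longlonglongrightarrow> f w"
    unfolding eq .
  have "integrable ?W (\<lambda>u. f u * kernel (2 + \<alpha>) w u)"
  proof (rule Bochner_Integration.integrable_bound)
    show "integrable ?W (\<lambda>u. f u * complex_of_real ((1 - cmod w) powr - (2 + \<alpha>)))"
      using f(2) by simp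
    show "(\<lambda>u. f u * kernel (2 + \<alpha>) w u) \<in> borel_measurable ?W"
      using f(2) borel_measurable_weighted_continuous[OF continuous_on_kernel2[OF w]] by auto
    have "cmod (f u * kernel (2 + \<alpha>) w u) \<le> cmod (f u) * (1 - cmod w) powr - (2 + \<alpha>)" if "u \<in> \<D>" for u
      unfolding norm_mult using norm_kernel_le[of w u "2 + \<alpha>"] that w assms(1) by (intro mult_left_mono) auto
    then show "AE u in ?W. cmod (f u * kernel (2 + \<alpha>) w u) \<le> cmod (f u * complex_of_real ((1 - cmod w) powr - (2 + \<alpha>)))"
      by (intro AE_I2) (simp add: norm_mult)
  qed
  from LIMSEQ_unique[OF 1 integral_indicator_ball_rad_tendsto[OF sets_weighted_area this]] show ?thesis .
qed

subsection \<open>Integrals with a kernel parameter and Bloch functions\<close>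

text \<open>Taylor's estimate of second order on the convex set \<open>cball 0 r\<close>. The bound
  does not involve w, so it survives integration against any finite measure.\<close>

lemma kernel_increment_le:
  assumes "cmod z \<le> r" "cmod y \<le> r" "r < 1" "cmod w \<le> 1" "s > 0"
  shows "cmod (kernel s y w - kernel s z w - s * cnj w * kernel (s + 1) z w * (y - z))
    \<le> s * (s + 1) * (1 - r) powr - (s + 2) * (cmod (y - z))\<^sup>2"
proof -
  have r: "cmod x < 1" if "x \<in> cball 0 r" for x using that assms by auto
  define F where "F i = (if i = 0 then (\<lambda>x. kernel s x w) else if i = 1 then (\<lambda>x. s * cnj w * kernel (s + 1) x w)
      else (\<lambda>x. s * cnj w * ((s + 1) * cnj w * kernel (s + 2) x w)))" for i :: nat
  have F: "F 0 = (\<lambda>x. kernel s x w)" "F (Suc 0) = (\<lambda>x. s * cnj w * kernel (s + 1) x w)"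
    "F 2 = (\<lambda>x. s * cnj w * ((s + 1) * cnj w * kernel (s + 2) x w))"
    by (simp_all add: F_def)
  have "cmod (F 0 y - (\<Sum>i\<le>1. F i z * (y - z) ^ i / fact i))
     \<le> (s * (s + 1) * (1 - r) powr - (s + 2)) * cmod (y - z) ^ Suc 1 / fact 1"
  proof (rule complex_Taylor[where S = "cball 0 r"])
    show "(F i has_field_derivative F (Suc i) x) (at x within cball 0 r)"
      if "x \<in> cball 0 r" "i \<le> 1" for x i
    proof (cases "i = 0")
      case True
      then show ?thesis
        using has_field_derivative_kernel[OF r[OF that(1)] assms(4), of s] by (simp add: F_def)
    next
      case False
      then have "i = 1" using that by simp
      then show ?thesis
        using DERIV_cmult[OF has_field_derivative_kernel[OF r[OF that(1)] assms(4), of "s + 1"], of "s * cnj w"]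
        by (simp add: F_def add.assoc)
    qed
    show "cmod (F (Suc 1) x) \<le> s * (s + 1) * (1 - r) powr - (s + 2)" if "x \<in> cball 0 r" for x
    proof -
      have "cmod (kernel (s + 2) x w) \<le> (1 - cmod x) powr - (s + 2)"
        using norm_kernel_le[OF r[OF that] assms(4), of "s + 2"] assms by simp
      also have "\<dots> \<le> (1 - r) powr - (s + 2)"
        using that assms by (intro powr_mono2') auto
      finally have "(cmod w * cmod w) * cmod (kernel (s + 2) x w) \<le> 1 * (1 - r) powr - (s + 2)"
        using assms by (intro mult_mono mult_le_one) auto
      then have "(s * (s + 1)) * ((cmod w * cmod w) * cmod (kernel (s + 2) x w)) \<le> (s * (s + 1)) * (1 * (1 - r) powr - (s + 2))"
        by (rule mult_left_mono) (use assms in simp)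
      moreover have "cmod (F (Suc 1) x) = (s * (s + 1)) * ((cmod w * cmod w) * cmod (kernel (s + 2) x w))"
      proof -
        have "F (Suc 1) x = complex_of_real (s * (s + 1)) * ((cnj w * cnj w) * kernel (s + 2) x w)"
          by (simp add: F_def)
        then show ?thesis using assms by (simp only: norm_mult norm_of_real complex_mod_cnj) simp
      qed
      ultimately show ?thesis by simp
    qed
  qed (use assms in auto)
  then show ?thesis
    by (simp add: F power2_eq_square algebra_simps)
qed

text \<open>Differentiation under the integral sign, the remainder being uniformly quadratic by Taylor.\<close>

lemma has_field_derivative_integral_kernel:
  fixes M :: "complex measure"
  assumes M: "finite_measure M" "sets M = sets (restrict_space borel \<D>)"
    and \<phi>: "\<phi> \<in> borel_measurable M" "\<And>w. w \<in> \<D> \<Longrightarrow> cmod (\<phi> w) \<le> B" and "s > 0" and z: "cmod z < 1"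
  shows "((\<lambda>z. \<integral>w. \<phi> w * kernel s z w \<partial>M) has_field_derivative
    s * (\<integral>w. \<phi> w * cnj w * kernel (s + 1) z w \<partial>M)) (at z)"
    and "integrable M (\<lambda>w. \<phi> w * kernel s z w)"
proof -
  interpret finite_measure M by fact
  have space: "space M = \<D>" by (rule space_disk_measure[OF M(2)])
  have B: "B \<ge> 0" using \<phi>(2)[of 0] norm_ge_zero[of "\<phi> 0"] by (simp del: norm_ge_zero)
  have mk [measurable]: "kernel r y \<in> borel_measurable M" if "cmod y < 1" for r y
    using borel_measurable_continuous_on_restrict[OF continuous_on_kernel2[OF that]] M(2)
    by (simp cong: measurable_cong_sets)
  have mw [measurable]: "(\<lambda>w. cnj w) \<in> borel_measurable M"
    using measurable_restrict_space1[OF borel_measurable_cnj, of \<D>] M(2) by (simp cong: measurable_cong_sets)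
  note [measurable] = \<phi>(1)
  have int1: "integrable M (\<lambda>w. \<phi> w * kernel r y w)" if "cmod y < 1" "r > 0" for r y
  proof (rule integrable_const_bound[of _ "B * (1 - cmod y) powr - r"])
    show "AE w in M. cmod (\<phi> w * kernel r y w) \<le> B * (1 - cmod y) powr - r"
      using \<phi>(2) norm_kernel_le[of y _ r] that B by (intro AE_I2) (auto simp: norm_mult space intro!: mult_mono)
  qed (use mk that in measurable)
  have int2: "integrable M (\<lambda>w. \<phi> w * cnj w * kernel r y w)" if "cmod y < 1" "r > 0" for r y
  proof (rule integrable_const_bound[of _ "B * 1 * (1 - cmod y) powr - r"])
    show "AE w in M. cmod (\<phi> w * cnj w * kernel r y w) \<le> B * 1 * (1 - cmod y) powr - r"
      unfolding norm_mult complex_mod_cnj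
      using \<phi>(2) norm_kernel_le[of y _ r] that B
      by (intro AE_I2 mult_mono) (auto simp: space)
  qed (use mk that in measurable)
  show "integrable M (\<lambda>w. \<phi> w * kernel s z w)" by (rule int1) (use assms in auto)
  define r where "r = (1 + cmod z) / 2"
  have r: "cmod z < r" "r < 1" using z by (auto simp: r_def)
  define K where "K = s * (s + 1) * (1 - r) powr - (s + 2)"
  have K: "K \<ge> 0" using \<open>s > 0\<close> by (simp add: K_def)
  define G where "G z = (\<integral>w. \<phi> w * kernel s z w \<partial>M)" for z
  define D where "D = s * (\<integral>w. \<phi> w * cnj w * kernel (s + 1) z w \<partial>M)"
  have est: "cmod (G y - G z - D * (y - z)) \<le> B * K * measure M \<D> * (cmod (y - z))\<^sup>2" if y: "cmod y < r" for y
  proof -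
    have y1: "cmod y < 1" using y r by simp
    have "G y - G z - D * (y - z) =
      (\<integral>w. \<phi> w * kernel s y w - \<phi> w * kernel s z w - s * (\<phi> w * cnj w * kernel (s + 1) z w) * (y - z) \<partial>M)"
      using int1[OF y1 \<open>s > 0\<close>] int1[OF z \<open>s > 0\<close>] int2[OF z, of "s + 1"] \<open>s > 0\<close>
      by (simp add: G_def D_def)
    also have "cmod \<dots> \<le> (\<integral>w. B * K * (cmod (y - z))\<^sup>2 \<partial>M)"
    proof (rule order_trans[OF integral_norm_bound integral_mono])
      show "integrable M (\<lambda>w. cmod (\<phi> w * kernel s y w - \<phi> w * kernel s z w - s * (\<phi> w * cnj w * kernel (s + 1) z w) * (y - z)))"
        using int1[OF y1 \<open>s > 0\<close>] int1[OF z \<open>s > 0\<close>] int2[OF z, of "s + 1"] \<open>s > 0\<close> by auto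
      show "cmod (\<phi> w * kernel s y w - \<phi> w * kernel s z w - s * (\<phi> w * cnj w * kernel (s + 1) z w) * (y - z)) \<le> B * K * (cmod (y - z))\<^sup>2"
        if "w \<in> space M" for w
      proof -
        have "\<phi> w * kernel s y w - \<phi> w * kernel s z w - s * (\<phi> w * cnj w * kernel (s + 1) z w) * (y - z) =
          \<phi> w * (kernel s y w - kernel s z w - s * cnj w * kernel (s + 1) z w * (y - z))"
          by (simp add: algebra_simps)
        also have "cmod \<dots> \<le> B * (K * (cmod (y - z))\<^sup>2)"
          unfolding norm_mult K_def
          using kernel_increment_le[of z r y w s] \<phi>(2)[of w] that y r \<open>s > 0\<close> B
          by (intro mult_mono) (auto simp: space)
        finally show ?thesis by (simp add: mult.assoc)
      qed
    qed simp
    also have "\<dots> = B * K * measure M \<D> * (cmod (y - z))\<^sup>2"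
      by (simp add: space)
    finally show ?thesis .
  qed
  have "((\<lambda>y. (G y - G z - D * (y - z)) / (y - z)) \<longlongrightarrow> 0) (at z)"
  proof (rule Lim_null_comparison)
    show "\<forall>\<^sub>F y in at z. norm ((G y - G z - D * (y - z)) / (y - z)) \<le> B * K * measure M \<D> * cmod (y - z)"
      unfolding eventually_at
    proof (intro exI[of _ "r - cmod z"] conjI ballI impI)
      fix y assume "y \<noteq> z \<and> dist y z < r - cmod z"
      then have y: "y \<noteq> z" "cmod y < r"
        using norm_triangle_ineq2[of y z] by (auto simp: dist_norm)
      show "norm ((G y - G z - D * (y - z)) / (y - z)) \<le> B * K * measure M \<D> * cmod (y - z)"
        using est[OF y(2)] y(1) by (simp add: norm_divide divide_le_eq power2_eq_square mult_ac)
    qed (use r in auto)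
    have "((\<lambda>y. B * K * measure M \<D> * cmod (y - z)) \<longlongrightarrow> B * K * measure M \<D> * cmod (z - z)) (at z)"
      by (intro tendsto_intros)
    then show "((\<lambda>y. B * K * measure M \<D> * cmod (y - z)) \<longlongrightarrow> 0) (at z)" by simp
  qed
  then have "((\<lambda>y. (G y - G z) / (y - z) - D) \<longlongrightarrow> 0) (at z)"
    by (rule Lim_transform_eventually) (auto simp: eventually_at diff_divide_distrib intro!: exI[of _ 1])
  then have "((\<lambda>y. (G y - G z) / (y - z)) \<longlongrightarrow> D) (at z)"
    by (simp add: LIM_zero_iff)
  then show "((\<lambda>z. \<integral>w. \<phi> w * kernel s z w \<partial>M) has_field_derivative
    s * (\<integral>w. \<phi> w * cnj w * kernel (s + 1) z w \<partial>M)) (at z)"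
    unfolding has_field_derivative_iff G_def D_def by simp
qed

lemma holomorphic_integral_kernel:
  fixes M :: "complex measure"
  assumes "finite_measure M" "sets M = sets (restrict_space borel \<D>)"
    and "\<phi> \<in> borel_measurable M" "\<And>w. w \<in> \<D> \<Longrightarrow> cmod (\<phi> w) \<le> B" and "s > 0"
  shows "(\<lambda>z. \<integral>w. \<phi> w * kernel s z w \<partial>M) holomorphic_on \<D>"
  unfolding holomorphic_on_def field_differentiable_def
proof (intro ballI exI)
  fix z :: complex assume "z \<in> \<D>"
  then have "cmod z < 1" by simp
  from has_field_derivative_integral_kernel(1)[OF assms this]
  show "((\<lambda>z. \<integral>w. \<phi> w * kernel s z w \<partial>M) has_field_derivative
      s * (\<integral>w. \<phi> w * cnj w * kernel (s + 1) z w \<partial>M)) (at z within \<D>)"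
    by (rule has_field_derivative_at_within)
qed

text \<open>The constant is kept explicit because later estimates must be uniform over all
  projections of functions bounded by 1.\<close>

definition Bloch_bounded :: "real \<Rightarrow> (complex \<Rightarrow> complex) \<Rightarrow> bool" where
  "Bloch_bounded L h \<longleftrightarrow> h holomorphic_on \<D> \<and> (\<forall>w\<in>\<D>. (1 - (cmod w)\<^sup>2) * cmod (deriv h w) \<le> L)"

lemma Bloch_boundedD:
  assumes "Bloch_bounded L h"
  shows "h holomorphic_on \<D>" "w \<in> \<D> \<Longrightarrow> (1 - (cmod w)\<^sup>2) * cmod (deriv h w) \<le> L" "L \<ge> 0"
proof -
  show h: "h holomorphic_on \<D>" "w \<in> \<D> \<Longrightarrow> (1 - (cmod w)\<^sup>2) * cmod (deriv h w) \<le> L" for w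
    using assms by (auto simp: Bloch_bounded_def)
  show "L \<ge> 0" using h(2)[of 0] norm_ge_zero[of "deriv h 0"] by (simp del: norm_ge_zero)
qed

text \<open>Integrate |h'| \<le> L / (1 - |t v|^2) along the radius. The function \<open>g\<close>
  is L artanh(t |v|), a primitive of the resulting majorant.\<close>

lemma Bloch_radial:
  assumes Bl: "Bloch_bounded L h" and v: "v \<in> \<D>"
  shows "cmod (h v - h 0) \<le> L * ln (4 / (1 - (cmod v)\<^sup>2))"
proof -
  note h = Bloch_boundedD[OF Bl] and L = Bloch_boundedD(3)[OF Bl]
  have v1: "cmod v < 1" using v by simp
  define g where "g t = (L / 2) * (ln (1 + t * cmod v) - ln (1 - t * cmod v))" for t :: real
  have tv: "t * cmod v < 1" "t * cmod v \<ge> 0" if "t \<in> {0..1}" for t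
    using that v1 mult_le_one[of t "cmod v"] mult_left_le_one_le[of "cmod v" t] by auto
  have "norm (h (of_real 1 * v) - h (of_real 0 * v)) \<le> g 1 - g 0"
  proof (rule differentiable_bound_general[where f = "\<lambda>t. h (of_real t * v)" and \<phi> = g
        and \<phi>' = "\<lambda>t. (L / 2) * (cmod v / (1 + t * cmod v) + cmod v / (1 - t * cmod v))"
        and f' = "\<lambda>t. v * deriv h (of_real t * v)"])
    show "continuous_on {0..1} g"
    proof -
      have "1 + t * cmod v \<noteq> 0" "1 - t * cmod v \<noteq> 0" if "t \<in> {0..1}" for t
        using tv[OF that] by auto
      then show ?thesis unfolding g_def by (intro continuous_intros) auto
    qed
    show "continuous_on {0..1} (\<lambda>t. h (complex_of_real t * v))"
      by (intro continuous_on_compose2[OF holomorphic_on_imp_continuous_on[OF h(1)]] continuous_intros)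
        (use tv in \<open>auto simp: norm_mult\<close>)
    fix t :: real assume t: "0 < t" "t < 1"
    then have tv': "t * cmod v < 1" "t * cmod v \<ge> 0" using tv[of t] by auto
    show "(g has_vector_derivative (L / 2) * (cmod v / (1 + t * cmod v) + cmod v / (1 - t * cmod v))) (at t)"
      unfolding g_def has_real_derivative_iff_has_vector_derivative[symmetric]
      by (rule derivative_eq_intros refl | use tv' in \<open>simp; fail\<close>)+
    have in_disk: "of_real t * v \<in> \<D>" using t tv' by (simp add: norm_mult)
    have "(h has_field_derivative deriv h (of_real t * v)) (at (of_real t * v))"
      using h(1) in_disk by (simp add: holomorphic_derivI)
    moreover have "((\<lambda>t. of_real t * v) has_vector_derivative v) (at t)"
      unfolding has_vector_derivative_def by (auto intro!: derivative_eq_intros simp: scaleR_conv_of_real)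
    ultimately show "((\<lambda>t. h (of_real t * v)) has_vector_derivative v * deriv h (of_real t * v)) (at t)"
      using field_vector_diff_chain_at[of "\<lambda>t. of_real t * v" v t h] by (simp add: o_def)
    have "cmod (deriv h (of_real t * v)) \<le> L / (1 - (t * cmod v)\<^sup>2)"
    proof -
      have "1 - (cmod (of_real t * v))\<^sup>2 > 0" using one_minus_norm_bounds(1)[of "of_real t * v"] in_disk by simp
      then show ?thesis
        using h(2)[OF in_disk] t by (simp add: norm_mult pos_le_divide_eq mult.commute)
    qed
    then have "cmod v * cmod (deriv h (of_real t * v)) \<le> cmod v * (L / (1 - (t * cmod v)\<^sup>2))"
      by (rule mult_left_mono) simp
    also have "\<dots> = (L / 2) * (cmod v / (1 + t * cmod v) + cmod v / (1 - t * cmod v))"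
    proof -
      have "1 - (t * cmod v)\<^sup>2 = (1 + t * cmod v) * (1 - t * cmod v)"
        by (simp add: power2_eq_square algebra_simps)
      moreover have "x * (L / (A * B)) = (L / 2) * (x / A + x / B)" if "A > 0" "B > 0" "A + B = 2" for x A B :: real
      proof -
        have "x / A + x / B = x * (A + B) / (A * B)" using that(1,2) by (simp add: field_simps)
        then show ?thesis using that by simp
      qed
      from this[of "1 + t * cmod v" "1 - t * cmod v" "cmod v"] tv'
      have "cmod v * (L / ((1 + t * cmod v) * (1 - t * cmod v))) = (L / 2) * (cmod v / (1 + t * cmod v) + cmod v / (1 - t * cmod v))"
        by simp
      ultimately show ?thesis by simp
    qed
    finally show "norm (v * deriv h (of_real t * v)) \<le> (L / 2) * (cmod v / (1 + t * cmod v) + cmod v / (1 - t * cmod v))"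
      by (simp add: norm_mult)
  qed simp
  also have "g 1 - g 0 = (L / 2) * (ln (1 + cmod v) - ln (1 - cmod v))"
    by (simp add: g_def)
  also have "\<dots> = (L / 2) * ln ((1 + cmod v)\<^sup>2 / (1 - (cmod v)\<^sup>2))"
  proof -
    have "(1 + cmod v)\<^sup>2 / (1 - (cmod v)\<^sup>2) = (1 + cmod v) / (1 - cmod v)"
    proof -
      have "1 - (cmod v)\<^sup>2 = (1 + cmod v) * (1 - cmod v)" by (simp add: power2_eq_square algebra_simps)
      moreover have "1 + cmod v \<noteq> 0" using norm_ge_zero[of v] by linarith
      ultimately show ?thesis by (simp add: power2_eq_square)
    qed
    moreover have "1 + cmod v > 0" using norm_ge_zero[of v] by linarith
    ultimately show ?thesis using v1 by (simp add: ln_div)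
  qed
  \<comment> \<open>As (1 + |v|)^2 \<le> 4, one copy of the logarithm suffices; it is nonnegative,
    so it may be doubled to cancel the factor 1/2.\<close>
  also have "\<dots> \<le> (L / 2) * (2 * ln (4 / (1 - (cmod v)\<^sup>2)))"
  proof (rule mult_left_mono)
    have p: "1 - (cmod v)\<^sup>2 > 0" "1 - (cmod v)\<^sup>2 \<le> 1" using one_minus_norm_bounds[OF v1] by auto
    have "(1 + cmod v)\<^sup>2 \<le> 2\<^sup>2" using v1 by (intro power_mono) auto
    then have "(1 + cmod v)\<^sup>2 / (1 - (cmod v)\<^sup>2) \<le> 4 / (1 - (cmod v)\<^sup>2)"
      using p by (intro divide_right_mono) auto
    moreover have "(1 + cmod v)\<^sup>2 > 0" using norm_ge_zero[of v] by (intro zero_less_power) linarith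
    ultimately have "ln ((1 + cmod v)\<^sup>2 / (1 - (cmod v)\<^sup>2)) \<le> ln (4 / (1 - (cmod v)\<^sup>2))"
      using p by (intro ln_mono) auto
    moreover have "1 - (cmod v)\<^sup>2 \<le> 4" using p(2) by linarith
    then have "4 / (1 - (cmod v)\<^sup>2) \<ge> 1" using p(1) by (simp only: le_divide_eq_1_pos)
    then have "ln (4 / (1 - (cmod v)\<^sup>2)) \<ge> 0" by simp
    ultimately show "ln ((1 + cmod v)\<^sup>2 / (1 - (cmod v)\<^sup>2)) \<le> 2 * ln (4 / (1 - (cmod v)\<^sup>2))" by linarith
  qed (use L in simp)
  finally show ?thesis by simp
qed

text \<open>The identity behind 1 - |m(u)|^2 for an automorphism m of the disk; it also gives |1 - z
  cnj w|^2 \<ge> (1 - |z|^2)(1 - |w|^2) in the disk.\<close>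

lemma norm_one_minus_mult_cnj_square:
  "(cmod (1 - z * cnj w))\<^sup>2 - (cmod (z - w))\<^sup>2 = (1 - (cmod z)\<^sup>2) * (1 - (cmod w)\<^sup>2)"
proof -
  have "complex_of_real ((cmod (1 - z * cnj w))\<^sup>2 - (cmod (z - w))\<^sup>2) =
     complex_of_real ((1 - (cmod z)\<^sup>2) * (1 - (cmod w)\<^sup>2))"
    unfolding of_real_diff of_real_mult of_real_1 complex_norm_square by (simp add: algebra_simps)
  then show ?thesis by (simp only: of_real_eq_iff)
qed

text \<open>Compose with the disk automorphism that swaps \<open>0\<close> and \<open>z\<close>.\<close>

lemma Bloch_Lipschitz:
  assumes Bl: "Bloch_bounded L h" and z: "z \<in> \<D>" and w: "w \<in> \<D>"
  shows "cmod (h w - h z) \<le> L * ln (4 * (cmod (1 - z * cnj w))\<^sup>2 / ((1 - (cmod z)\<^sup>2) * (1 - (cmod w)\<^sup>2)))"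
proof -
  note h = Bloch_boundedD[OF Bl]
  \<comment> \<open>An involution of the disk with \<open>m 0 = z\<close>, so the composition of h
    and m takes the values h w and h z at \<open>m w\<close> and 0.\<close>
  define m where "m u = (z - u) / (1 - u * cnj z)" for u
  have z1: "cmod z < 1" using z by simp
  have nz: "1 - u * cnj z \<noteq> 0" if "u \<in> \<D>" for u
    using one_minus_mult_cnj_nonzero[of u z] that z by simp
  have one_minus_m: "1 - (cmod (m u))\<^sup>2 = (1 - (cmod z)\<^sup>2) * (1 - (cmod u)\<^sup>2) / (cmod (1 - u * cnj z))\<^sup>2" if "u \<in> \<D>" for u
    using norm_one_minus_mult_cnj_square[of u z] nz[OF that]
    by (simp add: m_def norm_divide power_divide norm_minus_commute field_simps)
  have m_disk: "m u \<in> \<D>" if u: "u \<in> \<D>" for u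
  proof -
    have "1 - (cmod (m u))\<^sup>2 > 0"
      unfolding one_minus_m[OF u] using one_minus_norm_bounds(1)[of u] one_minus_norm_bounds(1)[of z] u z nz[OF u]
      by (intro divide_pos_pos mult_pos_pos zero_less_power) auto
    then show ?thesis by (simp add: abs_square_less_1)
  qed
  have deriv_m: "(m has_field_derivative (complex_of_real ((cmod z)\<^sup>2) - 1) / (1 - u * cnj z)\<^sup>2) (at u)" if u: "u \<in> \<D>" for u
  proof -
    have "(m has_field_derivative ((-1) * (1 - u * cnj z) - (z - u) * (- cnj z)) / ((1 - u * cnj z) * (1 - u * cnj z))) (at u)"
      unfolding m_def by (rule DERIV_divide) (use nz[OF u] in \<open>auto intro!: derivative_eq_intros\<close>)
    moreover have "(-1) * (1 - u * cnj z) - (z - u) * (- cnj z) = complex_of_real ((cmod z)\<^sup>2) - 1"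
      unfolding complex_norm_square by (simp add: algebra_simps)
    ultimately show ?thesis by (simp only: power2_eq_square[of "1 - u * cnj z"])
  qed
  have deriv_hm: "((\<lambda>u. h (m u)) has_field_derivative deriv h (m u) * ((complex_of_real ((cmod z)\<^sup>2) - 1) / (1 - u * cnj z)\<^sup>2)) (at u)" if u: "u \<in> \<D>" for u
    using DERIV_chain2[OF _ deriv_m[OF u], of h] holomorphic_derivI[OF h(1) _ m_disk[OF u], of UNIV] by auto
  have "cmod (h (m (m w)) - h (m 0)) \<le> L * ln (4 / (1 - (cmod (m w))\<^sup>2))"
  proof (rule Bloch_radial[of L "\<lambda>u. h (m u)"])
    have "(\<lambda>u. h (m u)) holomorphic_on \<D>"
      using deriv_hm by (meson field_differentiable_at_within field_differentiable_def holomorphic_onI)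
    \<comment> \<open>The Bloch seminorm is invariant: (1 - |u|^2) |m'(u)| = 1 - |m(u)|^2.\<close>
    moreover have "(1 - (cmod u)\<^sup>2) * cmod (deriv (\<lambda>u. h (m u)) u) \<le> L" if u: "u \<in> \<D>" for u
    proof -
      have "cmod (deriv (\<lambda>u. h (m u)) u) = cmod (deriv h (m u)) * ((1 - (cmod z)\<^sup>2) / (cmod (1 - u * cnj z))\<^sup>2)"
      proof -
        have "cmod (complex_of_real ((cmod z)\<^sup>2) - 1) = \<bar>(cmod z)\<^sup>2 - 1\<bar>"
          by (metis norm_of_real of_real_1 of_real_diff)
        also have "\<dots> = 1 - (cmod z)\<^sup>2" using one_minus_norm_bounds(1)[OF z1] by simp
        finally show ?thesis
          unfolding DERIV_imp_deriv[OF deriv_hm[OF u]] by (simp add: norm_mult norm_divide norm_power)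
      qed
      then have "(1 - (cmod u)\<^sup>2) * cmod (deriv (\<lambda>u. h (m u)) u) = (1 - (cmod (m u))\<^sup>2) * cmod (deriv h (m u))"
        unfolding one_minus_m[OF u] by simp
      then show ?thesis using h(2)[OF m_disk[OF u]] by simp
    qed
    ultimately show "Bloch_bounded L (\<lambda>u. h (m u))" by (simp add: Bloch_bounded_def)
  qed (use m_disk[OF w] in simp)
  moreover have "m 0 = z" by (simp add: m_def)
  moreover have "m (m w) = w"
  proof -
    have ne: "1 - w * cnj z \<noteq> 0" by (rule nz[OF w])
    have nez: "1 - z * cnj z \<noteq> 0" by (rule nz[OF z])
    have "z - m w = w * (1 - z * cnj z) / (1 - w * cnj z)"
      using ne unfolding m_def by (simp add: field_simps)
    moreover have "1 - m w * cnj z = (1 - z * cnj z) / (1 - w * cnj z)"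
      using ne unfolding m_def by (simp add: field_simps)
    ultimately show ?thesis using ne nez by (simp add: m_def[of "m w"])
  qed
  moreover have "4 / (1 - (cmod (m w))\<^sup>2) = 4 * (cmod (1 - z * cnj w))\<^sup>2 / ((1 - (cmod z)\<^sup>2) * (1 - (cmod w)\<^sup>2))"
    unfolding one_minus_m[OF w] norm_one_minus_mult_cnj_commute[of z w] by simp
  ultimately show ?thesis by simp
qed

text \<open>The inequality ln x \<le> x^e / e trades the logarithm for small powers of its factors.
  Multiplied by a kernel, the bound is again of Forelli-Rudin type, with \<alpha> lowered by
  e.\<close>

lemma Bloch_Lipschitz_powr:
  assumes Bl: "Bloch_bounded L h" and z: "z \<in> \<D>" and w: "w \<in> \<D>" and "e > 0"
  shows "cmod (h w - h z) \<le> L * 4 powr e / e * (1 - (cmod z)\<^sup>2) powr - e * (1 - (cmod w)\<^sup>2) powr - e *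
    cmod (1 - z * cnj w) powr (2 * e)"
proof -
  note h = Bloch_boundedD[OF Bl] and L = Bloch_boundedD(3)[OF Bl]
  define a b c where "a = 1 - (cmod z)\<^sup>2" and "b = 1 - (cmod w)\<^sup>2" and "c = cmod (1 - z * cnj w)"
  have ab: "a > 0" "b > 0" "c > 0"
    using one_minus_norm_bounds(1) one_minus_mult_cnj_nonzero[of z w] z w by (auto simp: a_def b_def c_def)
  \<comment> \<open>\<open>ln_powr_bound\<close> needs an argument of at least 1, which comes from
    |z - w|^2 \<ge> 0 in the identity.\<close>
  have "a * b \<le> c\<^sup>2"
    using norm_one_minus_mult_cnj_square[of z w] zero_le_power2[of "cmod (z - w)"]
    unfolding a_def b_def c_def by linarith
  then have "a * b \<le> 4 * c\<^sup>2" using zero_le_power2[of c] by linarith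
  then have ge: "4 * c\<^sup>2 / (a * b) \<ge> 1"
    using ab by (simp add: le_divide_eq)
  have "cmod (h w - h z) \<le> L * ln (4 * c\<^sup>2 / (a * b))"
    unfolding a_def b_def c_def by (rule Bloch_Lipschitz[OF Bl z w])
  also have "\<dots> \<le> L * ((4 * c\<^sup>2 / (a * b)) powr e / e)"
    by (intro mult_left_mono ln_powr_bound ge L \<open>e > 0\<close>)
  also have "(4 * c\<^sup>2 / (a * b)) powr e = 4 powr e * a powr - e * b powr - e * c powr (2 * e)"
  proof -
    have "(c\<^sup>2) powr e = c powr (2 * e)"
      using ab by (simp add: powr_powr flip: powr_numeral)
    then show ?thesis
      using ab by (simp add: powr_divide powr_mult powr_minus divide_simps)
  qed
  finally show ?thesis by (simp add: a_def b_def c_def mult_ac)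
qed

subsection \<open>Carleson measures\<close>

text \<open>Moves powers of 1 - |u|^2 from the integrand into the weight; the constant is the
  quotient of the two normalising factors.\<close>

lemma nn_integral_weighted_area_powr:
  assumes "\<alpha> > -1" "\<alpha> + g > -1" and [measurable]: "F \<in> borel_measurable area_measure"
  shows "(\<integral>\<^sup>+u. ennreal ((1 - (cmod u)\<^sup>2) powr g) * F u \<partial>weighted_area \<alpha>) =
    ennreal ((1 + \<alpha>) / (1 + \<alpha> + g)) * (\<integral>\<^sup>+u. F u \<partial>weighted_area (\<alpha> + g))"
proof -
  have [measurable]: "(\<lambda>u. ennreal ((1 - (cmod u)\<^sup>2) powr g)) \<in> borel_measurable area_measure"
    by (simp add: measurable_restrict_space1 cong: measurable_cong_sets[OF sets_area_measure refl])
  have "(\<integral>\<^sup>+u. ennreal ((1 - (cmod u)\<^sup>2) powr g) * F u \<partial>weighted_area \<alpha>) =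
    (\<integral>\<^sup>+u. ennreal (weight \<alpha> u) * (ennreal ((1 - (cmod u)\<^sup>2) powr g) * F u) \<partial>area_measure)"
    by (rule nn_integral_weighted_area) measurable
  also have "\<dots> = (\<integral>\<^sup>+u. ennreal ((1 + \<alpha>) / (1 + \<alpha> + g)) * (ennreal (weight (\<alpha> + g) u) * F u) \<partial>area_measure)"
  proof (rule nn_integral_cong)
    fix u assume "u \<in> space area_measure"
    then have "1 - (cmod u)\<^sup>2 > 0" using one_minus_norm_bounds(1)[of u] by simp
    then have "weight \<alpha> u * (1 - (cmod u)\<^sup>2) powr g = (1 + \<alpha>) / (1 + \<alpha> + g) * weight (\<alpha> + g) u"
      using assms by (simp add: weight_def powr_add add.assoc)
    then show "ennreal (weight \<alpha> u) * (ennreal ((1 - (cmod u)\<^sup>2) powr g) * F u) =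
        ennreal ((1 + \<alpha>) / (1 + \<alpha> + g)) * (ennreal (weight (\<alpha> + g) u) * F u)"
      using assms by (simp add: mult.assoc[symmetric] ennreal_mult'[symmetric] weight_nonneg)
  qed
  also have "\<dots> = ennreal ((1 + \<alpha>) / (1 + \<alpha> + g)) * (\<integral>\<^sup>+u. ennreal (weight (\<alpha> + g) u) * F u \<partial>area_measure)"
    by (rule nn_integral_cmult) measurable
  also have "(\<integral>\<^sup>+u. ennreal (weight (\<alpha> + g) u) * F u \<partial>area_measure) = (\<integral>\<^sup>+u. F u \<partial>weighted_area (\<alpha> + g))"
    by (rule nn_integral_weighted_area[symmetric]) measurable
  finally show ?thesis .
qed

lemma nn_integral_mult_ennreal_le:
  assumes "f \<in> borel_measurable M" "\<And>x. x \<in> space M \<Longrightarrow> g x \<le> ennreal c * f x"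
    "(\<integral>\<^sup>+x. f x \<partial>M) \<le> ennreal d" "c \<ge> 0"
  shows "(\<integral>\<^sup>+x. g x \<partial>M) \<le> ennreal (c * d)"
proof -
  have "(\<integral>\<^sup>+x. g x \<partial>M) \<le> (\<integral>\<^sup>+x. ennreal c * f x \<partial>M)"
    by (rule nn_integral_mono) (use assms in auto)
  also have "\<dots> = ennreal c * (\<integral>\<^sup>+x. f x \<partial>M)"
    by (rule nn_integral_cmult) (use assms in auto)
  also have "\<dots> \<le> ennreal c * ennreal d"
    by (rule mult_left_mono) (use assms in auto)
  also have "\<dots> = ennreal (c * d)" using assms by (simp add: ennreal_mult')
  finally show ?thesis .
qed

lemma Lp_norm_1: "Lp_norm 1 M f = (\<integral>\<^sup>+z. ennreal (cmod (f z)) \<partial>M)"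
proof -
  have "(\<integral>\<^sup>+z. ennreal (cmod (f z) powr 1) \<partial>M) = (\<integral>\<^sup>+z. ennreal (cmod (f z)) \<partial>M)"
    by simp
  moreover have "ennreal (enn2real I powr 1) = I" if "I \<noteq> \<infinity>" for I
    using that by (simp add: top.not_eq_extremum)
  ultimately show ?thesis by (auto simp: Lp_norm_def Let_def)
qed

lemma Lp_norm_le_iff:
  assumes "q > 0" "A \<ge> 0"
  shows "Lp_norm q M f \<le> ennreal A \<longleftrightarrow> (\<integral>\<^sup>+z. ennreal (cmod (f z) powr q) \<partial>M) \<le> ennreal (A powr q)"
proof (cases "(\<integral>\<^sup>+z. ennreal (cmod (f z) powr q) \<partial>M) = \<infinity>")
  case True
  then show ?thesis by (simp add: Lp_norm_def top_unique)
next
  case False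
  then obtain I where I: "(\<integral>\<^sup>+z. ennreal (cmod (f z) powr q) \<partial>M) = ennreal I" "I \<ge> 0"
    by (cases "\<integral>\<^sup>+z. ennreal (cmod (f z) powr q) \<partial>M") auto
  have "I powr (1 / q) \<le> A \<longleftrightarrow> I \<le> A powr q"
  proof
    assume "I powr (1 / q) \<le> A"
    then have "(I powr (1 / q)) powr q \<le> A powr q" using assms by (intro powr_mono2) auto
    then show "I \<le> A powr q" using assms I by (simp add: powr_powr)
  next
    assume "I \<le> A powr q"
    then have "I powr (1 / q) \<le> (A powr q) powr (1 / q)" using assms I by (intro powr_mono2) auto
    then show "I powr (1 / q) \<le> A" using assms by (simp add: powr_powr)
  qed
  then show ?thesis using I assms by (simp add: Lp_norm_def)
qed

text \<open>The norm is replaced by any number A above it, so that test functions need only upper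
  estimates.\<close>

lemma carleson_measureD:
  assumes "carleson_measure \<mu> s 1 \<alpha>" "s > 0"
  obtains C where "C > 0" "\<And>f A. f holomorphic_on \<D> \<Longrightarrow> A \<ge> 0 \<Longrightarrow>
     (\<integral>\<^sup>+u. ennreal (cmod (f u)) \<partial>weighted_area \<alpha>) \<le> ennreal A \<Longrightarrow>
     (\<integral>\<^sup>+u. ennreal (cmod (f u) powr s) \<partial>\<mu>) \<le> ennreal ((C * A) powr s)"
proof -
  obtain C where C: "C > 0" "\<And>f. f \<in> bergman_space 1 \<alpha> \<Longrightarrow> Lp_norm s \<mu> f \<le> ennreal C * Lp_norm 1 (weighted_area \<alpha>) f"
    using assms(1) unfolding carleson_measure_def by auto
  show thesis
  proof (rule that[OF C(1)])
    fix f A assume f: "f holomorphic_on \<D>" "A \<ge> 0" "(\<integral>\<^sup>+u. ennreal (cmod (f u)) \<partial>weighted_area \<alpha>) \<le> ennreal A"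
    have "f \<in> bergman_space 1 \<alpha>"
      using f order_le_less_trans[OF f(3), of top] by (simp add: bergman_space_def Lp_norm_1)
    then have "Lp_norm s \<mu> f \<le> ennreal C * Lp_norm 1 (weighted_area \<alpha>) f" by (rule C(2))
    also have "\<dots> \<le> ennreal C * ennreal A"
      unfolding Lp_norm_1 by (rule mult_left_mono[OF f(3)]) simp
    also have "\<dots> = ennreal (C * A)" using C(1) f(2) by (simp add: ennreal_mult)
    finally show "(\<integral>\<^sup>+u. ennreal (cmod (f u) powr s) \<partial>\<mu>) \<le> ennreal ((C * A) powr s)"
      using C(1) f(2) assms(2) by (subst (asm) Lp_norm_le_iff) auto
  qed
qed

text \<open>The test function is the kernel of order 2 + \<alpha> + e * p at z. Forelli-Rudin gives
  its L^1 norm, and its modulus to the power 1 / p is the kernel of order (2 + \<alpha>) / p +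
  e.\<close>

lemma carleson_measure_kernel:
  assumes "carleson_measure \<mu> (1 / p) 1 \<alpha>" "p > 0" "\<alpha> > -1" "e > 0"
  obtains C where "C > 0" "\<And>z. cmod z < 1 \<Longrightarrow>
    (\<integral>\<^sup>+w. ennreal (cmod (kernel ((2 + \<alpha>) / p + e) z w)) \<partial>\<mu>) \<le> ennreal (C * (1 - (cmod z)\<^sup>2) powr - e)"
proof -
  obtain C where C: "C > 0" "\<And>f A. f holomorphic_on \<D> \<Longrightarrow> A \<ge> 0 \<Longrightarrow>
     (\<integral>\<^sup>+u. ennreal (cmod (f u)) \<partial>weighted_area \<alpha>) \<le> ennreal A \<Longrightarrow>
     (\<integral>\<^sup>+u. ennreal (cmod (f u) powr (1 / p)) \<partial>\<mu>) \<le> ennreal ((C * A) powr (1 / p))"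
    using carleson_measureD[OF assms(1)] assms(2) by auto
  obtain K where K: "K > 0" "\<And>z. cmod z < 1 \<Longrightarrow>
    (\<integral>\<^sup>+u. ennreal (cmod (kernel (2 + \<alpha> + e * p) z u)) \<partial>weighted_area \<alpha>) \<le> ennreal (K * (1 - (cmod z)\<^sup>2) powr - (e * p))"
    using Forelli_Rudin[OF assms(3), of "e * p"] assms by auto
  show thesis
  proof
    show "(C * K) powr (1 / p) > 0" using C K by simp
    fix z assume z: "cmod z < 1"
    have "(\<integral>\<^sup>+w. ennreal (cmod (kernel (2 + \<alpha> + e * p) w z) powr (1 / p)) \<partial>\<mu>) \<le>
      ennreal ((C * (K * (1 - (cmod z)\<^sup>2) powr - (e * p))) powr (1 / p))"
      by (rule C(2)) (use K(2)[OF z] K(1) z holomorphic_kernel[of z] in \<open>auto simp: norm_kernel_commute[of _ z]\<close>)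
    also have "(C * (K * (1 - (cmod z)\<^sup>2) powr - (e * p))) powr (1 / p) = (C * K) powr (1 / p) * (1 - (cmod z)\<^sup>2) powr - e"
      using C K assms by (simp add: powr_mult powr_powr)
    finally have le: "(\<integral>\<^sup>+w. ennreal (cmod (kernel (2 + \<alpha> + e * p) w z) powr (1 / p)) \<partial>\<mu>) \<le>
      ennreal ((C * K) powr (1 / p) * (1 - (cmod z)\<^sup>2) powr - e)" .
    have eq: "cmod (kernel (2 + \<alpha> + e * p) w z) powr (1 / p) = cmod (kernel ((2 + \<alpha>) / p + e) z w)" for w
    proof -
      have "- (2 + \<alpha> + e * p) * (1 / p) = - ((2 + \<alpha>) / p + e)"
        using assms(2) by (simp add: field_simps)
      then show ?thesis by (simp only: norm_kernel powr_powr norm_one_minus_mult_cnj_commute[of w])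
    qed
    show "(\<integral>\<^sup>+w. ennreal (cmod (kernel ((2 + \<alpha>) / p + e) z w)) \<partial>\<mu>) \<le> ennreal ((C * K) powr (1 / p) * (1 - (cmod z)\<^sup>2) powr - e)"
      using le unfolding eq .
  qed
qed

text \<open>The difference leaves the order 1 / (1 - |z|^2) of the pure kernel integral unchanged.
  The test function is (h w - h z) times the kernel of order 2 + \<alpha> + p: to the power 1 / p
  its modulus is |h w - h z|^(1/p) times the kernel of order (2 + \<alpha>) / p + 1, and since 1 / p
  \<ge> 1, the difference itself is at most 1 plus its power 1 / p. The constant depends on h only
  through L.\<close>

lemma carleson_measure_Bloch:
  assumes \<mu>: "carleson_measure \<mu> (1 / p) 1 \<alpha>" "sets \<mu> = sets (restrict_space borel \<D>)"
    and p: "0 < p" "p \<le> 1" and \<alpha>: "\<alpha> > -1" and "L \<ge> 0"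
  obtains C where "C > 0" "\<And>h z. Bloch_bounded L h \<Longrightarrow>
    cmod z < 1 \<Longrightarrow>
    (\<integral>\<^sup>+w. ennreal (cmod (h w - h z) * cmod (kernel ((2 + \<alpha>) / p + 1) z w)) \<partial>\<mu>) \<le> ennreal (C / (1 - (cmod z)\<^sup>2))"
proof -
  have space: "space \<mu> = \<D>" by (rule space_disk_measure[OF \<mu>(2)])
  obtain C where C: "C > 0" "\<And>f A. f holomorphic_on \<D> \<Longrightarrow> A \<ge> 0 \<Longrightarrow>
     (\<integral>\<^sup>+u. ennreal (cmod (f u)) \<partial>weighted_area \<alpha>) \<le> ennreal A \<Longrightarrow>
     (\<integral>\<^sup>+u. ennreal (cmod (f u) powr (1 / p)) \<partial>\<mu>) \<le> ennreal ((C * A) powr (1 / p))"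
    using carleson_measureD[OF \<mu>(1)] p by auto
  obtain C1 where C1: "C1 > 0" "\<And>z. cmod z < 1 \<Longrightarrow>
    (\<integral>\<^sup>+w. ennreal (cmod (kernel ((2 + \<alpha>) / p + 1) z w)) \<partial>\<mu>) \<le> ennreal (C1 * (1 - (cmod z)\<^sup>2) powr - 1)"
    using carleson_measure_kernel[OF \<mu>(1) p(1) \<alpha>, of 1] by auto
  \<comment> \<open>Small enough that the weight \<alpha> - e stays admissible and the Forelli-Rudin
    exponent p - e stays positive.\<close>
  define e where "e = min ((\<alpha> + 1) / 2) (p / 2)"
  have e: "e > 0" "\<alpha> - e > -1" "p - e > 0" using p \<alpha> by (auto simp: e_def min_def field_simps)
  obtain K where K: "K > 0" "\<And>z. cmod z < 1 \<Longrightarrow>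
    (\<integral>\<^sup>+u. ennreal (cmod (kernel (2 + (\<alpha> - e) + (p - e)) z u)) \<partial>weighted_area (\<alpha> - e)) \<le> ennreal (K * (1 - (cmod z)\<^sup>2) powr - (p - e))"
    using Forelli_Rudin[OF e(2) e(3)] by auto
  define B where "B = L * 4 powr e / e * ((1 + \<alpha>) / (1 + \<alpha> - e)) * K"
  have B: "B \<ge> 0" using \<open>L \<ge> 0\<close> e \<alpha> K by (simp add: B_def)
  show thesis
  proof
    show "C1 + (C * B) powr (1 / p) > 0" using C1 by (simp add: add_pos_nonneg)
    fix h z assume Bl: "Bloch_bounded L h" and z: "cmod z < 1"
    note h = Bloch_boundedD[OF Bl]
    define x where "x = 1 - (cmod z)\<^sup>2"
    have x: "x > 0" using one_minus_norm_bounds(1)[OF z] by (simp add: x_def)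
    define f where "f w = (h w - h z) * kernel (2 + \<alpha> + p) w z" for w
    have f_holo: "f holomorphic_on \<D>"
      unfolding f_def by (intro holomorphic_intros h(1) holomorphic_kernel) (use z in auto)
    have "(\<integral>\<^sup>+u. ennreal (cmod (f u)) \<partial>weighted_area \<alpha>) \<le>
      ennreal (L * 4 powr e / e * x powr - e * ((1 + \<alpha>) / (1 + \<alpha> - e) * (K * x powr - (p - e))))"
    proof (rule nn_integral_mult_ennreal_le)
      let ?F = "\<lambda>u. ennreal (cmod (kernel (2 + (\<alpha> - e) + (p - e)) z u))"
      have F: "?F \<in> borel_measurable area_measure"
        by (intro measurable_compose[OF _ measurable_ennreal] borel_measurable_area_continuous continuous_intros continuous_on_kernel2 z)
      show "(\<lambda>u. ennreal ((1 - (cmod u)\<^sup>2) powr - e) * ?F u) \<in> borel_measurable (weighted_area \<alpha>)"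
      proof (rule borel_measurable_times_ennreal)
        show "(\<lambda>u. ennreal ((1 - (cmod u)\<^sup>2) powr - e)) \<in> borel_measurable (weighted_area \<alpha>)"
          by (rule borel_measurable_weighted_borel) measurable
        show "?F \<in> borel_measurable (weighted_area \<alpha>)"
          using F by (simp add: borel_measurable_weighted_iff)
      qed
      have "(\<integral>\<^sup>+u. ennreal ((1 - (cmod u)\<^sup>2) powr - e) * ?F u \<partial>weighted_area \<alpha>) =
          ennreal ((1 + \<alpha>) / (1 + \<alpha> - e)) * (\<integral>\<^sup>+u. ?F u \<partial>weighted_area (\<alpha> - e))"
        using nn_integral_weighted_area_powr[OF \<alpha>, of "- e" ?F] e F by simp
      also have "\<dots> \<le> ennreal ((1 + \<alpha>) / (1 + \<alpha> - e)) * ennreal (K * x powr - (p - e))"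
        unfolding x_def by (rule mult_left_mono[OF K(2)[OF z]]) simp
      also have "\<dots> = ennreal ((1 + \<alpha>) / (1 + \<alpha> - e) * (K * x powr - (p - e)))"
        by (rule ennreal_mult'[symmetric]) (use e \<alpha> in simp)
      finally show "(\<integral>\<^sup>+u. ennreal ((1 - (cmod u)\<^sup>2) powr - e) * ?F u \<partial>weighted_area \<alpha>) \<le>
          ennreal ((1 + \<alpha>) / (1 + \<alpha> - e) * (K * x powr - (p - e)))" .
      show "L * 4 powr e / e * x powr - e \<ge> 0" using \<open>L \<ge> 0\<close> e by simp
      fix u assume "u \<in> space (weighted_area \<alpha>)"
      then have u: "u \<in> \<D>" by simp
      have "cmod (f u) = cmod (h u - h z) * cmod (1 - z * cnj u) powr - (2 + \<alpha> + p)"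
        by (simp only: f_def norm_mult norm_kernel norm_one_minus_mult_cnj_commute[of u])
      also have "\<dots> \<le> (L * 4 powr e / e * x powr - e * (1 - (cmod u)\<^sup>2) powr - e * cmod (1 - z * cnj u) powr (2 * e)) *
          cmod (1 - z * cnj u) powr - (2 + \<alpha> + p)"
        unfolding x_def by (rule mult_right_mono[OF Bloch_Lipschitz_powr[OF Bl _ u e(1)]]) (use z in auto)
      also have "\<dots> = (L * 4 powr e / e * x powr - e) * ((1 - (cmod u)\<^sup>2) powr - e * (cmod (1 - z * cnj u) powr (2 * e) *
          cmod (1 - z * cnj u) powr - (2 + \<alpha> + p)))"
        by (simp only: mult_ac)
      \<comment> \<open>The order drops by 2 e: one e is due to the weight \<alpha> - e, the other
        to the exponent p - e.\<close>
      also have "cmod (1 - z * cnj u) powr (2 * e) * cmod (1 - z * cnj u) powr - (2 + \<alpha> + p) = cmod (kernel (2 + (\<alpha> - e) + (p - e)) z u)"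
        by (simp add: norm_kernel powr_add[symmetric] algebra_simps)
      finally show "ennreal (cmod (f u)) \<le> ennreal (L * 4 powr e / e * x powr - e) * (ennreal ((1 - (cmod u)\<^sup>2) powr - e) * ?F u)"
        using \<open>L \<ge> 0\<close> e by (simp add: ennreal_mult[symmetric] ennreal_leI)
    qed
    also have "L * 4 powr e / e * x powr - e * ((1 + \<alpha>) / (1 + \<alpha> - e) * (K * x powr - (p - e))) = B * x powr - p"
    proof -
      have "x powr - e * x powr - (p - e) = x powr - p"
        by (simp add: powr_add[symmetric])
      then show ?thesis unfolding B_def by (simp add: mult_ac)
    qed
    finally have "(\<integral>\<^sup>+w. ennreal (cmod (f w) powr (1 / p)) \<partial>\<mu>) \<le> ennreal ((C * (B * x powr - p)) powr (1 / p))"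
      using B by (intro C(2) f_holo) auto
    also have "(C * (B * x powr - p)) powr (1 / p) = (C * B) powr (1 / p) * (1 / x)"
    proof -
      have "(x powr - p) powr (1 / p) = 1 / x" using x p by (simp add: powr_powr powr_neg_one)
      then show ?thesis using B C(1) by (simp add: powr_mult del: powr_powr)
    qed
    finally have J: "(\<integral>\<^sup>+w. ennreal (cmod (f w) powr (1 / p)) \<partial>\<mu>) \<le> ennreal ((C * B) powr (1 / p) * (1 / x))" .
    have fp: "cmod (f w) powr (1 / p) = cmod (h w - h z) powr (1 / p) * cmod (kernel ((2 + \<alpha>) / p + 1) z w)" for w
    proof -
      have "- (2 + \<alpha> + p) * (1 / p) = - ((2 + \<alpha>) / p + 1)"
        using p by (simp add: field_simps)
      then have "cmod (kernel (2 + \<alpha> + p) w z) powr (1 / p) = cmod (kernel ((2 + \<alpha>) / p + 1) z w)"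
        by (simp only: norm_kernel powr_powr norm_one_minus_mult_cnj_commute[of w])
      then show ?thesis by (simp add: f_def norm_mult powr_mult)
    qed
    have m1: "(\<lambda>w. ennreal (cmod (kernel ((2 + \<alpha>) / p + 1) z w))) \<in> borel_measurable \<mu>"
      using borel_measurable_continuous_on_restrict[OF continuous_on_kernel2[OF z]] \<mu>(2)
      by (simp cong: measurable_cong_sets)
    have "h \<in> borel_measurable \<mu>"
      using borel_measurable_continuous_on_restrict[OF holomorphic_on_imp_continuous_on[OF h(1)]] \<mu>(2)
      by (simp cong: measurable_cong_sets)
    moreover have "f \<in> borel_measurable \<mu>"
      using borel_measurable_continuous_on_restrict[OF holomorphic_on_imp_continuous_on[OF f_holo]] \<mu>(2)
      by (simp cong: measurable_cong_sets)
    ultimately have m2: "(\<lambda>w. ennreal (cmod (f w) powr (1 / p))) \<in> borel_measurable \<mu>" by measurable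
    have "(\<integral>\<^sup>+w. ennreal (cmod (h w - h z) * cmod (kernel ((2 + \<alpha>) / p + 1) z w)) \<partial>\<mu>) \<le>
      (\<integral>\<^sup>+w. ennreal (cmod (kernel ((2 + \<alpha>) / p + 1) z w)) + ennreal (cmod (f w) powr (1 / p)) \<partial>\<mu>)"
    proof (rule nn_integral_mono)
      fix w
      have "a \<le> 1 + a powr (1 / p)" if "a \<ge> 0" for a :: real
      proof (cases "a \<le> 1")
        case False
        then have "a powr 1 \<le> a powr (1 / p)" using p by (intro powr_mono) auto
        then show ?thesis using False by simp
      qed (use powr_ge_zero[of a "1 / p"] in linarith)
      from mult_right_mono[OF this[of "cmod (h w - h z)"], of "cmod (kernel ((2 + \<alpha>) / p + 1) z w)"]
      show "ennreal (cmod (h w - h z) * cmod (kernel ((2 + \<alpha>) / p + 1) z w)) \<le>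
        ennreal (cmod (kernel ((2 + \<alpha>) / p + 1) z w)) + ennreal (cmod (f w) powr (1 / p))"
        unfolding fp by (simp add: ennreal_plus[symmetric] distrib_right ennreal_leI del: ennreal_plus)
    qed
    also have "\<dots> = (\<integral>\<^sup>+w. ennreal (cmod (kernel ((2 + \<alpha>) / p + 1) z w)) \<partial>\<mu>) + (\<integral>\<^sup>+w. ennreal (cmod (f w) powr (1 / p)) \<partial>\<mu>)"
      by (rule nn_integral_add[OF m1 m2])
    also have "\<dots> \<le> ennreal (C1 * x powr - 1) + ennreal ((C * B) powr (1 / p) * (1 / x))"
      unfolding x_def by (rule add_mono[OF C1(2)[OF z] J[unfolded x_def]])
    also have "\<dots> = ennreal ((C1 + (C * B) powr (1 / p)) / x)"
      using C1 x by (simp add: ennreal_plus[symmetric] add_divide_distrib powr_minus_divide del: ennreal_plus)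
    finally show "(\<integral>\<^sup>+w. ennreal (cmod (h w - h z) * cmod (kernel ((2 + \<alpha>) / p + 1) z w)) \<partial>\<mu>) \<le>
      ennreal ((C1 + (C * B) powr (1 / p)) / (1 - (cmod z)\<^sup>2))" by (simp add: x_def)
  qed
qed

text \<open>By convention the integral of a non-integrable function is 0, so a bound on the
  nonnegative integral carries over without a separate proof of integrability.\<close>

lemma norm_integral_le:
  fixes f :: "'a \<Rightarrow> complex"
  assumes "(\<integral>\<^sup>+x. ennreal (cmod (f x)) \<partial>M) \<le> ennreal A" "A \<ge> 0"
  shows "cmod (\<integral>x. f x \<partial>M) \<le> A"
proof (cases "integrable M f")
  case True
  then have "ennreal (cmod (\<integral>x. f x \<partial>M)) \<le> (\<integral>\<^sup>+x. ennreal (cmod (f x)) \<partial>M)"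
    by (rule integral_norm_bound_ennreal)
  also note assms(1)
  finally show ?thesis using assms(2) by (simp add: ennreal_le_iff)
qed (use assms in \<open>simp add: not_integrable_integral_eq\<close>)

text \<open>Fatou's lemma along \<open>rad\<close>: a bound uniform in the truncation passes to the
  full integral, whose finiteness is not known beforehand.\<close>

lemma nn_integral_le_of_trunc:
  fixes F :: "complex \<Rightarrow> ennreal"
  assumes "sets M = sets (restrict_space borel \<D>)" and [measurable]: "F \<in> borel_measurable M"
    and le: "\<And>n. (\<integral>\<^sup>+u. indicator (ball 0 (rad n)) u * F u \<partial>M) \<le> c"
  shows "(\<integral>\<^sup>+u. F u \<partial>M) \<le> c"
proof -
  have space: "space M = \<D>" by (rule space_disk_measure[OF assms(1)])
  have [measurable]: "(\<lambda>u. indicator (ball 0 r) u :: ennreal) \<in> borel_measurable M" for r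
    using assms(1) by (simp add: measurable_restrict_space1 cong: measurable_cong_sets)
  have "(\<integral>\<^sup>+u. F u \<partial>M) = (\<integral>\<^sup>+u. liminf (\<lambda>n. indicator (ball 0 (rad n)) u * F u) \<partial>M)"
  proof (rule nn_integral_cong)
    fix u assume "u \<in> space M"
    then have "cmod u < 1" by (simp add: space)
    from eventually_less_rad[OF this] have "\<forall>\<^sub>F n in sequentially. indicator (ball 0 (rad n)) u * F u = F u"
      by eventually_elim simp
    then have "(\<lambda>n. indicator (ball 0 (rad n)) u * F u) \<longlonglongrightarrow> F u"
      by (rule tendsto_eventually)
    then show "F u = liminf (\<lambda>n. indicator (ball 0 (rad n)) u * F u)"
      by (intro lim_imp_Liminf[symmetric]) auto
  qed
  also have "\<dots> \<le> liminf (\<lambda>n. \<integral>\<^sup>+u. indicator (ball 0 (rad n)) u * F u \<partial>M)"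
    by (rule nn_integral_liminf) measurable
  also have "\<dots> \<le> limsup (\<lambda>n. \<integral>\<^sup>+u. indicator (ball 0 (rad n)) u * F u \<partial>M)"
    by (rule Liminf_le_Limsup) simp
  also have "\<dots> \<le> c"
    by (rule Limsup_bounded) (use le in simp)
  finally show ?thesis .
qed

text \<open>The reproducing formula bounds \<open>\<bar>f w\<bar>\<close> by \<open>N * (1 - \<bar>w\<bar>) powr - t\<close>, where \<open>N\<close> is the
  \<open>L\<^sup>1\<close> norm on the left; writing \<open>\<bar>f\<bar> = \<bar>f\<bar> powr p * \<bar>f\<bar> powr (1 - p)\<close> then bounds \<open>N\<close> by
  \<open>N powr (1 - p)\<close> times the integral on the right.\<close>

lemma bergman_embedding_L1:
  assumes p: "0 < p" "p \<le> 1" and \<alpha>: "\<alpha> > -1"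
  obtains C where "C > 0" "\<And>f A B. f holomorphic_on \<D> \<Longrightarrow> (\<And>u. u \<in> \<D> \<Longrightarrow> cmod (f u) \<le> B) \<Longrightarrow> A \<ge> 0 \<Longrightarrow>
     (\<integral>\<^sup>+u. ennreal (cmod (f u) powr p) \<partial>weighted_area \<alpha>) \<le> ennreal A \<Longrightarrow>
     (\<integral>\<^sup>+u. ennreal (cmod (f u)) \<partial>weighted_area ((2 + \<alpha>) / p - 2)) \<le> ennreal (C * A powr (1 / p))"
proof -
  define t where "t = (2 + \<alpha>) / p"
  have tp: "t * p = 2 + \<alpha>" using p by (simp add: t_def)
  have t: "t > 1"
  proof -
    have "p < 2 + \<alpha>" using p \<alpha> by simp
    then show ?thesis using p by (simp add: t_def)
  qed
  define K where "K = (2 powr t) powr (1 - p) * ((t - 1) / (1 + \<alpha>))"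
  have K: "K > 0" using t \<alpha> by (simp add: K_def)
  show thesis
  proof
    show "K powr (1 / p) > 0" using K by simp
    fix f A B assume f: "f holomorphic_on \<D>" "\<And>u. u \<in> \<D> \<Longrightarrow> cmod (f u) \<le> B" and A: "A \<ge> 0"
      "(\<integral>\<^sup>+u. ennreal (cmod (f u) powr p) \<partial>weighted_area \<alpha>) \<le> ennreal A"
    let ?W = "weighted_area (t - 2)"
    have fm: "f \<in> borel_measurable area_measure"
      by (rule borel_measurable_area_continuous[OF holomorphic_on_imp_continuous_on[OF f(1)]])
    have int: "integrable ?W f"
      by (rule integrable_weighted_area_bounded[of _ _ B]) (use t fm f(2) in \<open>auto simp: borel_measurable_weighted_iff\<close>)
    \<comment> \<open>N is finite because f is bounded on the disk; this is what allows a power of N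
      to be cancelled at the end.\<close>
    define N where "N = (\<integral>u. cmod (f u) \<partial>?W)"
    have N0: "N \<ge> 0" unfolding N_def by (rule integral_nonneg_AE) simp
    have N: "(\<integral>\<^sup>+u. ennreal (cmod (f u)) \<partial>?W) = ennreal N"
      unfolding N_def by (rule nn_integral_eq_integral) (use int in auto)
    have pw: "cmod (f w) \<le> 2 powr t * N * (1 - (cmod w)\<^sup>2) powr - t" if w: "w \<in> \<D>" for w
    proof -
      have w1: "cmod w < 1" using w by simp
      have "f w = (\<integral>u. f u * kernel (2 + (t - 2)) w u \<partial>?W)"
        by (rule bergman_reproducing) (use t f int w in auto)
      also have "cmod \<dots> \<le> (1 - cmod w) powr - t * N"
      proof (rule norm_integral_le)
        show "(\<integral>\<^sup>+u. ennreal (cmod (f u * kernel (2 + (t - 2)) w u)) \<partial>?W) \<le> ennreal ((1 - cmod w) powr - t * N)"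
        proof (rule nn_integral_mult_ennreal_le)
          show "(\<lambda>u. ennreal (cmod (f u))) \<in> borel_measurable ?W" using int by auto
          fix u assume "u \<in> space ?W"
          then have "cmod (kernel t w u) \<le> (1 - cmod w) powr - t"
            using norm_kernel_le[of w u t] t w1 by simp
          from mult_right_mono[OF this, of "cmod (f u)"]
          show "ennreal (cmod (f u * kernel (2 + (t - 2)) w u)) \<le> ennreal ((1 - cmod w) powr - t) * ennreal (cmod (f u))"
            by (simp add: norm_mult ennreal_mult'[symmetric] ennreal_leI mult.commute)
        qed (use N in auto)
      qed (use N0 in simp)
      also have "\<dots> \<le> (2 powr t * (1 - (cmod w)\<^sup>2) powr - t) * N"
      proof (rule mult_right_mono[OF _ N0])
        have "(1 - cmod w) powr - t \<le> ((1 - (cmod w)\<^sup>2) / 2) powr - t"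
          using one_minus_norm_bounds[OF w1] t by (intro powr_mono2') auto
        also have "\<dots> = 2 powr t * (1 - (cmod w)\<^sup>2) powr - t"
          using one_minus_norm_bounds(1)[OF w1] by (simp add: powr_divide powr_minus field_simps)
        finally show "(1 - cmod w) powr - t \<le> 2 powr t * (1 - (cmod w)\<^sup>2) powr - t" .
      qed
      finally show ?thesis by (simp add: mult_ac)
    qed
    define c where "c = (2 powr t * N) powr (1 - p)"
    have "ennreal N \<le> ennreal (c * ((t - 1) / (1 + \<alpha>) * A))"
      unfolding N[symmetric]
    proof (rule nn_integral_mult_ennreal_le)
      let ?F = "\<lambda>u. ennreal (cmod (f u) powr p)"
      have F: "?F \<in> borel_measurable area_measure" using fm by measurable
      show "(\<lambda>u. ennreal ((1 - (cmod u)\<^sup>2) powr (- t * (1 - p))) * ?F u) \<in> borel_measurable ?W"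
      proof (rule borel_measurable_times_ennreal)
        show "(\<lambda>u. ennreal ((1 - (cmod u)\<^sup>2) powr (- t * (1 - p)))) \<in> borel_measurable ?W"
          by (rule borel_measurable_weighted_borel) measurable
        show "?F \<in> borel_measurable ?W"
          using F by (simp add: borel_measurable_weighted_iff)
      qed
      \<comment> \<open>The factor |f|^(1 - p) costs a power of 1 - |u|^2 that turns the weight t -
        2 into exactly \<alpha>, because t * p = 2 + \<alpha>.\<close>
      have a: "t - 2 + - t * (1 - p) = \<alpha>" using tp by (simp add: algebra_simps)
      have "(\<integral>\<^sup>+u. ennreal ((1 - (cmod u)\<^sup>2) powr (- t * (1 - p))) * ?F u \<partial>?W) =
          ennreal ((1 + (t - 2)) / (1 + (t - 2) + - t * (1 - p))) * (\<integral>\<^sup>+u. ?F u \<partial>weighted_area (t - 2 + - t * (1 - p)))"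
      proof (rule nn_integral_weighted_area_powr[OF _ _ F])
        show "t - 2 + - t * (1 - p) > -1" unfolding a by (rule \<alpha>)
      qed (use t in simp)
      also have "1 + (t - 2) + - t * (1 - p) = 1 + \<alpha>" using a by simp
      also have "ennreal ((1 + (t - 2)) / (1 + \<alpha>)) * (\<integral>\<^sup>+u. ?F u \<partial>weighted_area (t - 2 + - t * (1 - p))) \<le>
          ennreal ((t - 1) / (1 + \<alpha>)) * ennreal A"
        unfolding a by (intro mult_mono A) auto
      also have "\<dots> = ennreal ((t - 1) / (1 + \<alpha>) * A)"
        using t \<alpha> by (intro ennreal_mult'[symmetric]) auto
      finally show "(\<integral>\<^sup>+u. ennreal ((1 - (cmod u)\<^sup>2) powr (- t * (1 - p))) * ?F u \<partial>?W) \<le> ennreal ((t - 1) / (1 + \<alpha>) * A)" .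
      show "c \<ge> 0" by (simp add: c_def)
      fix u assume "u \<in> space ?W"
      then have u: "u \<in> \<D>" by simp
      have x: "1 - (cmod u)\<^sup>2 > 0" using one_minus_norm_bounds(1)[of u] u by simp
      have "cmod (f u) = cmod (f u) powr (1 - p) * cmod (f u) powr p"
        by (cases "f u = 0") (simp_all add: powr_add[symmetric])
      also have "\<dots> \<le> (2 powr t * N * (1 - (cmod u)\<^sup>2) powr - t) powr (1 - p) * cmod (f u) powr p"
        using pw[OF u] p by (intro mult_right_mono powr_mono2) auto
      also have "(2 powr t * N * (1 - (cmod u)\<^sup>2) powr - t) powr (1 - p) = c * (1 - (cmod u)\<^sup>2) powr (- t * (1 - p))"
        using x N0 by (simp add: c_def powr_mult powr_powr)
      finally show "ennreal (cmod (f u)) \<le> ennreal c * (ennreal ((1 - (cmod u)\<^sup>2) powr (- t * (1 - p))) * ?F u)"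
        by (simp add: ennreal_mult[symmetric] ennreal_leI c_def mult.assoc)
    qed
    then have le: "N \<le> c * ((t - 1) / (1 + \<alpha>) * A)"
      using A(1) t \<alpha> by (simp add: ennreal_le_iff c_def)
    have "N \<le> (K * A) powr (1 / p)"
    proof (cases "N = 0")
      case False
      then have Np: "N > 0" using N0 by simp
      have "N \<le> N powr (1 - p) * (K * A)"
        using le N0 by (simp add: c_def K_def powr_mult mult_ac)
      moreover have "N = N powr (1 - p) * N powr p" using Np by (simp add: powr_add[symmetric])
      ultimately have "N powr (1 - p) * N powr p \<le> N powr (1 - p) * (K * A)" by simp
      then have "N powr p \<le> K * A" using Np by simp
      then have "(N powr p) powr (1 / p) \<le> (K * A) powr (1 / p)" using p by (intro powr_mono2) auto
      then show ?thesis using p Np by (simp add: powr_powr)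
    qed simp
    then show "(\<integral>\<^sup>+u. ennreal (cmod (f u)) \<partial>weighted_area ((2 + \<alpha>) / p - 2)) \<le> ennreal (K powr (1 / p) * A powr (1 / p))"
      using N K A(1) by (simp add: t_def[symmetric] powr_mult ennreal_leI)
  qed
qed

section \<open>Bergman projections of bounded functions and the dual pairing\<close>

lemma toeplitz_eq: "toeplitz \<mu> \<gamma> f z = (\<integral>w. f w * kernel (2 + \<gamma>) z w \<partial>\<mu>)"
  by (simp add: toeplitz_def kernel_def)

text \<open>Differentiation raises the order of the kernel by one, and Forelli-Rudin with b = 1
  bounds its integral by C / (1 - |w|^2). At the origin the kernel is 1, so h 0 is a mean of \<phi>.
  One L serves all \<phi>, in particular all truncations.\<close>

lemma bergman_projection_Bloch:
  assumes "\<beta> > -1"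
  obtains L where "L > 0" "\<And>\<phi> h. \<phi> \<in> borel_measurable (weighted_area \<beta>) \<Longrightarrow> (\<And>u. u \<in> \<D> \<Longrightarrow> cmod (\<phi> u) \<le> 1) \<Longrightarrow>
    h = (\<lambda>w. \<integral>u. \<phi> u * kernel (2 + \<beta>) w u \<partial>weighted_area \<beta>) \<Longrightarrow>
    Bloch_bounded L h \<and> cmod (h 0) \<le> 1"
proof -
  obtain C where C: "C > 0" "\<And>z. cmod z < 1 \<Longrightarrow>
    (\<integral>\<^sup>+u. ennreal (cmod (kernel (2 + \<beta> + 1) z u)) \<partial>weighted_area \<beta>) \<le> ennreal (C * (1 - (cmod z)\<^sup>2) powr - 1)"
    using Forelli_Rudin[OF assms, of 1] by auto
  show thesis
  proof
    show "(2 + \<beta>) * C > 0" using C assms by simp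
    fix \<phi> h assume \<phi>: "\<phi> \<in> borel_measurable (weighted_area \<beta>)" "\<And>u. u \<in> \<D> \<Longrightarrow> cmod (\<phi> u) \<le> 1"
      and h: "h = (\<lambda>w. \<integral>u. \<phi> u * kernel (2 + \<beta>) w u \<partial>weighted_area \<beta>)"
    let ?W = "weighted_area \<beta>"
    have d: "(h has_field_derivative (2 + \<beta>) * (\<integral>u. \<phi> u * cnj u * kernel (2 + \<beta> + 1) w u \<partial>?W)) (at w)" if "w \<in> \<D>" for w
      using has_field_derivative_integral_kernel(1)[OF finite_measure_weighted_area[OF assms] sets_weighted_area \<phi>, of "2 + \<beta>" w]
        that assms by (simp add: h)
    have "h holomorphic_on \<D>"
      unfolding h by (rule holomorphic_integral_kernel[OF finite_measure_weighted_area[OF assms] sets_weighted_area \<phi>]) (use assms in auto)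
    moreover have "(1 - (cmod w)\<^sup>2) * cmod (deriv h w) \<le> (2 + \<beta>) * C" if w: "w \<in> \<D>" for w
    proof -
      have w1: "cmod w < 1" using w by simp
      have x: "1 - (cmod w)\<^sup>2 > 0" by (rule one_minus_norm_bounds(1)[OF w1])
      have "cmod (\<integral>u. \<phi> u * cnj u * kernel (2 + \<beta> + 1) w u \<partial>?W) \<le> C * (1 - (cmod w)\<^sup>2) powr - 1"
      proof (rule norm_integral_le)
        have "(\<integral>\<^sup>+u. ennreal (cmod (\<phi> u * cnj u * kernel (2 + \<beta> + 1) w u)) \<partial>?W) \<le>
          (\<integral>\<^sup>+u. ennreal (cmod (kernel (2 + \<beta> + 1) w u)) \<partial>?W)"
        proof (intro nn_integral_mono ennreal_leI)
          fix u assume "u \<in> space ?W"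
          then have "cmod (\<phi> u) * cmod u \<le> 1" using \<phi>(2)[of u] by (intro mult_le_one) auto
          from mult_right_mono[OF this, of "cmod (kernel (2 + \<beta> + 1) w u)"]
          show "cmod (\<phi> u * cnj u * kernel (2 + \<beta> + 1) w u) \<le> cmod (kernel (2 + \<beta> + 1) w u)"
            by (simp add: norm_mult)
        qed
        also note C(2)[OF w1]
        finally show "(\<integral>\<^sup>+u. ennreal (cmod (\<phi> u * cnj u * kernel (2 + \<beta> + 1) w u)) \<partial>?W) \<le> ennreal (C * (1 - (cmod w)\<^sup>2) powr - 1)" .
      qed (use C in simp)
      also have "\<dots> = C / (1 - (cmod w)\<^sup>2)" using x by (simp add: powr_minus_divide)
      finally have le: "cmod (\<integral>u. \<phi> u * cnj u * kernel (2 + \<beta> + 1) w u \<partial>?W) \<le> C / (1 - (cmod w)\<^sup>2)" .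
      have "cmod (deriv h w) = (2 + \<beta>) * cmod (\<integral>u. \<phi> u * cnj u * kernel (2 + \<beta> + 1) w u \<partial>?W)"
        unfolding DERIV_imp_deriv[OF d[OF w]] norm_mult norm_of_real using assms by simp
      also have "\<dots> \<le> (2 + \<beta>) * (C / (1 - (cmod w)\<^sup>2))"
        using le assms by (intro mult_left_mono) auto
      finally show ?thesis using x by (simp add: field_simps)
    qed
    moreover have "cmod (h 0) \<le> 1"
      unfolding h
    proof (rule norm_integral_le)
      have "(\<integral>\<^sup>+u. ennreal (cmod (\<phi> u * kernel (2 + \<beta>) 0 u)) \<partial>?W) \<le> (\<integral>\<^sup>+u. 1 \<partial>?W)"
        by (intro nn_integral_mono) (use \<phi>(2) in \<open>auto simp: ennreal_le_1\<close>)
      then show "(\<integral>\<^sup>+u. ennreal (cmod (\<phi> u * kernel (2 + \<beta>) 0 u)) \<partial>?W) \<le> ennreal 1"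
        by (simp add: emeasure_weighted_area_disk[OF assms])
    qed simp
    ultimately show "Bloch_bounded ((2 + \<beta>) * C) h \<and> cmod (h 0) \<le> 1"
      by (simp add: Bloch_bounded_def)
  qed
qed

lemma measurable_id_borel:
  assumes "sets M = sets (restrict_space borel (S :: complex set))"
  shows "(\<lambda>x. x) \<in> measurable M borel"
  using assms measurable_restrict_space1[of "\<lambda>x. x" borel borel S] by (simp cong: measurable_cong_sets)

text \<open>Continuity holds on the product of the open disks; the indicator of that open set gives
  a Borel function on the whole plane squared, which can be pulled back to the product
  measure.\<close>

lemma borel_measurable_kernel_pair:
  assumes M: "sets M = sets (restrict_space borel \<D>)" and N: "sets N = sets (restrict_space borel \<D>)"
  shows "(\<lambda>(z, w). kernel s z w) \<in> borel_measurable (M \<Otimes>\<^sub>M N)"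
proof -
  note [measurable] = measurable_id_borel[OF M] measurable_id_borel[OF N]
  have "open (\<D> \<times> \<D> :: (complex \<times> complex) set)" by (intro open_Times) auto
  then have k: "(\<lambda>x. indicator (\<D> \<times> \<D>) x *\<^sub>R (case x of (z, w) \<Rightarrow> kernel s z w)) \<in> borel_measurable borel"
    by (intro borel_measurable_continuous_on_indicator continuous_on_kernel_pair) auto
  have "(\<lambda>x. (fst x, snd x)) \<in> measurable (M \<Otimes>\<^sub>M N) (borel \<Otimes>\<^sub>M borel)"
    by measurable
  then have "(\<lambda>x. x) \<in> measurable (M \<Otimes>\<^sub>M N) (borel :: (complex \<times> complex) measure)"
    by (simp add: borel_prod)
  from measurable_compose[OF this k]
  have "(\<lambda>x. indicator (\<D> \<times> \<D>) x *\<^sub>R (case x of (z, w) \<Rightarrow> kernel s z w)) \<in> borel_measurable (M \<Otimes>\<^sub>M N)" .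
  moreover have "space M = \<D>" "space N = \<D>"
    using space_disk_measure[OF M] space_disk_measure[OF N] by auto
  ultimately show ?thesis
    by (subst measurable_cong) (auto simp: space_pair_measure indicator_def)
qed

text \<open>The cutoff of \<open>\<phi>\<close> keeps the kernel bounded, so Fubini applies.\<close>

lemma toeplitz_pairing:
  assumes M: "finite_measure \<mu>" "sets \<mu> = sets (restrict_space borel \<D>)" and \<beta>: "\<beta> > -1"
    and f: "f \<in> borel_measurable \<mu>" "\<And>w. w \<in> \<D> \<Longrightarrow> cmod (f w) \<le> B"
    and \<phi>: "\<phi> \<in> borel_measurable (weighted_area \<beta>)" "\<And>u. u \<in> \<D> \<Longrightarrow> cmod (\<phi> u) \<le> B'"
    and r: "r < 1" "\<And>u. r \<le> cmod u \<Longrightarrow> \<phi> u = 0"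
  shows "(\<integral>u. toeplitz \<mu> \<beta> f u * cnj (\<phi> u) \<partial>weighted_area \<beta>) =
    (\<integral>w. f w * cnj (\<integral>u. \<phi> u * kernel (2 + \<beta>) w u \<partial>weighted_area \<beta>) \<partial>\<mu>)"
proof -
  let ?W = "weighted_area \<beta>"
  interpret W: finite_measure ?W by (rule finite_measure_weighted_area[OF \<beta>])
  interpret M: finite_measure \<mu> by fact
  interpret pair_sigma_finite ?W \<mu> ..
  interpret P: finite_measure "?W \<Otimes>\<^sub>M \<mu>" by (rule finite_measure_pair_measure) (use W.finite_measure_axioms M in auto)
  have space: "space \<mu> = \<D>" by (rule space_disk_measure[OF M(2)])
  have B: "B \<ge> 0" "B' \<ge> 0" using f(2)[of 0] \<phi>(2)[of 0] norm_ge_zero[of "f 0"] norm_ge_zero[of "\<phi> 0"] by (simp_all del: norm_ge_zero)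
  note [measurable] = f(1) \<phi>(1) borel_measurable_kernel_pair[OF sets_weighted_area[of \<beta>] M(2), of "2 + \<beta>"]
  have int: "integrable (?W \<Otimes>\<^sub>M \<mu>) (\<lambda>(u, w). f w * kernel (2 + \<beta>) u w * cnj (\<phi> u))"
  proof (rule P.integrable_const_bound[of _ "B * (1 - \<bar>r\<bar>) powr - (2 + \<beta>) * B'"])
    show "AE x in ?W \<Otimes>\<^sub>M \<mu>. norm (case x of (u, w) \<Rightarrow> f w * kernel (2 + \<beta>) u w * cnj (\<phi> u)) \<le> B * (1 - \<bar>r\<bar>) powr - (2 + \<beta>) * B'"
    proof (rule AE_I2)
      fix x assume "x \<in> space (?W \<Otimes>\<^sub>M \<mu>)"
      then obtain u w where x: "x = (u, w)" "u \<in> \<D>" "w \<in> \<D>"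
        by (auto simp: space_pair_measure space)
      have "cmod (f w * kernel (2 + \<beta>) u w * cnj (\<phi> u)) \<le> B * (1 - \<bar>r\<bar>) powr - (2 + \<beta>) * B'"
      proof (cases "r \<le> cmod u")
        case False
        then have "r > 0" using norm_ge_zero[of u] by linarith
        with False have "cmod (kernel (2 + \<beta>) u w) \<le> (1 - \<bar>r\<bar>) powr - (2 + \<beta>)"
          using r(1) x \<beta>
          by (intro order_trans[OF norm_kernel_le] powr_mono2') auto
        then show ?thesis
          unfolding norm_mult complex_mod_cnj using f(2)[of w] \<phi>(2)[of u] x B by (intro mult_mono) auto
      qed (use r(2) B in auto)
      then show "norm (case x of (u, w) \<Rightarrow> f w * kernel (2 + \<beta>) u w * cnj (\<phi> u)) \<le> B * (1 - \<bar>r\<bar>) powr - (2 + \<beta>) * B'"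
        by (simp add: x)
    qed
  qed measurable
  have "(\<integral>u. toeplitz \<mu> \<beta> f u * cnj (\<phi> u) \<partial>?W) = (\<integral>u. (\<integral>w. f w * kernel (2 + \<beta>) u w * cnj (\<phi> u) \<partial>\<mu>) \<partial>?W)"
    unfolding toeplitz_eq by simp
  also have "\<dots> = (\<integral>w. (\<integral>u. f w * kernel (2 + \<beta>) u w * cnj (\<phi> u) \<partial>?W) \<partial>\<mu>)"
    using Fubini_integral[OF int] by simp
  also have "\<dots> = (\<integral>w. f w * cnj (\<integral>u. \<phi> u * kernel (2 + \<beta>) w u \<partial>?W) \<partial>\<mu>)"
  proof (rule Bochner_Integration.integral_cong)
    fix w assume "w \<in> space \<mu>"
    then have w: "cmod w < 1" by (simp add: space)
    have "(\<integral>u. f w * kernel (2 + \<beta>) u w * cnj (\<phi> u) \<partial>?W) = (\<integral>u. f w * (cnj (\<phi> u * kernel (2 + \<beta>) w u)) \<partial>?W)"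
      by (rule Bochner_Integration.integral_cong) (use cnj_kernel[OF w] in auto)
    also have "\<dots> = f w * cnj (\<integral>u. \<phi> u * kernel (2 + \<beta>) w u \<partial>?W)"
      by (simp only: integral_mult_right_zero Bochner_Integration.integral_cnj)
    finally show "(\<integral>u. f w * kernel (2 + \<beta>) u w * cnj (\<phi> u) \<partial>?W) = f w * cnj (\<integral>u. \<phi> u * kernel (2 + \<beta>) w u \<partial>?W)" .
  qed simp
  finally show ?thesis .
qed

subsection \<open>Sufficiency\<close>

lemma borel_measurable_disk_continuous:
  fixes f :: "complex \<Rightarrow> 'a :: topological_space"
  assumes "sets M = sets (restrict_space borel \<D>)" "continuous_on \<D> f"
  shows "f \<in> borel_measurable M"
  using borel_measurable_continuous_on_restrict[OF assms(2)] assms(1) by (simp cong: measurable_cong_sets)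

lemma LB1_bound:
  assumes "g \<in> LB1"
  obtains G where "G \<ge> 0" "\<And>z. z \<in> \<D> \<Longrightarrow> (1 - (cmod z)\<^sup>2) * ln (2 / (1 - (cmod z)\<^sup>2)) * cmod (deriv g z) \<le> G"
proof -
  let ?f = "\<lambda>z. (1 - (cmod z)\<^sup>2) * ln (2 / (1 - (cmod z)\<^sup>2)) * cmod (deriv g z)"
  have "(SUP z\<in>\<D>. ennreal (?f z)) < \<infinity>"
    using assms unfolding LB1_def by (auto simp: ennreal_add_less_top)
  then obtain G where G: "(SUP z\<in>\<D>. ennreal (?f z)) = ennreal G" "G \<ge> 0"
    by (cases "SUP z\<in>\<D>. ennreal (?f z)") auto
  show thesis
  proof
    show "?f z \<le> G" if "z \<in> \<D>" for z
      using SUP_upper[OF that, of "\<lambda>z. ennreal (?f z)"] G by (simp add: ennreal_le_iff)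
  qed (rule G)
qed

lemma toeplitz_one_derivative:
  assumes "finite_measure \<mu>" "sets \<mu> = sets (restrict_space borel \<D>)" "2 + \<gamma> > 0" "cmod z < 1"
  shows "(toeplitz \<mu> \<gamma> (\<lambda>_. 1) has_field_derivative (2 + \<gamma>) * (\<integral>w. cnj w * kernel (2 + \<gamma> + 1) z w \<partial>\<mu>)) (at z)"
  using has_field_derivative_integral_kernel(1)[OF assms(1,2), of "\<lambda>_. 1" 1 "2 + \<gamma>" z] assms
  by (simp add: toeplitz_eq[abs_def])

lemma integrable_kernel:
  assumes "finite_measure \<mu>" "sets \<mu> = sets (restrict_space borel \<D>)" "s > 0" "cmod z < 1"
  shows "integrable \<mu> (kernel s z)"
  using has_field_derivative_integral_kernel(2)[OF assms(1,2), of "\<lambda>_. 1" 1 s z] assms by simp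

text \<open>Three exchange rates for the logarithm of \<open>LB1\<close>: it absorbs constants, it
  absorbs the logarithm of \<open>Bloch_radial\<close>, and it is itself worth at most half a
  negative power.\<close>

lemma ln_two_div_ge:
  assumes "0 < x" "x \<le> (1 :: real)"
  shows "ln (2 / x) \<ge> ln 2" "ln (4 / x) \<le> 2 * ln (2 / x)" "ln (2 / x) \<le> 4 * x powr - (1 / 2)"
proof -
  have "ln x \<le> 0" using assms by simp
  moreover have "ln (4 :: real) = 2 * ln 2" using ln_realpow[of 2 2] by simp
  ultimately show "ln (2 / x) \<ge> ln 2" "ln (4 / x) \<le> 2 * ln (2 / x)"
    using assms by (simp_all add: ln_div)
  have "ln (2 / x) \<le> (2 / x) powr (1 / 2) / (1 / 2)"
    using assms by (intro ln_powr_bound) auto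
  also have "(2 / x) powr (1 / 2) = 2 powr (1 / 2) * x powr - (1 / 2)"
    using assms by (simp add: powr_divide powr_minus_divide)
  also have "2 powr (1 / 2) \<le> (2 :: real) powr 1" by (intro powr_mono) auto
  finally show "ln (2 / x) \<le> 4 * x powr - (1 / 2)" by (simp add: mult_right_mono)
qed

text \<open>Replacing \<open>h w\<close> by \<open>h z\<close> costs a bounded amount, by the Carleson property; the growth
  \<open>\<bar>h z\<bar> = O(log)\<close> is compensated by the logarithm in the definition of \<open>LB1\<close>.\<close>

lemma Bloch_kernel_integral_bound:
  assumes \<mu>: "finite_measure \<mu>" "sets \<mu> = sets (restrict_space borel \<D>)"
    and carl: "carleson_measure \<mu> (1 / p) 1 \<alpha>" and p: "0 < p" "p \<le> 1" and \<alpha>: "\<alpha> > -1"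
    and LB: "toeplitz \<mu> ((2 + \<alpha>) / p - 2) (\<lambda>_. 1) \<in> LB1" and L: "L \<ge> 0"
  obtains K where "K > 0" "\<And>h z. Bloch_bounded L h \<Longrightarrow>
    cmod (h 0) \<le> 1 \<Longrightarrow> cmod z < 1 \<Longrightarrow>
    cmod (\<integral>w. h w * kernel ((2 + \<alpha>) / p + 1) z w \<partial>\<mu>) \<le> K / (1 - (cmod z)\<^sup>2)"
proof -
  define t where "t = (2 + \<alpha>) / p"
  have t: "t > 0" using p \<alpha> by (simp add: t_def)
  define g where "g = toeplitz \<mu> (t - 2) (\<lambda>_. 1)"
  obtain C1 where C1: "C1 > 0" "\<And>h z. Bloch_bounded L h \<Longrightarrow>
    cmod z < 1 \<Longrightarrow>
    (\<integral>\<^sup>+w. ennreal (cmod (h w - h z) * cmod (kernel (t + 1) z w)) \<partial>\<mu>) \<le> ennreal (C1 / (1 - (cmod z)\<^sup>2))"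
    using carleson_measure_Bloch[OF carl \<mu>(2) p \<alpha> L] unfolding t_def by blast
  \<comment> \<open>Kernel integrals are controlled for orders above t only. Passing from t to t + 1
    / 2 costs half a power of 1 - |z|^2 in the bound for g; the logarithm costs at most another
    half, and the factor x in the claim absorbs both.\<close>
  obtain C2 where C2: "C2 > 0" "\<And>z. cmod z < 1 \<Longrightarrow>
    (\<integral>\<^sup>+w. ennreal (cmod (kernel (t + 1 / 2) z w)) \<partial>\<mu>) \<le> ennreal (C2 * (1 - (cmod z)\<^sup>2) powr - (1 / 2))"
    using carleson_measure_kernel[OF carl p(1) \<alpha>, of "1 / 2"] unfolding t_def by auto
  obtain G where G: "G \<ge> 0" "\<And>z. z \<in> \<D> \<Longrightarrow> (1 - (cmod z)\<^sup>2) * ln (2 / (1 - (cmod z)\<^sup>2)) * cmod (deriv g z) \<le> G"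
    using LB1_bound[of g] LB by (auto simp: g_def t_def)
  \<comment> \<open>From |h z| \<le> |h 0| + L ln (4 / x): the term |h 0| \<le> 1 is at most
    \<Lambda> / ln 2, and the logarithm is at most 2 \<Lambda>.\<close>
  define L' where "L' = 1 / ln 2 + 2 * L"
  have L': "L' > 0" using L by (simp add: L'_def add_pos_nonneg)
  define K where "K = C1 + L' * (8 * C2 + G / t)"
  show thesis
  proof
    show "K > 0" using C1 C2 L' G t by (simp add: K_def add_pos_nonneg)
    fix h z assume Bl: "Bloch_bounded L h" and h0: "cmod (h 0) \<le> 1" and z: "cmod z < 1"
    note h = Bloch_boundedD[OF Bl]
    define x where "x = 1 - (cmod z)\<^sup>2"
    have x: "0 < x" "x \<le> 1" using one_minus_norm_bounds[OF z] by (auto simp: x_def)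
    define \<Lambda> where "\<Lambda> = ln (2 / x)"
    have \<Lambda>: "\<Lambda> \<ge> ln 2" "\<Lambda> > 0" "\<Lambda> \<le> 4 * x powr - (1 / 2)"
      using ln_two_div_ge[OF x] less_le_trans[OF ln_gt_zero[of "2::real"] ln_two_div_ge(1)[OF x]] by (auto simp: \<Lambda>_def)
    have hz: "cmod (h z) \<le> L' * \<Lambda>"
    proof -
      have "cmod (h z) \<le> cmod (h 0) + cmod (h z - h 0)"
        using norm_triangle_ineq[of "h 0" "h z - h 0"] by simp
      also have "\<dots> \<le> 1 + L * ln (4 / x)"
        using h0 Bloch_radial[OF Bl, of z] z by (simp add: x_def)
      also have "\<dots> \<le> 1 + L * (2 * \<Lambda>)"
        using ln_two_div_ge(2)[OF x] L by (simp add: \<Lambda>_def mult_left_mono)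
      also have "\<dots> \<le> \<Lambda> / ln 2 + L * (2 * \<Lambda>)"
        using \<Lambda> ln_gt_zero[of "2::real"] by simp
      finally show ?thesis by (simp add: L'_def algebra_simps)
    qed
    have int1: "integrable \<mu> (kernel (t + 1) z)" and int0: "integrable \<mu> (kernel t z)"
      using integrable_kernel[OF \<mu> _ z] t by auto
    have km: "kernel s z \<in> borel_measurable \<mu>" for s
      by (rule borel_measurable_disk_continuous[OF \<mu>(2) continuous_on_kernel2[OF z]])
    have hm: "h \<in> borel_measurable \<mu>"
      by (rule borel_measurable_disk_continuous[OF \<mu>(2) holomorphic_on_imp_continuous_on[OF h(1)]])
    have diff_le: "(\<integral>\<^sup>+w. ennreal (cmod ((h w - h z) * kernel (t + 1) z w)) \<partial>\<mu>) \<le> ennreal (C1 / x)"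
      using C1(2)[OF Bl z] by (simp add: x_def norm_mult)
    have int2: "integrable \<mu> (\<lambda>w. (h w - h z) * kernel (t + 1) z w)"
    proof (rule integrableI_bounded)
      show "(\<lambda>w. (h w - h z) * kernel (t + 1) z w) \<in> borel_measurable \<mu>" using hm km[of "t + 1"] by simp
    qed (use diff_le order_le_less_trans in fastforce)
    have g_eq: "g y = (\<integral>w. kernel t y w \<partial>\<mu>)" for y by (simp add: g_def toeplitz_eq)
    have gz: "cmod (g z) \<le> 2 * C2 * x powr - (1 / 2)"
      unfolding g_eq
    proof (rule norm_integral_le)
      have "(\<integral>\<^sup>+w. ennreal (cmod (kernel t z w)) \<partial>\<mu>) \<le> ennreal (2 * (C2 * x powr - (1 / 2)))"
      proof (rule nn_integral_mult_ennreal_le[OF _ _ C2(2)[OF z, folded x_def]])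
        show "(\<lambda>w. ennreal (cmod (kernel (t + 1 / 2) z w))) \<in> borel_measurable \<mu>" using km by measurable
        fix w assume "w \<in> space \<mu>"
        then have w: "cmod w < 1" using space_disk_measure[OF \<mu>(2)] by simp
        have c: "cmod (1 - z * cnj w) > 0" using one_minus_mult_cnj_nonzero[OF z, of w] w by auto
        have "cmod (1 - z * cnj w) powr (1 / 2) \<le> 2 powr (1 / 2)"
          using norm_one_minus_mult_cnj_le[OF z, of w] w by (intro powr_mono2) auto
        also have "\<dots> \<le> 2 powr 1" by (rule powr_mono) auto
        finally have "cmod (1 - z * cnj w) powr (1 / 2) * cmod (1 - z * cnj w) powr - (t + 1 / 2) \<le> 2 * cmod (1 - z * cnj w) powr - (t + 1 / 2)"
          by (intro mult_right_mono) auto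
        then have "cmod (kernel t z w) \<le> 2 * cmod (kernel (t + 1 / 2) z w)"
          by (simp add: norm_kernel powr_add[symmetric])
        then show "ennreal (cmod (kernel t z w)) \<le> ennreal 2 * ennreal (cmod (kernel (t + 1 / 2) z w))"
          by (simp only: ennreal_mult''[symmetric] norm_ge_zero ennreal_leI)
      qed simp
      then show "(\<integral>\<^sup>+w. ennreal (cmod (kernel t z w)) \<partial>\<mu>) \<le> ennreal (2 * C2 * x powr - (1 / 2))"
        by (simp add: mult.assoc)
    qed (use C2 in simp)
    have d: "deriv g z = t * (\<integral>w. cnj w * kernel (t + 1) z w \<partial>\<mu>)"
      using DERIV_imp_deriv[OF toeplitz_one_derivative[OF \<mu> _ z, of "t - 2"]] t by (simp add: g_def)
    have "(\<integral>w. kernel t z w \<partial>\<mu>) = (\<integral>w. kernel (t + 1) z w - z * (cnj w * kernel (t + 1) z w) \<partial>\<mu>)"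
    proof (rule Bochner_Integration.integral_cong)
      fix w assume "w \<in> space \<mu>"
      then have "cmod w \<le> 1" using space_disk_measure[OF \<mu>(2)] by simp
      from kernel_Suc[OF z this, of t] show "kernel t z w = kernel (t + 1) z w - z * (cnj w * kernel (t + 1) z w)"
        by (simp add: algebra_simps)
    qed simp
    also have "\<dots> = (\<integral>w. kernel (t + 1) z w \<partial>\<mu>) - z * (\<integral>w. cnj w * kernel (t + 1) z w \<partial>\<mu>)"
    proof -
      have "integrable \<mu> (\<lambda>w. cnj w * kernel (t + 1) z w)"
        using has_field_derivative_integral_kernel(2)[OF \<mu>, of cnj 1 "t + 1" z] t z
          measurable_compose[OF measurable_id_borel[OF \<mu>(2)] borel_measurable_cnj] by simp
      then show ?thesis using int1 by simp
    qed
    finally have k_eq: "(\<integral>w. kernel (t + 1) z w \<partial>\<mu>) = g z + z * (deriv g z / t)"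
      using t by (simp add: d g_eq)
    have "x * (\<Lambda> * cmod (\<integral>w. kernel (t + 1) z w \<partial>\<mu>)) \<le> 8 * C2 + G / t"
    proof -
      have "cmod (\<integral>w. kernel (t + 1) z w \<partial>\<mu>) \<le> cmod (g z) + cmod (z * (deriv g z / t))"
        unfolding k_eq by (rule norm_triangle_ineq)
      also have "cmod (z * (deriv g z / t)) \<le> 1 * (cmod (deriv g z) / t)"
        unfolding norm_mult norm_divide norm_of_real using z t by (intro mult_mono) auto
      finally have "x * (\<Lambda> * cmod (\<integral>w. kernel (t + 1) z w \<partial>\<mu>)) \<le> x * (\<Lambda> * (2 * C2 * x powr - (1 / 2) + cmod (deriv g z) / t))"
        using gz x \<Lambda> by (intro mult_left_mono) auto
      also have "\<dots> = x * \<Lambda> * (2 * C2 * x powr - (1 / 2)) + (x * \<Lambda> * cmod (deriv g z)) / t"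
        by (simp add: algebra_simps)
      also have "x * \<Lambda> * (2 * C2 * x powr - (1 / 2)) \<le> x * (4 * x powr - (1 / 2)) * (2 * C2 * x powr - (1 / 2))"
        using \<Lambda> x C2 by (intro mult_right_mono mult_left_mono) auto
      also have "\<dots> = 8 * C2 * (x * (x powr - (1 / 2) * x powr - (1 / 2)))" by simp
      also have "x powr - (1 / 2) * x powr - (1 / 2) = 1 / x"
        using x by (simp add: powr_add[symmetric] powr_neg_one)
      also have "(x * \<Lambda> * cmod (deriv g z)) / t \<le> G / t"
        using G(2)[of z] z t by (simp add: x_def \<Lambda>_def divide_right_mono)
      finally show ?thesis using x by simp
    qed
    from mult_left_mono[OF this, of L'] L'
    have main: "x * (L' * \<Lambda> * cmod (\<integral>w. kernel (t + 1) z w \<partial>\<mu>)) \<le> L' * (8 * C2 + G / t)"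
      by (simp add: mult_ac)
    have "(\<integral>w. h w * kernel (t + 1) z w \<partial>\<mu>) = (\<integral>w. (h w - h z) * kernel (t + 1) z w + h z * kernel (t + 1) z w \<partial>\<mu>)"
      by (simp add: algebra_simps)
    also have "\<dots> = (\<integral>w. (h w - h z) * kernel (t + 1) z w \<partial>\<mu>) + h z * (\<integral>w. kernel (t + 1) z w \<partial>\<mu>)"
      using int1 int2 by simp
    finally have "cmod (\<integral>w. h w * kernel (t + 1) z w \<partial>\<mu>) \<le>
        cmod (\<integral>w. (h w - h z) * kernel (t + 1) z w \<partial>\<mu>) + cmod (h z * (\<integral>w. kernel (t + 1) z w \<partial>\<mu>))"
      by (metis norm_triangle_ineq)
    also have "\<dots> \<le> C1 / x + L' * \<Lambda> * cmod (\<integral>w. kernel (t + 1) z w \<partial>\<mu>)"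
      unfolding norm_mult using norm_integral_le[OF diff_le] C1 x hz by (intro add_mono mult_right_mono) auto
    finally have "x * cmod (\<integral>w. h w * kernel (t + 1) z w \<partial>\<mu>) \<le> x * (C1 / x + L' * \<Lambda> * cmod (\<integral>w. kernel (t + 1) z w \<partial>\<mu>))"
      by (rule mult_left_mono) (use x in simp)
    also have "\<dots> \<le> K"
      using main x by (simp add: K_def distrib_left)
    finally have "x * cmod (\<integral>w. h w * kernel (t + 1) z w \<partial>\<mu>) \<le> K" .
    then show "cmod (\<integral>w. h w * kernel ((2 + \<alpha>) / p + 1) z w \<partial>\<mu>) \<le> K / (1 - (cmod z)\<^sup>2)"
      using x unfolding t_def[symmetric] x_def[symmetric] by (simp add: pos_le_divide_eq mult.commute)
  qed
qed

lemma poly_bounded_on_disk: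
  fixes P :: "complex poly"
  obtains B where "B \<ge> 0" "\<And>u. u \<in> \<D> \<Longrightarrow> cmod (poly P u) \<le> B"
proof -
  have "compact (poly P ` cball 0 1)"
    by (intro compact_continuous_image continuous_intros) auto
  then have "bounded (poly P ` cball 0 1)" by (rule compact_imp_bounded)
  then obtain B where B: "\<And>y. y \<in> poly P ` cball 0 1 \<Longrightarrow> cmod y \<le> B"
    unfolding bounded_iff by blast
  show thesis
  proof
    show "cmod (poly P u) \<le> B" if "u \<in> \<D>" for u using B[of "poly P u"] that by auto
    then show "B \<ge> 0" using norm_ge_zero[of "poly P 0"] by (meson centre_in_ball order_trans zero_less_one)
  qed
qed

lemma holomorphic_toeplitz:
  assumes \<mu>: "finite_measure \<mu>" "sets \<mu> = sets (restrict_space borel \<D>)" and "2 + \<gamma> > 0"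
    and f: "f \<in> borel_measurable \<mu>" "\<And>w. w \<in> \<D> \<Longrightarrow> cmod (f w) \<le> B"
  shows "toeplitz \<mu> \<gamma> f holomorphic_on \<D>"
  unfolding toeplitz_eq[abs_def] by (rule holomorphic_integral_kernel[OF \<mu> f assms(3)])

text \<open>Reproducing f with the weight t - 1 brings in the kernel of order t + 1, whose integral
  against h costs 1 / (1 - |z|^2). That is the factor between the weights t - 1 and t - 2, and t /
  (t - 1) is the quotient of their normalisations. The bounds B and B' serve integrability and do
  not enter the constant.\<close>

lemma Bloch_pairing_bound:
  assumes \<mu>: "finite_measure \<mu>" "sets \<mu> = sets (restrict_space borel \<D>)"
    and carl: "carleson_measure \<mu> (1 / p) 1 \<alpha>" and p: "0 < p" "p \<le> 1" and \<alpha>: "\<alpha> > -1"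
    and LB: "toeplitz \<mu> ((2 + \<alpha>) / p - 2) (\<lambda>_. 1) \<in> LB1" and L: "L \<ge> 0"
  obtains K where "K > 0" "\<And>f B h B' A. f holomorphic_on \<D> \<Longrightarrow> (\<And>u. u \<in> \<D> \<Longrightarrow> cmod (f u) \<le> B) \<Longrightarrow>
    Bloch_bounded L h \<Longrightarrow> cmod (h 0) \<le> 1 \<Longrightarrow> (\<And>u. u \<in> \<D> \<Longrightarrow> cmod (h u) \<le> B') \<Longrightarrow>
    A \<ge> 0 \<Longrightarrow> (\<integral>\<^sup>+u. ennreal (cmod (f u)) \<partial>weighted_area ((2 + \<alpha>) / p - 2)) \<le> ennreal A \<Longrightarrow>
    cmod (\<integral>w. f w * cnj (h w) \<partial>\<mu>) \<le> K * A"
proof -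
  define t where "t = (2 + \<alpha>) / p"
  have t: "t > 1"
  proof -
    have "p < 2 + \<alpha>" using p \<alpha> by simp
    then show ?thesis using p by (simp add: t_def)
  qed
  obtain K where K: "K > 0" "\<And>h z. Bloch_bounded L h \<Longrightarrow>
    cmod (h 0) \<le> 1 \<Longrightarrow> cmod z < 1 \<Longrightarrow>
    cmod (\<integral>w. h w * kernel (t + 1) z w \<partial>\<mu>) \<le> K / (1 - (cmod z)\<^sup>2)"
    using Bloch_kernel_integral_bound[OF \<mu> carl p \<alpha> LB L] unfolding t_def by blast
  obtain C where C: "C > 0" "\<And>z. cmod z < 1 \<Longrightarrow>
    (\<integral>\<^sup>+w. ennreal (cmod (kernel (t + 1) z w)) \<partial>\<mu>) \<le> ennreal (C * (1 - (cmod z)\<^sup>2) powr - 1)"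
    using carleson_measure_kernel[OF carl p(1) \<alpha>, of 1] unfolding t_def by auto
  have space: "space \<mu> = \<D>" by (rule space_disk_measure[OF \<mu>(2)])
  show thesis
  proof
    show "K * (t / (t - 1)) > 0" using K t by simp
    fix f B h B' A
    assume f: "f holomorphic_on \<D>" "\<And>u. u \<in> \<D> \<Longrightarrow> cmod (f u) \<le> B"
      and h: "Bloch_bounded L h" "cmod (h 0) \<le> 1" "\<And>u. u \<in> \<D> \<Longrightarrow> cmod (h u) \<le> B'"
      and A: "A \<ge> 0" "(\<integral>\<^sup>+u. ennreal (cmod (f u)) \<partial>weighted_area ((2 + \<alpha>) / p - 2)) \<le> ennreal A"
    let ?W = "weighted_area (t - 1)"
    have B': "B' \<ge> 0" using h(3)[of 0] norm_ge_zero[of "h 0"] by (simp del: norm_ge_zero)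
    interpret W: finite_measure ?W by (rule finite_measure_weighted_area) (use t in simp)
    interpret M: finite_measure \<mu> by fact
    interpret pair_sigma_finite \<mu> ?W ..
    have fm: "f \<in> borel_measurable area_measure"
      by (rule borel_measurable_area_continuous[OF holomorphic_on_imp_continuous_on[OF f(1)]])
    have fW [measurable]: "f \<in> borel_measurable ?W"
      using fm by (simp add: borel_measurable_weighted_iff)
    have hm [measurable]: "h \<in> borel_measurable \<mu>"
      by (rule borel_measurable_disk_continuous[OF \<mu>(2) holomorphic_on_imp_continuous_on[OF Bloch_boundedD(1)[OF h(1)]]])
    have km [measurable]: "(\<lambda>(w, z). kernel (t + 1) w z) \<in> borel_measurable (\<mu> \<Otimes>\<^sub>M ?W)"
      by (rule borel_measurable_kernel_pair[OF \<mu>(2) sets_weighted_area])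
    have fint: "integrable ?W f"
      by (rule integrable_weighted_area_bounded[of _ _ B]) (use t fW f(2) in auto)
    have shift: "(\<integral>\<^sup>+z. ennreal ((1 - (cmod z)\<^sup>2) powr - 1) * ennreal (cmod (f z)) \<partial>?W) \<le> ennreal (t / (t - 1) * A)"
    proof -
      have "(\<integral>\<^sup>+z. ennreal ((1 - (cmod z)\<^sup>2) powr - 1) * ennreal (cmod (f z)) \<partial>?W) =
         ennreal ((1 + (t - 1)) / (1 + (t - 1) + - 1)) * (\<integral>\<^sup>+z. ennreal (cmod (f z)) \<partial>weighted_area (t - 1 + - 1))"
        by (rule nn_integral_weighted_area_powr) (use t fm in auto)
      also have "\<dots> \<le> ennreal (t / (t - 1)) * ennreal A"
        using A(2) by (intro mult_mono) (auto simp: t_def)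
      also have "\<dots> = ennreal (t / (t - 1) * A)"
        using t by (intro ennreal_mult'[symmetric]) auto
      finally show ?thesis .
    qed
    have wm: "(\<lambda>z. ennreal ((1 - (cmod z)\<^sup>2) powr - 1) * ennreal (cmod (f z))) \<in> borel_measurable ?W"
    proof (rule borel_measurable_times_ennreal)
      show "(\<lambda>z. ennreal ((1 - (cmod z)\<^sup>2) powr - 1)) \<in> borel_measurable ?W"
        by (rule borel_measurable_weighted_borel) measurable
    qed measurable
    \<comment> \<open>Absolute convergence: with |h| \<le> B', the Carleson estimate for the kernel
      controls the integral over \<mu>, and \<open>shift\<close> controls the one over the weighted
      measure.\<close>
    have int: "integrable (\<mu> \<Otimes>\<^sub>M ?W) (\<lambda>(w, z). f z * kernel (t + 1) w z * cnj (h w))"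
    proof (rule integrableI_bounded)
      have m: "(\<lambda>(w, z). ennreal (cmod (f z * kernel (t + 1) w z * cnj (h w)))) \<in> borel_measurable (\<mu> \<Otimes>\<^sub>M ?W)"
        by measurable
      have "(\<integral>\<^sup>+x. ennreal (norm (case x of (w, z) \<Rightarrow> f z * kernel (t + 1) w z * cnj (h w))) \<partial>(\<mu> \<Otimes>\<^sub>M ?W)) =
        (\<integral>\<^sup>+z. (\<integral>\<^sup>+w. ennreal (cmod (f z * kernel (t + 1) w z * cnj (h w))) \<partial>\<mu>) \<partial>?W)"
        using nn_integral_snd[OF m] by (simp add: case_prod_unfold)
      also have "\<dots> \<le> ennreal (C * B' * (t / (t - 1) * A))"
      proof (rule nn_integral_mult_ennreal_le[OF wm _ shift])
        fix z assume "z \<in> space ?W"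
        then have z: "cmod z < 1" by simp
        have "(\<integral>\<^sup>+w. ennreal (cmod (f z * kernel (t + 1) w z * cnj (h w))) \<partial>\<mu>) \<le>
           ennreal (cmod (f z) * B' * (C * (1 - (cmod z)\<^sup>2) powr - 1))"
        proof (rule nn_integral_mult_ennreal_le[OF _ _ C(2)[OF z]])
          show "(\<lambda>w. ennreal (cmod (kernel (t + 1) z w))) \<in> borel_measurable \<mu>"
            using borel_measurable_disk_continuous[OF \<mu>(2) continuous_on_kernel2[OF z]] by measurable
          fix w assume w: "w \<in> space \<mu>"
          have "cmod (f z * kernel (t + 1) w z * cnj (h w)) = cmod (f z) * cmod (h w) * cmod (kernel (t + 1) z w)"
            by (simp add: norm_mult norm_kernel_commute[of _ w] mult_ac)
          also have "\<dots> \<le> cmod (f z) * B' * cmod (kernel (t + 1) z w)"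
            using h(3)[of w] w by (intro mult_right_mono mult_left_mono) (auto simp: space)
          finally show "ennreal (cmod (f z * kernel (t + 1) w z * cnj (h w))) \<le> ennreal (cmod (f z) * B') * ennreal (cmod (kernel (t + 1) z w))"
            using B' by (simp add: ennreal_mult[symmetric] ennreal_leI)
        qed (use B' in simp)
        also have "\<dots> = ennreal (C * B') * (ennreal ((1 - (cmod z)\<^sup>2) powr - 1) * ennreal (cmod (f z)))"
          using B' C by (simp add: ennreal_mult[symmetric] mult_ac)
        finally show "(\<integral>\<^sup>+w. ennreal (cmod (f z * kernel (t + 1) w z * cnj (h w))) \<partial>\<mu>) \<le>
          ennreal (C * B') * (ennreal ((1 - (cmod z)\<^sup>2) powr - 1) * ennreal (cmod (f z)))" .
      qed (use B' C in simp)
      also have "\<dots> < \<infinity>" by simp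
      finally show "(\<integral>\<^sup>+x. ennreal (norm (case x of (w, z) \<Rightarrow> f z * kernel (t + 1) w z * cnj (h w))) \<partial>(\<mu> \<Otimes>\<^sub>M ?W)) < \<infinity>" .
    qed measurable
    have "(\<integral>w. f w * cnj (h w) \<partial>\<mu>) = (\<integral>w. (\<integral>z. f z * kernel (t + 1) w z * cnj (h w) \<partial>?W) \<partial>\<mu>)"
    proof (rule Bochner_Integration.integral_cong)
      fix w assume w: "w \<in> space \<mu>"
      have "f w = (\<integral>z. f z * kernel (2 + (t - 1)) w z \<partial>?W)"
        by (rule bergman_reproducing) (use t f fint w in \<open>auto simp: space\<close>)
      also have "2 + (t - 1) = t + 1" by simp
      finally show "f w * cnj (h w) = (\<integral>z. f z * kernel (t + 1) w z * cnj (h w) \<partial>?W)"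
        by simp
    qed simp
    also have "\<dots> = (\<integral>z. (\<integral>w. f z * kernel (t + 1) w z * cnj (h w) \<partial>\<mu>) \<partial>?W)"
      using Fubini_integral[OF int] by simp
    also have "\<dots> = (\<integral>z. f z * cnj (\<integral>w. h w * kernel (t + 1) z w \<partial>\<mu>) \<partial>?W)"
    proof (rule Bochner_Integration.integral_cong)
      fix z assume "z \<in> space ?W"
      then have z: "cmod z < 1" by simp
      have "(\<integral>w. f z * kernel (t + 1) w z * cnj (h w) \<partial>\<mu>) = (\<integral>w. f z * cnj (h w * kernel (t + 1) z w) \<partial>\<mu>)"
        by (rule Bochner_Integration.integral_cong) (use cnj_kernel[OF z] in \<open>auto simp: space\<close>)
      also have "\<dots> = f z * cnj (\<integral>w. h w * kernel (t + 1) z w \<partial>\<mu>)"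
        by (simp only: integral_mult_right_zero Bochner_Integration.integral_cnj)
      finally show "(\<integral>w. f z * kernel (t + 1) w z * cnj (h w) \<partial>\<mu>) = f z * cnj (\<integral>w. h w * kernel (t + 1) z w \<partial>\<mu>)" .
    qed simp
    also have "cmod \<dots> \<le> K * (t / (t - 1) * A)"
    proof (rule norm_integral_le[OF nn_integral_mult_ennreal_le[OF wm _ shift]])
      fix z assume "z \<in> space ?W"
      then have z: "cmod z < 1" by simp
      have x: "1 - (cmod z)\<^sup>2 > 0" by (rule one_minus_norm_bounds(1)[OF z])
      have "cmod (f z * cnj (\<integral>w. h w * kernel (t + 1) z w \<partial>\<mu>)) \<le> cmod (f z) * (K / (1 - (cmod z)\<^sup>2))"
        unfolding norm_mult complex_mod_cnj using K(2)[OF h(1,2) z] by (intro mult_left_mono) auto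
      also have "\<dots> = K * ((1 - (cmod z)\<^sup>2) powr - 1 * cmod (f z))"
        using x by (simp add: powr_neg_one)
      finally show "ennreal (cmod (f z * cnj (\<integral>w. h w * kernel (t + 1) z w \<partial>\<mu>))) \<le>
          ennreal K * (ennreal ((1 - (cmod z)\<^sup>2) powr - 1) * ennreal (cmod (f z)))"
        using K(1) by (simp add: ennreal_mult[symmetric] ennreal_leI)
    qed (use K A t in auto)
    finally show "cmod (\<integral>w. f w * cnj (h w) \<partial>\<mu>) \<le> K * (t / (t - 1)) * A"
      by (simp add: mult.assoc)
  qed
qed

lemma poly_Lp_norm_obtain:
  fixes P :: "complex poly"
  assumes "p > 0" "\<alpha> > -1"
  obtains a where "a \<ge> 0" "Lp_norm p (weighted_area \<alpha>) (poly P) = ennreal a"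
    "(\<integral>\<^sup>+u. ennreal (cmod (poly P u) powr p) \<partial>weighted_area \<alpha>) \<le> ennreal (a powr p)"
proof -
  obtain B where B: "B \<ge> 0" "\<And>u. u \<in> \<D> \<Longrightarrow> cmod (poly P u) \<le> B" using poly_bounded_on_disk by blast
  have "(\<integral>\<^sup>+u. ennreal (cmod (poly P u) powr p) \<partial>weighted_area \<alpha>) \<le> (\<integral>\<^sup>+u. ennreal (B powr p) \<partial>weighted_area \<alpha>)"
    by (intro nn_integral_mono ennreal_leI powr_mono2) (use B assms in auto)
  also have "\<dots> = ennreal (B powr p)" by (simp add: emeasure_weighted_area_disk[OF assms(2)])
  finally have "Lp_norm p (weighted_area \<alpha>) (poly P) \<le> ennreal B"
    using Lp_norm_le_iff[OF assms(1) B(1)] by simp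
  then obtain a where a: "Lp_norm p (weighted_area \<alpha>) (poly P) = ennreal a" "a \<ge> 0"
    by (cases "Lp_norm p (weighted_area \<alpha>) (poly P)") (auto simp: top_unique)
  show thesis
    by (rule that[OF a(2,1)]) (use Lp_norm_le_iff[OF assms(1) a(2), of "weighted_area \<alpha>" "poly P"] a in simp)
qed

lemma borel_measurable_poly_disk:
  assumes "sets M = sets (restrict_space borel \<D>)"
  shows "poly P \<in> borel_measurable M"
  by (rule borel_measurable_disk_continuous[OF assms]) (intro continuous_intros)

text \<open>On the support of \<phi> the kernel is bounded. The bound blows up as r tends to 1, so
  it only provides finiteness for fixed r and must not reach a final constant.\<close>

lemma norm_projection_trunc_le:
  assumes \<beta>: "\<beta> > -1" and \<phi>: "\<And>u. u \<in> \<D> \<Longrightarrow> cmod (\<phi> u) \<le> K" and K: "K \<ge> 0"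
    and r: "0 < r" "r < 1" "\<And>u. r \<le> cmod u \<Longrightarrow> \<phi> u = 0" and w: "cmod w < 1"
  shows "cmod (\<integral>u. \<phi> u * kernel (2 + \<beta>) w u \<partial>weighted_area \<beta>) \<le> K * (1 - r) powr - (2 + \<beta>)"
proof (rule norm_integral_le)
  have "(\<integral>\<^sup>+u. ennreal (cmod (\<phi> u * kernel (2 + \<beta>) w u)) \<partial>weighted_area \<beta>) \<le>
    (\<integral>\<^sup>+u. ennreal (K * (1 - r) powr - (2 + \<beta>)) \<partial>weighted_area \<beta>)"
  proof (intro nn_integral_mono ennreal_leI)
    fix u assume "u \<in> space (weighted_area \<beta>)"
    then have u: "cmod u < 1" by simp
    show "cmod (\<phi> u * kernel (2 + \<beta>) w u) \<le> K * (1 - r) powr - (2 + \<beta>)"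
    proof (cases "r \<le> cmod u")
      case False
      then have "cmod (kernel (2 + \<beta>) w u) \<le> (1 - r) powr - (2 + \<beta>)"
        using r w u \<beta> by (intro order_trans[OF norm_kernel_le'] powr_mono2') auto
      then show ?thesis unfolding norm_mult using \<phi>[of u] u K by (intro mult_mono) auto
    qed (use r(3) K in simp)
  qed
  then show "(\<integral>\<^sup>+u. ennreal (cmod (\<phi> u * kernel (2 + \<beta>) w u)) \<partial>weighted_area \<beta>) \<le> ennreal (K * (1 - r) powr - (2 + \<beta>))"
    by (simp add: emeasure_weighted_area_disk[OF \<beta>])
qed (use K in simp)

text \<open>For F the image of a polynomial, the sign of F cut off to a ball is the dual function
  that turns the pairing into the integral of |F| over that ball. The constant K of the pairing and
  C of the embedding bound it uniformly in the radius, and Fatou's lemma removes the cutoff.\<close>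

lemma toeplitz_bounded_if_carleson_LB1:
  assumes \<mu>: "finite_measure \<mu>" "sets \<mu> = sets (restrict_space borel \<D>)"
    and p: "0 < p" "p \<le> 1" and \<alpha>: "\<alpha> > -1" and \<beta>: "\<beta> > -1"
    and carl: "carleson_measure \<mu> (1 / p) 1 \<alpha>"
    and LB: "toeplitz \<mu> ((2 + \<alpha>) / p - 2) (\<lambda>_. 1) \<in> LB1"
  shows "toeplitz_bounded \<mu> p \<alpha> 1 \<beta>"
proof -
  obtain L where L: "L > 0" "\<And>\<phi> h. \<phi> \<in> borel_measurable (weighted_area \<beta>) \<Longrightarrow> (\<And>u. u \<in> \<D> \<Longrightarrow> cmod (\<phi> u) \<le> 1) \<Longrightarrow>
    h = (\<lambda>w. \<integral>u. \<phi> u * kernel (2 + \<beta>) w u \<partial>weighted_area \<beta>) \<Longrightarrow>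
    Bloch_bounded L h \<and> cmod (h 0) \<le> 1"
    using bergman_projection_Bloch[OF \<beta>] by blast
  obtain K where K: "K > 0" "\<And>f B h B' A. f holomorphic_on \<D> \<Longrightarrow> (\<And>u. u \<in> \<D> \<Longrightarrow> cmod (f u) \<le> B) \<Longrightarrow>
    Bloch_bounded L h \<Longrightarrow> cmod (h 0) \<le> 1 \<Longrightarrow> (\<And>u. u \<in> \<D> \<Longrightarrow> cmod (h u) \<le> B') \<Longrightarrow>
    A \<ge> 0 \<Longrightarrow> (\<integral>\<^sup>+u. ennreal (cmod (f u)) \<partial>weighted_area ((2 + \<alpha>) / p - 2)) \<le> ennreal A \<Longrightarrow>
    cmod (\<integral>w. f w * cnj (h w) \<partial>\<mu>) \<le> K * A"
    using Bloch_pairing_bound[OF \<mu> carl p \<alpha> LB less_imp_le[OF L(1)]] by blast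
  obtain C where C: "C > 0" "\<And>f A B. f holomorphic_on \<D> \<Longrightarrow> (\<And>u. u \<in> \<D> \<Longrightarrow> cmod (f u) \<le> B) \<Longrightarrow> A \<ge> 0 \<Longrightarrow>
     (\<integral>\<^sup>+u. ennreal (cmod (f u) powr p) \<partial>weighted_area \<alpha>) \<le> ennreal A \<Longrightarrow>
     (\<integral>\<^sup>+u. ennreal (cmod (f u)) \<partial>weighted_area ((2 + \<alpha>) / p - 2)) \<le> ennreal (C * A powr (1 / p))"
    using bergman_embedding_L1[OF p \<alpha>] by blast
  show ?thesis
    unfolding toeplitz_bounded_def
  proof (intro exI[of _ "K * C"] conjI allI)
    show "K * C \<ge> 0" using K C by simp
    fix P :: "complex poly"
    let ?W = "weighted_area \<beta>"
    obtain a where a: "a \<ge> 0" "Lp_norm p (weighted_area \<alpha>) (poly P) = ennreal a"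
      "(\<integral>\<^sup>+u. ennreal (cmod (poly P u) powr p) \<partial>weighted_area \<alpha>) \<le> ennreal (a powr p)"
      using poly_Lp_norm_obtain[OF p(1) \<alpha>] by blast
    obtain B where B: "B \<ge> 0" "\<And>u. u \<in> \<D> \<Longrightarrow> cmod (poly P u) \<le> B" using poly_bounded_on_disk by blast
    have P_holo: "poly P holomorphic_on \<D>" by (intro holomorphic_intros)
    have PL1: "(\<integral>\<^sup>+u. ennreal (cmod (poly P u)) \<partial>weighted_area ((2 + \<alpha>) / p - 2)) \<le> ennreal (C * a)"
      using C(2)[OF P_holo B(2) _ a(3)] a(1) p by (simp add: powr_powr)
    have Pm: "poly P \<in> borel_measurable \<mu>" by (rule borel_measurable_poly_disk[OF \<mu>(2)])
    define F where "F = toeplitz \<mu> \<beta> (poly P)"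
    have F_cont: "continuous_on \<D> F"
      unfolding F_def by (intro holomorphic_on_imp_continuous_on holomorphic_toeplitz[OF \<mu> _ Pm B(2)]) (use \<beta> in auto)
    have Fm [measurable]: "F \<in> borel_measurable ?W" by (rule borel_measurable_weighted_continuous[OF F_cont])
    have im [measurable]: "(\<lambda>u. indicator (ball 0 r) u :: complex) \<in> borel_measurable ?W" for r
      by (intro borel_measurable_weighted_borel borel_measurable_indicator) auto
    have "(\<integral>\<^sup>+u. ennreal (cmod (F u)) \<partial>?W) \<le> ennreal (K * (C * a))"
    proof (rule nn_integral_le_of_trunc[OF sets_weighted_area])
      fix n
      define r where "r = rad n"
      have r: "0 < r" "r < 1" using rad(1,2)[of n] by (auto simp: r_def)
      define \<phi> where "\<phi> u = indicator (ball 0 r) u * sgn (F u)" for u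
      define h where "h = (\<lambda>w. \<integral>u. \<phi> u * kernel (2 + \<beta>) w u \<partial>?W)"
      have \<phi>m: "\<phi> \<in> borel_measurable ?W" unfolding \<phi>_def by measurable
      have \<phi>1: "cmod (\<phi> u) \<le> 1" for u by (simp add: \<phi>_def indicator_def norm_sgn)
      have \<phi>0: "\<phi> u = 0" if "r \<le> cmod u" for u using that by (simp add: \<phi>_def)
      have h: "Bloch_bounded L h" "cmod (h 0) \<le> 1"
        using L(2)[OF \<phi>m \<phi>1 h_def] by auto
      have hb: "cmod (h w) \<le> 1 * (1 - r) powr - (2 + \<beta>)" if "w \<in> \<D>" for w
        unfolding h_def by (rule norm_projection_trunc_le[OF \<beta> \<phi>1 _ r \<phi>0]) (use that in auto)
      have pair: "(\<integral>u. F u * cnj (\<phi> u) \<partial>?W) = (\<integral>w. poly P w * cnj (h w) \<partial>\<mu>)"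
        unfolding F_def h_def by (rule toeplitz_pairing[OF \<mu> \<beta> Pm B(2) \<phi>m \<phi>1 r(2) \<phi>0])
      have "F u * cnj (\<phi> u) = complex_of_real (indicator (ball 0 r) u * cmod (F u))" for u
      proof (cases "F u = 0")
        case False
        have "F u * cnj (sgn (F u)) = complex_of_real ((cmod (F u))\<^sup>2) / cmod (F u)"
          unfolding sgn_eq complex_norm_square by simp
        also have "\<dots> = cmod (F u)" using False by (simp add: power2_eq_square)
        finally show ?thesis by (simp add: \<phi>_def indicator_def)
      qed (simp add: \<phi>_def)
      then have "(\<integral>u. F u * cnj (\<phi> u) \<partial>?W) = complex_of_real (\<integral>u. indicator (ball 0 r) u * cmod (F u) \<partial>?W)"
        by (simp only: integral_complex_of_real)
      then have abs_eq: "\<bar>\<integral>u. indicator (ball 0 r) u * cmod (F u) \<partial>?W\<bar> = cmod (\<integral>w. poly P w * cnj (h w) \<partial>\<mu>)"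
        using pair by (metis norm_of_real)
      \<comment> \<open>F is not yet known to be integrable over the disk; on the closed ball of
        radius r it is bounded by continuity.\<close>
      have int: "integrable ?W (\<lambda>u. indicator (ball 0 r) u * F u)"
      proof -
        have "compact (F ` cball 0 r)"
          by (intro compact_continuous_image continuous_on_subset[OF F_cont]) (use r in auto)
        then have "bounded (F ` cball 0 r)" by (rule compact_imp_bounded)
        then obtain b where b: "\<And>u. u \<in> cball 0 r \<Longrightarrow> cmod (F u) \<le> b" unfolding bounded_iff by blast
        have "b \<ge> 0" using b[of 0] norm_ge_zero[of "F 0"] r by (simp del: norm_ge_zero)
        show ?thesis
        proof (rule integrable_weighted_area_bounded[OF \<beta>])
          show "cmod (indicator (ball 0 r) u * F u) \<le> b" for u
            using b[of u] \<open>b \<ge> 0\<close> by (simp add: indicator_def)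
        qed measurable
      qed
      have "(\<integral>\<^sup>+u. indicator (ball 0 (rad n)) u * ennreal (cmod (F u)) \<partial>?W) =
         (\<integral>\<^sup>+u. ennreal (indicator (ball 0 r) u * cmod (F u)) \<partial>?W)"
        by (intro nn_integral_cong) (simp add: r_def indicator_def)
      also have "\<dots> = ennreal (\<integral>u. indicator (ball 0 r) u * cmod (F u) \<partial>?W)"
      proof (rule nn_integral_eq_integral)
        have "cmod (indicator (ball 0 r) u * F u) = indicator (ball 0 r) u * cmod (F u)" for u
          by (simp add: indicator_def)
        then show "integrable ?W (\<lambda>u. indicator (ball 0 r) u * cmod (F u))"
          using integrable_norm[OF int] by simp
      qed simp
      also have "\<dots> \<le> ennreal (K * (C * a))"
        using K(2)[OF P_holo B(2) h hb _ PL1] abs_eq C a by (intro ennreal_leI) auto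
      finally show "(\<integral>\<^sup>+u. indicator (ball 0 (rad n)) u * ennreal (cmod (F u)) \<partial>?W) \<le> ennreal (K * (C * a))" .
    qed measurable
    then show "Lp_norm 1 (weighted_area \<beta>) (toeplitz \<mu> \<beta> (poly P)) \<le> ennreal (K * C) * Lp_norm p (weighted_area \<alpha>) (poly P)"
      using K C a by (simp add: Lp_norm_1 F_def ennreal_mult[symmetric] mult.assoc)
  qed
qed

subsection \<open>Necessity\<close>

text \<open>Extends the dual estimate from polynomials to their bounded pointwise limits. Both \<mu>
  and the weighted measure are finite, so the pairing and the quasi-norm converge by dominated
  convergence. The constant depends on neither r nor S.\<close>

lemma toeplitz_bounded_pairing:
  assumes \<mu>: "finite_measure \<mu>" "sets \<mu> = sets (restrict_space borel \<D>)"
    and p: "0 < p" "p \<le> 1" and \<alpha>: "\<alpha> > -1" and \<beta>: "\<beta> > -1"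
    and T: "toeplitz_bounded \<mu> p \<alpha> 1 \<beta>"
  obtains C where "C > 0" "\<And>P f S A \<phi> K r. (\<And>n u. u \<in> \<D> \<Longrightarrow> cmod (poly (P n) u) \<le> S) \<Longrightarrow>
    (\<And>u. u \<in> \<D> \<Longrightarrow> (\<lambda>n. poly (P n) u) \<longlonglongrightarrow> f u) \<Longrightarrow> A \<ge> 0 \<Longrightarrow>
    (\<integral>\<^sup>+u. ennreal (cmod (f u) powr p) \<partial>weighted_area \<alpha>) \<le> ennreal (A powr p) \<Longrightarrow>
    \<phi> \<in> borel_measurable (weighted_area \<beta>) \<Longrightarrow> (\<And>u. u \<in> \<D> \<Longrightarrow> cmod (\<phi> u) \<le> K) \<Longrightarrow> 0 < r \<Longrightarrow> r < 1 \<Longrightarrow>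
    (\<And>u. r \<le> cmod u \<Longrightarrow> \<phi> u = 0) \<Longrightarrow>
    cmod (\<integral>w. f w * cnj (\<integral>u. \<phi> u * kernel (2 + \<beta>) w u \<partial>weighted_area \<beta>) \<partial>\<mu>) \<le> C * K * A"
proof -
  obtain C0 where C0: "C0 \<ge> 0" "\<And>P. Lp_norm 1 (weighted_area \<beta>) (toeplitz \<mu> \<beta> (poly P))
          \<le> ennreal C0 * Lp_norm p (weighted_area \<alpha>) (poly P)"
    using T unfolding toeplitz_bounded_def by blast
  show thesis
  proof
    \<comment> \<open>C0 may be 0, and a positive constant is wanted.\<close>
    show "C0 + 1 > 0" using C0 by simp
    fix P :: "nat \<Rightarrow> complex poly" and f S A \<phi> K r
    assume P: "\<And>n u. u \<in> \<D> \<Longrightarrow> cmod (poly (P n) u) \<le> S" "\<And>u. u \<in> \<D> \<Longrightarrow> (\<lambda>n. poly (P n) u) \<longlonglongrightarrow> f u"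
      and A: "A \<ge> 0" "(\<integral>\<^sup>+u. ennreal (cmod (f u) powr p) \<partial>weighted_area \<alpha>) \<le> ennreal (A powr p)"
      and \<phi>: "\<phi> \<in> borel_measurable (weighted_area \<beta>)" "\<And>u. u \<in> \<D> \<Longrightarrow> cmod (\<phi> u) \<le> K"
      and r: "0 < r" "r < 1" "\<And>u. r \<le> cmod u \<Longrightarrow> \<phi> u = 0"
    let ?W = "weighted_area \<beta>" and ?V = "weighted_area \<alpha>"
    interpret M: finite_measure \<mu> by fact
    interpret V: finite_measure ?V by (rule finite_measure_weighted_area[OF \<alpha>])
    have space: "space \<mu> = \<D>" by (rule space_disk_measure[OF \<mu>(2)])
    have K: "K \<ge> 0" using \<phi>(2)[of 0] norm_ge_zero[of "\<phi> 0"] by (simp del: norm_ge_zero)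
    have S: "S \<ge> 0" using P(1)[of 0 0] norm_ge_zero[of "poly (P 0) 0"] by (simp del: norm_ge_zero)
    define h where "h w = (\<integral>u. \<phi> u * kernel (2 + \<beta>) w u \<partial>?W)" for w
    define H where "H = K * (1 - r) powr - (2 + \<beta>)"
    have H: "H \<ge> 0" using K by (simp add: H_def)
    have hb: "cmod (h w) \<le> H" if "w \<in> \<D>" for w
      unfolding h_def H_def by (rule norm_projection_trunc_le[OF \<beta> \<phi>(2) K r]) (use that in auto)
    have "h holomorphic_on \<D>"
      unfolding h_def by (rule holomorphic_integral_kernel[OF finite_measure_weighted_area[OF \<beta>] sets_weighted_area \<phi>]) (use \<beta> in auto)
    then have hm [measurable]: "h \<in> borel_measurable \<mu>"
      by (intro borel_measurable_disk_continuous[OF \<mu>(2)] holomorphic_on_imp_continuous_on)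
    have Pm [measurable]: "poly Q \<in> borel_measurable \<mu>" for Q by (rule borel_measurable_poly_disk[OF \<mu>(2)])
    have PV [measurable]: "poly Q \<in> borel_measurable ?V" for Q by (rule borel_measurable_poly_disk[OF sets_weighted_area])
    have fm [measurable]: "f \<in> borel_measurable \<mu>"
      by (rule borel_measurable_LIMSEQ_metric[of "\<lambda>n. poly (P n)"]) (use P(2) in \<open>auto simp: space\<close>)
    have fV [measurable]: "f \<in> borel_measurable ?V"
      by (rule borel_measurable_LIMSEQ_metric[of "\<lambda>n. poly (P n)"]) (use P(2) in auto)
    define I where "I n = (\<integral>u. cmod (poly (P n) u) powr p \<partial>?V)" for n
    have I0: "I n \<ge> 0" for n unfolding I_def by (rule integral_nonneg_AE) simp
    have intI: "integrable ?V (\<lambda>u. cmod (poly (P n) u) powr p)" for n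
      by (rule V.integrable_const_bound[of _ "S powr p"]) (use P(1) p in \<open>auto intro!: powr_mono2\<close>)
    have step: "cmod (\<integral>w. poly (P n) w * cnj (h w) \<partial>\<mu>) \<le> C0 * K * I n powr (1 / p)" for n
    proof -
      define a where "a = I n powr (1 / p)"
      have "(\<integral>\<^sup>+u. ennreal (cmod (poly (P n) u) powr p) \<partial>?V) = ennreal (I n)"
        unfolding I_def by (rule nn_integral_eq_integral[OF intI]) simp
      also have "I n = a powr p" using I0[of n] p by (simp add: a_def powr_powr)
      finally have "Lp_norm p ?V (poly (P n)) \<le> ennreal a"
        using Lp_norm_le_iff[OF p(1), of a] by (simp add: a_def)
      then have "Lp_norm 1 ?W (toeplitz \<mu> \<beta> (poly (P n))) \<le> ennreal C0 * ennreal a"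
        by (rule order_trans[OF C0(2) mult_left_mono]) simp
      then have T1: "(\<integral>\<^sup>+u. ennreal (cmod (toeplitz \<mu> \<beta> (poly (P n)) u)) \<partial>?W) \<le> ennreal (C0 * a)"
        using C0 by (simp add: Lp_norm_1 ennreal_mult a_def)
      have "(\<integral>w. poly (P n) w * cnj (h w) \<partial>\<mu>) = (\<integral>u. toeplitz \<mu> \<beta> (poly (P n)) u * cnj (\<phi> u) \<partial>?W)"
        unfolding h_def by (rule toeplitz_pairing[OF \<mu> \<beta> Pm P(1) \<phi> r(2,3), symmetric])
      also have "cmod \<dots> \<le> K * (C0 * a)"
      proof (rule norm_integral_le[OF nn_integral_mult_ennreal_le[OF _ _ T1 K]])
        show "(\<lambda>u. ennreal (cmod (toeplitz \<mu> \<beta> (poly (P n)) u))) \<in> borel_measurable ?W"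
        proof -
          have "2 + \<beta> > 0" using \<beta> by simp
          from borel_measurable_weighted_continuous[OF holomorphic_on_imp_continuous_on[OF holomorphic_toeplitz[OF \<mu> this Pm P(1)]]]
          show ?thesis by measurable
        qed
        fix u assume "u \<in> space ?W"
        then have "cmod (toeplitz \<mu> \<beta> (poly (P n)) u * cnj (\<phi> u)) \<le> K * cmod (toeplitz \<mu> \<beta> (poly (P n)) u)"
          using \<phi>(2)[of u] mult_left_mono[of "cmod (\<phi> u)" K "cmod (toeplitz \<mu> \<beta> (poly (P n)) u)"] by (simp add: norm_mult mult.commute)
        then show "ennreal (cmod (toeplitz \<mu> \<beta> (poly (P n)) u * cnj (\<phi> u))) \<le> ennreal K * ennreal (cmod (toeplitz \<mu> \<beta> (poly (P n)) u))"
          using K by (simp add: ennreal_mult[symmetric] ennreal_leI)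
      qed (use K C0 in \<open>simp add: a_def\<close>)
      finally show ?thesis by (simp add: a_def mult_ac)
    qed
    have lim1: "(\<lambda>n. \<integral>w. poly (P n) w * cnj (h w) \<partial>\<mu>) \<longlonglongrightarrow> (\<integral>w. f w * cnj (h w) \<partial>\<mu>)"
    proof (rule integral_dominated_convergence[where w = "\<lambda>_. S * H"])
      show "AE w in \<mu>. (\<lambda>n. poly (P n) w * cnj (h w)) \<longlonglongrightarrow> f w * cnj (h w)"
        by (intro AE_I2 tendsto_mult tendsto_const P(2)) (simp add: space)
      show "AE w in \<mu>. norm (poly (P n) w * cnj (h w)) \<le> S * H" for n
        unfolding norm_mult complex_mod_cnj using P(1) hb S by (intro AE_I2 mult_mono) (auto simp: space)
    qed auto
    have limI: "I \<longlonglongrightarrow> (\<integral>u. cmod (f u) powr p \<partial>?V)"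
      unfolding I_def[abs_def]
    proof (rule integral_dominated_convergence[where w = "\<lambda>_. S powr p"])
      show "AE u in ?V. (\<lambda>n. cmod (poly (P n) u) powr p) \<longlonglongrightarrow> cmod (f u) powr p"
        by (intro AE_I2 tendsto_powr' tendsto_norm P(2) tendsto_const) (use p in auto)
      show "AE u in ?V. norm (cmod (poly (P n) u) powr p) \<le> S powr p" for n
        using P(1) p by (intro AE_I2) (auto intro!: powr_mono2)
    qed auto
    have I_le: "(\<integral>u. cmod (f u) powr p \<partial>?V) \<le> A powr p"
    proof -
      have "(\<integral>u. cmod (f u) powr p \<partial>?V) = enn2real (\<integral>\<^sup>+u. ennreal (cmod (f u) powr p) \<partial>?V)"
        by (rule integral_eq_nn_integral) auto
      also have "\<dots> \<le> A powr p" using enn2real_mono[OF A(2)] by simp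
      finally show ?thesis .
    qed
    have If0: "(\<integral>u. cmod (f u) powr p \<partial>?V) \<ge> 0" by (rule integral_nonneg_AE) simp
    have "(\<lambda>n. C0 * K * I n powr (1 / p)) \<longlonglongrightarrow> C0 * K * (\<integral>u. cmod (f u) powr p \<partial>?V) powr (1 / p)"
      by (intro tendsto_mult tendsto_const tendsto_powr' limI) (use p I0 in auto)
    then have "cmod (\<integral>w. f w * cnj (h w) \<partial>\<mu>) \<le> C0 * K * (\<integral>u. cmod (f u) powr p \<partial>?V) powr (1 / p)"
      by (rule LIMSEQ_le[OF tendsto_norm[OF lim1]]) (use step in blast)
    also have "\<dots> \<le> C0 * K * (A powr p) powr (1 / p)"
      using C0 K p I_le If0 by (intro mult_left_mono powr_mono2) auto
    also have "\<dots> = C0 * K * A" using A p by (simp add: powr_powr)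
    also have "\<dots> \<le> (C0 + 1) * K * A" using K A by (simp add: mult_right_mono)
    finally show "cmod (\<integral>w. f w * cnj (\<integral>u. \<phi> u * kernel (2 + \<beta>) w u \<partial>?W) \<partial>\<mu>) \<le> (C0 + 1) * K * A"
      by (simp add: h_def)
  qed
qed

text \<open>For |z| < 1 the coefficients are absolutely summable, and their sum bounds all Taylor
  polynomials on the disk. This makes the kernel a legitimate test function in the dual
  estimate.\<close>

lemma kernel_poly_limit:
  assumes z: "cmod z < 1" and s: "s > 0"
  obtains P :: "nat \<Rightarrow> complex poly" and S :: real
  where "\<And>n u. u \<in> \<D> \<Longrightarrow> cmod (poly (P n) u) \<le> S" "\<And>u. u \<in> \<D> \<Longrightarrow> (\<lambda>n. poly (P n) u) \<longlonglongrightarrow> kernel s u z"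
proof -
  define a where "a k = complex_of_real (pochhammer s k / fact k) * cnj z ^ k" for k
  have a: "summable (\<lambda>k. cmod (a k))"
    unfolding a_def by (rule summable_norm_kernel_power_series[OF z s])
  define P where "P n = (\<Sum>k<n. monom (a k) k)" for n
  have P: "poly (P n) u = (\<Sum>k<n. a k * u ^ k)" for n u
    by (simp add: P_def poly_sum poly_monom)
  show thesis
  proof
    fix u assume u: "u \<in> \<D>"
    have le: "cmod (a k * u ^ k) \<le> cmod (a k)" for k
      using u by (simp add: norm_mult norm_power mult_left_le power_le_one)
    show "cmod (poly (P n) u) \<le> (\<Sum>k. cmod (a k))" for n
    proof -
      have "cmod (poly (P n) u) \<le> (\<Sum>k<n. cmod (a k))"
        unfolding P by (rule order_trans[OF norm_sum sum_mono[OF le]])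
      also have "\<dots> \<le> (\<Sum>k. cmod (a k))" by (rule sum_le_suminf[OF a]) auto
      finally show ?thesis .
    qed
    have "summable (\<lambda>k. a k * u ^ k)"
      by (rule summable_norm_cancel, rule summable_comparison_test'[OF a, of 0]) (use le in simp)
    then show "(\<lambda>n. poly (P n) u) \<longlonglongrightarrow> kernel s u z"
      unfolding P using kernel_power_series[OF z, of u s] u by (simp add: summable_LIMSEQ a_def)
  qed
qed

text \<open>The truncated projection multiplies Taylor coefficients by numbers in [0, 1], so their
  absolute sum bounds it for every r. The bound of \<open>norm_projection_trunc_le\<close> grows
  with r and could not serve as a majorant when r tends to 1.\<close>

lemma norm_kernel_projection_trunc_le:
  assumes z: "cmod z < 1" and s: "s > 0" and \<beta>: "\<beta> > -1"
  obtains S where "\<And>r w. 0 < r \<Longrightarrow> r < 1 \<Longrightarrow> cmod w < 1 \<Longrightarrow>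
    cmod (\<integral>u. indicator (ball 0 r) u * (kernel s u z * kernel (2 + \<beta>) w u) \<partial>weighted_area \<beta>) \<le> S"
proof -
  define a where "a k = complex_of_real (pochhammer s k / fact k) * cnj z ^ k" for k
  have a: "summable (\<lambda>k. cmod (a k))"
    unfolding a_def by (rule summable_norm_kernel_power_series[OF z s])
  show thesis
  proof
    fix r w assume r: "0 < r" "r < (1::real)" and w: "cmod w < 1"
    let ?q = "\<lambda>k. pochhammer (2 + \<beta>) k / fact k * trunc_moment \<beta> r k"
    have ar: "summable (\<lambda>k. cmod (a k) * r ^ k)"
      by (rule summable_comparison_test'[OF a, of 0]) (use r in \<open>auto simp: mult_left_le power_le_one\<close>)
    have "(\<integral>u. indicator (ball 0 r) u * (kernel s u z * kernel (2 + \<beta>) w u) \<partial>weighted_area \<beta>) =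
      (\<integral>u. indicator (ball 0 r) u * ((\<Sum>k. a k * u ^ k) * kernel (2 + \<beta>) w u) \<partial>weighted_area \<beta>)"
      by (rule Bochner_Integration.integral_cong) (use kernel_power_series[OF z] in \<open>auto simp: a_def\<close>)
    also have "\<dots> = (\<Sum>k. a k * w ^ k * complex_of_real (?q k))"
      using integral_kernel_power_series[OF \<beta> r(1) _ w ar] r(2) by (simp add: sums_iff)
    also have "cmod \<dots> \<le> (\<Sum>k. cmod (a k))"
    proof -
      have le: "cmod (a k * w ^ k * complex_of_real (?q k)) \<le> cmod (a k)" for k
      proof -
        have "cmod (w ^ k) * \<bar>?q k\<bar> \<le> 1"
        proof (rule mult_le_one)
          show "\<bar>?q k\<bar> \<le> 1"
            using trunc_moment_ratio_le_1[OF \<beta>, of r k] r by (simp only: abs_of_nonneg)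
        qed (use w in \<open>auto simp: norm_power power_le_one\<close>)
        then show ?thesis
          unfolding norm_mult norm_of_real mult.assoc by (rule mult_left_le) simp
      qed
      have sm: "summable (\<lambda>k. cmod (a k * w ^ k * complex_of_real (?q k)))"
        by (rule summable_comparison_test'[OF a, of 0]) (use le in simp)
      show ?thesis
        by (rule order_trans[OF summable_norm[OF sm] suminf_le[OF le sm a]])
    qed
    finally show "cmod (\<integral>u. indicator (ball 0 r) u * (kernel s u z * kernel (2 + \<beta>) w u) \<partial>weighted_area \<beta>) \<le> (\<Sum>k. cmod (a k))" .
  qed
qed

text \<open>The p-th power of the modulus is that of the kernel of order 2 + \<alpha> + e * p, to
  which Forelli-Rudin applies. The bound is written as a p-th power to match the quasi-norm.\<close>

lemma nn_integral_kernel_powr_le: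
  assumes "\<alpha> > -1" "p > 0" "e > 0"
  obtains C where "C > 0" "\<And>z. cmod z < 1 \<Longrightarrow>
    (\<integral>\<^sup>+u. ennreal (cmod (kernel ((2 + \<alpha>) / p + e) u z) powr p) \<partial>weighted_area \<alpha>) \<le>
    ennreal ((C * (1 - (cmod z)\<^sup>2) powr - e) powr p)"
proof -
  obtain C where C: "C > 0" "\<And>z. cmod z < 1 \<Longrightarrow>
    (\<integral>\<^sup>+u. ennreal (cmod (kernel (2 + \<alpha> + e * p) z u)) \<partial>weighted_area \<alpha>) \<le> ennreal (C * (1 - (cmod z)\<^sup>2) powr - (e * p))"
    using Forelli_Rudin[OF assms(1), of "e * p"] assms by auto
  show thesis
  proof
    show "C powr (1 / p) > 0" using C by simp
    fix z assume z: "cmod z < 1"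
    have "- ((2 + \<alpha>) / p + e) * p = - (2 + \<alpha> + e * p)" using assms by (simp add: field_simps)
    then have "cmod (kernel ((2 + \<alpha>) / p + e) u z) powr p = cmod (kernel (2 + \<alpha> + e * p) z u)" for u
      by (simp only: norm_kernel powr_powr norm_one_minus_mult_cnj_commute[of u])
    moreover have "C * (1 - (cmod z)\<^sup>2) powr - (e * p) = (C powr (1 / p) * (1 - (cmod z)\<^sup>2) powr - e) powr p"
      using C(1) assms(2) by (simp add: powr_mult powr_powr)
    ultimately show "(\<integral>\<^sup>+u. ennreal (cmod (kernel ((2 + \<alpha>) / p + e) u z) powr p) \<partial>weighted_area \<alpha>) \<le>
      ennreal ((C powr (1 / p) * (1 - (cmod z)\<^sup>2) powr - e) powr p)"
      using C(2)[OF z] by simp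
  qed
qed

text \<open>Test the pairing with both functions equal to the kernel, which its own truncated Bergman
  projections approximate.\<close>

lemma toeplitz_bounded_kernel:
  assumes \<mu>: "finite_measure \<mu>" "sets \<mu> = sets (restrict_space borel \<D>)"
    and p: "0 < p" "p \<le> 1" and \<alpha>: "\<alpha> > -1" and \<beta>: "\<beta> > -1"
    and T: "toeplitz_bounded \<mu> p \<alpha> 1 \<beta>" and t: "t = (2 + \<alpha>) / p"
  obtains C where "C > 0" "\<And>z. cmod z < 1 \<Longrightarrow>
    (\<integral>\<^sup>+w. ennreal (cmod (kernel (2 * (t + 1)) z w)) \<partial>\<mu>) \<le> ennreal (C * (1 - (cmod z)\<^sup>2) powr - (t + 2))"
proof -
  have t0: "t > 0" using p \<alpha> by (simp add: t)
  obtain C1 where C1: "C1 > 0" "\<And>P f S A \<phi> K r. (\<And>n u. u \<in> \<D> \<Longrightarrow> cmod (poly (P n) u) \<le> S) \<Longrightarrow>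
    (\<And>u. u \<in> \<D> \<Longrightarrow> (\<lambda>n. poly (P n) u) \<longlonglongrightarrow> f u) \<Longrightarrow> A \<ge> 0 \<Longrightarrow>
    (\<integral>\<^sup>+u. ennreal (cmod (f u) powr p) \<partial>weighted_area \<alpha>) \<le> ennreal (A powr p) \<Longrightarrow>
    \<phi> \<in> borel_measurable (weighted_area \<beta>) \<Longrightarrow> (\<And>u. u \<in> \<D> \<Longrightarrow> cmod (\<phi> u) \<le> K) \<Longrightarrow> 0 < r \<Longrightarrow> r < 1 \<Longrightarrow>
    (\<And>u. r \<le> cmod u \<Longrightarrow> \<phi> u = 0) \<Longrightarrow>
    cmod (\<integral>w. f w * cnj (\<integral>u. \<phi> u * kernel (2 + \<beta>) w u \<partial>weighted_area \<beta>) \<partial>\<mu>) \<le> C1 * K * A"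
    using toeplitz_bounded_pairing[OF \<mu> p \<alpha> \<beta> T] by blast
  obtain C2 where C2: "C2 > 0" "\<And>z. cmod z < 1 \<Longrightarrow>
    (\<integral>\<^sup>+u. ennreal (cmod (kernel (t + 1) u z) powr p) \<partial>weighted_area \<alpha>) \<le>
    ennreal ((C2 * (1 - (cmod z)\<^sup>2) powr - 1) powr p)"
    using nn_integral_kernel_powr_le[OF \<alpha> p(1), of 1] unfolding t by auto
  have space: "space \<mu> = \<D>" by (rule space_disk_measure[OF \<mu>(2)])
  interpret M: finite_measure \<mu> by fact
  show thesis
  proof
    \<comment> \<open>The sup norm of the dual function contributes (1 - |z|^2)^-(t + 1), the
      quasi-norm of f one more power. The total t + 2 is what the Carleson property yields for the
      order 2 (t + 1) = t + (t + 2), so this crude choice of the dual function loses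
      nothing.\<close>
    show "C1 * 2 powr (t + 1) * C2 > 0" using C1 C2 by simp
    fix z assume z: "cmod z < 1"
    define x where "x = 1 - (cmod z)\<^sup>2"
    have x: "x > 0" using one_minus_norm_bounds(1)[OF z] by (simp add: x_def)
    define f where "f u = kernel (t + 1) u z" for u
    define K where "K = (1 - cmod z) powr - (t + 1)"
    have fb: "cmod (f u) \<le> K" if "u \<in> \<D>" for u
      using norm_kernel_le'[of z u "t + 1"] that z t0 by (simp add: f_def K_def)
    have fc: "continuous_on \<D> f"
      unfolding f_def by (rule continuous_on_kernel1) (use z in simp)
    have fh: "f holomorphic_on \<D>"
      unfolding f_def by (rule holomorphic_kernel) (use z in simp)
    have fm: "f \<in> borel_measurable (weighted_area \<beta>)" by (rule borel_measurable_weighted_continuous[OF fc])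
    have fmu [measurable]: "f \<in> borel_measurable \<mu>" by (rule borel_measurable_disk_continuous[OF \<mu>(2) fc])
    have fint: "integrable (weighted_area \<beta>) f" by (rule integrable_weighted_area_bounded[OF \<beta> fm fb])
    obtain P S where PS: "\<And>n u. u \<in> \<D> \<Longrightarrow> cmod (poly (P n) u) \<le> S" "\<And>u. u \<in> \<D> \<Longrightarrow> (\<lambda>n. poly (P n) u) \<longlonglongrightarrow> f u"
      using kernel_poly_limit[OF z, of "t + 1"] t0 unfolding f_def by auto
    define h where "h n w = (\<integral>u. indicator (ball 0 (rad n)) u * (f u * kernel (2 + \<beta>) w u) \<partial>weighted_area \<beta>)" for n w
    have "t + 1 > 0" using t0 by simp
    from norm_kernel_projection_trunc_le[OF z this \<beta>] obtain S' where
      "\<And>r w. 0 < r \<Longrightarrow> r < 1 \<Longrightarrow> cmod w < 1 \<Longrightarrow>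
        cmod (\<integral>u. indicator (ball 0 r) u * (f u * kernel (2 + \<beta>) w u) \<partial>weighted_area \<beta>) \<le> S'"
      unfolding f_def by blast
    then have S': "\<And>n w. w \<in> \<D> \<Longrightarrow> cmod (h n w) \<le> S'"
      using rad(1,2) unfolding h_def by simp
    have h_lim: "(\<lambda>n. h n w) \<longlonglongrightarrow> f w" if w: "w \<in> \<D>" for w
    proof -
      have "integrable (weighted_area \<beta>) (\<lambda>u. f u * kernel (2 + \<beta>) w u)"
        by (rule has_field_derivative_integral_kernel(2)[OF finite_measure_weighted_area[OF \<beta>] sets_weighted_area fm fb])
          (use \<beta> w in auto)
      from integral_indicator_ball_rad_tendsto[OF sets_weighted_area this]
      show ?thesis
        unfolding h_def using bergman_reproducing[OF \<beta> fh fint, of w] w by simp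
    qed
    have h_eq: "h n w = (\<integral>u. (indicator (ball 0 (rad n)) u * f u) * kernel (2 + \<beta>) w u \<partial>weighted_area \<beta>)" for n w
      by (simp add: h_def mult.assoc)
    have im: "(\<lambda>u. indicator (ball 0 r) u * f u) \<in> borel_measurable (weighted_area \<beta>)" for r
      by (intro borel_measurable_times fm borel_measurable_weighted_borel borel_measurable_indicator) auto
    have bnd: "cmod (\<integral>w. f w * cnj (h n w) \<partial>\<mu>) \<le> C1 * K * (C2 * x powr - 1)" for n
      unfolding h_eq
    proof (rule C1(2)[OF PS _ _ im])
      show "(\<integral>\<^sup>+u. ennreal (cmod (f u) powr p) \<partial>weighted_area \<alpha>) \<le> ennreal ((C2 * x powr - 1) powr p)"
        using C2(2)[OF z] by (simp add: f_def x_def)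
      show "cmod (indicator (ball 0 (rad n)) u * f u) \<le> K" if "u \<in> \<D>" for u
        using fb[OF that] by (auto simp: indicator_def K_def)
      show "0 < rad n" "rad n < 1" by (rule rad)+
      show "indicator (ball 0 (rad n)) u * f u = 0" if "rad n \<le> cmod u" for u
        using that by simp
    qed (use C2 in auto)
    have m_h: "h n \<in> borel_measurable \<mu>" for n
    proof -
      have "cmod (indicator (ball 0 (rad n)) u * f u) \<le> K" if "u \<in> \<D>" for u
        using fb[OF that] by (auto simp: indicator_def K_def)
      then have "h n holomorphic_on \<D>"
        unfolding h_eq by (rule holomorphic_integral_kernel[OF finite_measure_weighted_area[OF \<beta>] sets_weighted_area im]) (use \<beta> in auto)
      then show ?thesis by (intro borel_measurable_disk_continuous[OF \<mu>(2)] holomorphic_on_imp_continuous_on)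
    qed
    \<comment> \<open>The reproducing formula gives the pointwise limit of \<open>h n\<close>, and
      \<open>S'\<close> does not depend on n, so \<open>K * S'\<close> is a majorant on the finite
      measure.\<close>
    have "(\<lambda>n. \<integral>w. f w * cnj (h n w) \<partial>\<mu>) \<longlonglongrightarrow> (\<integral>w. f w * cnj (f w) \<partial>\<mu>)"
    proof (rule integral_dominated_convergence[where w = "\<lambda>_. K * S'"])
      show "AE w in \<mu>. (\<lambda>n. f w * cnj (h n w)) \<longlonglongrightarrow> f w * cnj (f w)"
        by (intro AE_I2 tendsto_mult tendsto_const tendsto_cnj h_lim) (simp add: space)
      show "AE w in \<mu>. norm (f w * cnj (h n w)) \<le> K * S'" for n
        unfolding norm_mult complex_mod_cnj using fb S' by (intro AE_I2 mult_mono) (auto simp: space K_def)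
    qed (use m_h in auto)
    then have "cmod (\<integral>w. f w * cnj (f w) \<partial>\<mu>) \<le> C1 * K * (C2 * x powr - 1)"
      by (rule LIMSEQ_le_const2[OF tendsto_norm]) (use bnd in blast)
    also have "(\<integral>w. f w * cnj (f w) \<partial>\<mu>) = complex_of_real (\<integral>w. (cmod (f w))\<^sup>2 \<partial>\<mu>)"
      by (simp only: complex_norm_square[symmetric] integral_complex_of_real)
    finally have le: "(\<integral>w. (cmod (f w))\<^sup>2 \<partial>\<mu>) \<le> C1 * K * (C2 * x powr - 1)"
      by simp
    have K_le: "K \<le> 2 powr (t + 1) * x powr - (t + 1)"
    proof -
      have "K \<le> (x / 2) powr - (t + 1)"
        unfolding K_def x_def using one_minus_norm_bounds[OF z] t0 by (intro powr_mono2') auto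
      also have "(x / 2) powr - s = 2 powr s * x powr - s" for s
        using x by (simp add: powr_divide powr_minus field_simps)
      finally show ?thesis .
    qed
    have "(\<integral>\<^sup>+w. ennreal (cmod (kernel (2 * (t + 1)) z w)) \<partial>\<mu>) = (\<integral>\<^sup>+w. ennreal ((cmod (f w))\<^sup>2) \<partial>\<mu>)"
    proof (rule nn_integral_cong)
      fix w
      have e: "2 * (t + 1) = (t + 1) + (t + 1)" by simp
      have "cmod (kernel (2 * (t + 1)) z w) = (cmod (f w))\<^sup>2"
        by (simp only: e f_def norm_kernel norm_one_minus_mult_cnj_commute[of w] minus_add_distrib powr_add power2_eq_square)
      then show "ennreal (cmod (kernel (2 * (t + 1)) z w)) = ennreal ((cmod (f w))\<^sup>2)" by simp
    qed
    also have "\<dots> = ennreal (\<integral>w. (cmod (f w))\<^sup>2 \<partial>\<mu>)"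
      by (intro nn_integral_eq_integral M.integrable_const_bound[of _ "K\<^sup>2"])
        (use fb in \<open>auto simp: space intro!: power_mono\<close>)
    also have "\<dots> \<le> ennreal (C1 * 2 powr (t + 1) * C2 * x powr - (t + 2))"
    proof (rule ennreal_leI[OF order_trans[OF le]])
      have "C1 * K * (C2 * x powr - 1) \<le> C1 * (2 powr (t + 1) * x powr - (t + 1)) * (C2 * x powr - 1)"
        using K_le C1 C2 by (intro mult_right_mono mult_left_mono) auto
      also have "\<dots> = C1 * 2 powr (t + 1) * C2 * (x powr - (t + 1) * x powr - 1)" by (simp only: mult_ac)
      also have "x powr - (t + 1) * x powr - 1 = x powr - (t + 2)"
      proof -
        have "- (t + 2) = - (t + 1) + - 1" by simp
        then show ?thesis by (simp only: powr_add)
      qed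
      finally show "C1 * K * (C2 * x powr - 1) \<le> C1 * 2 powr (t + 1) * C2 * x powr - (t + 2)" .
    qed
    finally show "(\<integral>\<^sup>+w. ennreal (cmod (kernel (2 * (t + 1)) z w)) \<partial>\<mu>) \<le>
      ennreal (C1 * 2 powr (t + 1) * C2 * (1 - (cmod z)\<^sup>2) powr - (t + 2))" by (simp add: x_def)
  qed
qed

text \<open>If b \<le> e a, the first term alone suffices; otherwise a < b / e and the second does.
  A small e makes the first term absorbable.\<close>

lemma Young_powr:
  fixes a b e s :: real
  assumes "a \<ge> 0" "b \<ge> 0" "e > 0" "s \<ge> 1"
  shows "a powr (s - 1) * b \<le> e * a powr s + e powr (1 - s) * b powr s"
proof (cases "b \<le> e * a")
  case True
  show ?thesis
  proof (cases "a = 0")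
    case False
    then have "a powr s = a powr (s - 1) * a" using assms powr_add[of a "s - 1" 1] by simp
    moreover have "a powr (s - 1) * b \<le> a powr (s - 1) * (e * a)" using True by (rule mult_left_mono) simp
    ultimately have "a powr (s - 1) * b \<le> e * a powr s" by (simp add: mult_ac)
    then show ?thesis by (rule add_increasing2[rotated]) simp
  qed (use True assms in auto)
next
  case False
  then have ab: "a \<le> b / e" using assms by (auto simp: field_simps)
  have b: "b > 0" using False mult_nonneg_nonneg[of e a] assms by linarith
  have "a powr (s - 1) * b \<le> (b / e) powr (s - 1) * b"
    using ab assms by (intro mult_right_mono powr_mono2) auto
  also have "\<dots> = e powr (1 - s) * b powr s"
  proof -
    have "e powr (1 - s) = 1 / e powr (s - 1)" using powr_minus_divide[of e "s - 1"] by simp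
    moreover have "b powr s = b powr (s - 1) * b" using b powr_add[of b "s - 1" 1] by simp
    ultimately show ?thesis using b assms by (simp add: powr_divide)
  qed
  finally show ?thesis using assms by (simp add: add_increasing)
qed

text \<open>With \<open>k\<close> the reproducing kernel of a sufficiently large order, \<open>\<bar>f\<bar>\<close> is dominated by an average
  of \<open>k\<close> against \<open>\<bar>f\<bar>\<close>. Truncation makes the integral \<open>X\<close> of \<open>\<bar>f\<bar> powr s\<close> finite, and Young's
  inequality, with \<open>e\<close> chosen such that half of \<open>X\<close> is absorbed, replaces Minkowski's.\<close>

lemma carleson_measure_if_kernel_bound:
  assumes \<mu>: "finite_measure \<mu>" "sets \<mu> = sets (restrict_space borel \<D>)"
    and p: "0 < p" "p \<le> 1" and \<alpha>: "\<alpha> > -1" and t: "t = (2 + \<alpha>) / p" and C: "C > 0"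
    and bound: "\<And>z. cmod z < 1 \<Longrightarrow>
      (\<integral>\<^sup>+w. ennreal (cmod (kernel (2 * (t + 1)) z w)) \<partial>\<mu>) \<le> ennreal (C * (1 - (cmod z)\<^sup>2) powr - (t + 2))"
  shows "carleson_measure \<mu> (1 / p) 1 \<alpha>"
proof -
  define s where "s = 1 / p"
  have s: "s \<ge> 1" using p by (simp add: s_def)
  \<comment> \<open>Chosen for the identities \<open>exps\<close>: to the power s, the kernel of
    order 2 + \<eta> becomes the kernel in \<open>bound\<close>, and the weight factor of
    \<open>k\<close> exactly cancels the power on its right-hand side. Hence \<open>int_k\<close> is
    uniform in z.\<close>
  define \<eta> where "\<eta> = 2 + 2 * \<alpha> + 2 * p"
  have \<eta>: "\<eta> > -1" "\<eta> - \<alpha> > 0" using \<alpha> p by (auto simp: \<eta>_def)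
  have exps: "(2 + \<eta>) * s = 2 * (t + 1)" "(\<eta> - \<alpha>) * s = t + 2"
    using p by (auto simp: \<eta>_def s_def t field_simps)
  define c where "c = (1 + \<eta>) / (1 + \<alpha>)"
  have c: "c > 0" using \<alpha> \<eta> by (simp add: c_def)
  have space: "space \<mu> = \<D>" by (rule space_disk_measure[OF \<mu>(2)])
  interpret M: finite_measure \<mu> by fact
  interpret V: finite_measure "weighted_area \<alpha>" by (rule finite_measure_weighted_area[OF \<alpha>])
  interpret pair_sigma_finite \<mu> "weighted_area \<alpha>" ..
  \<comment> \<open>The reproducing kernel for the weight \<eta> in modulus, times the density of
    that weight relative to \<alpha> up to the factor c, so that all averages run over
    \<omega>_\<alpha>.\<close>
  define k where "k w z = (1 - (cmod z)\<^sup>2) powr (\<eta> - \<alpha>) * cmod (kernel (2 + \<eta>) w z)" for w z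
  have k0: "k w z \<ge> 0" for w z by (simp add: k_def)
  have int_k: "(\<integral>\<^sup>+w. ennreal (k w z powr s) \<partial>\<mu>) \<le> ennreal C" if z: "cmod z < 1" for z
  proof -
    have x: "1 - (cmod z)\<^sup>2 > 0" by (rule one_minus_norm_bounds(1)[OF z])
    have "(\<integral>\<^sup>+w. ennreal (k w z powr s) \<partial>\<mu>) \<le> ennreal ((1 - (cmod z)\<^sup>2) powr (t + 2) * (C * (1 - (cmod z)\<^sup>2) powr - (t + 2)))"
    proof (rule nn_integral_mult_ennreal_le[OF _ _ bound[OF z]])
      show "(\<lambda>w. ennreal (cmod (kernel (2 * (t + 1)) z w))) \<in> borel_measurable \<mu>"
        using borel_measurable_disk_continuous[OF \<mu>(2) continuous_on_kernel2[OF z]] by measurable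
      fix w
      have "- (2 + \<eta>) * s = - (2 * (t + 1))" by (simp only: mult_minus_left exps(1))
      then have "cmod (kernel (2 + \<eta>) w z) powr s = cmod (kernel (2 * (t + 1)) z w)"
        by (simp only: norm_kernel powr_powr norm_one_minus_mult_cnj_commute[of w])
      then have "k w z powr s = (1 - (cmod z)\<^sup>2) powr (t + 2) * cmod (kernel (2 * (t + 1)) z w)"
        using x by (simp add: k_def powr_mult powr_powr exps)
      then show "ennreal (k w z powr s) \<le> ennreal ((1 - (cmod z)\<^sup>2) powr (t + 2)) * ennreal (cmod (kernel (2 * (t + 1)) z w))"
        by (simp add: ennreal_mult)
    qed simp
    also have "(1 - (cmod z)\<^sup>2) powr r * (C * (1 - (cmod z)\<^sup>2) powr - r) = C" for r
      using x by (simp add: powr_minus_divide)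
    finally show ?thesis .
  qed
  \<comment> \<open>As s = 1 / p, the p-th power of \<open>C * (2 * c * A) powr s\<close> is
    \<open>C' * A\<close>.\<close>
  define C' where "C' = C powr p * (2 * c)"
  have "Lp_norm s \<mu> f \<le> ennreal C' * Lp_norm 1 (weighted_area \<alpha>) f" if f: "f \<in> bergman_space 1 \<alpha>" for f
  proof -
    have fh: "f holomorphic_on \<D>" and fin: "(\<integral>\<^sup>+u. ennreal (cmod (f u)) \<partial>weighted_area \<alpha>) < \<infinity>"
      using f by (auto simp: bergman_space_def Lp_norm_1)
    obtain A where A: "A \<ge> 0" "(\<integral>\<^sup>+u. ennreal (cmod (f u)) \<partial>weighted_area \<alpha>) = ennreal A"
      using fin by (cases "\<integral>\<^sup>+u. ennreal (cmod (f u)) \<partial>weighted_area \<alpha>") auto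
    have fc: "continuous_on \<D> f" by (rule holomorphic_on_imp_continuous_on[OF fh])
    have fa: "f \<in> borel_measurable area_measure" by (rule borel_measurable_area_continuous[OF fc])
    have fV [measurable]: "f \<in> borel_measurable (weighted_area \<alpha>)" by (rule borel_measurable_weighted_continuous[OF fc])
    have fmu [measurable]: "f \<in> borel_measurable \<mu>" by (rule borel_measurable_disk_continuous[OF \<mu>(2) fc])
    have f\<eta>: "f \<in> borel_measurable (weighted_area \<eta>)" by (rule borel_measurable_weighted_continuous[OF fc])
    have shift: "(\<integral>\<^sup>+z. F z \<partial>weighted_area \<eta>) = ennreal c * (\<integral>\<^sup>+z. ennreal ((1 - (cmod z)\<^sup>2) powr (\<eta> - \<alpha>)) * F z \<partial>weighted_area \<alpha>)"
      if "F \<in> borel_measurable area_measure" for F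
    proof -
      have "(\<integral>\<^sup>+z. ennreal ((1 - (cmod z)\<^sup>2) powr (\<eta> - \<alpha>)) * F z \<partial>weighted_area \<alpha>) =
        ennreal ((1 + \<alpha>) / (1 + \<eta>)) * (\<integral>\<^sup>+z. F z \<partial>weighted_area \<eta>)"
        using nn_integral_weighted_area_powr[OF \<alpha>, of "\<eta> - \<alpha>" F] \<eta> that by simp
      then show ?thesis
        using \<alpha> \<eta> by (simp add: c_def mult.assoc[symmetric] ennreal_mult'[symmetric])
    qed
    have int\<eta>: "integrable (weighted_area \<eta>) f"
    proof (rule integrableI_bounded[OF f\<eta>])
      have "(\<integral>\<^sup>+z. ennreal (cmod (f z)) \<partial>weighted_area \<eta>) \<le> ennreal c * (\<integral>\<^sup>+z. ennreal (cmod (f z)) \<partial>weighted_area \<alpha>)"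
      proof (subst shift)
        show "(\<lambda>z. ennreal (cmod (f z))) \<in> borel_measurable area_measure" using fa by measurable
        have "ennreal ((1 - (cmod z)\<^sup>2) powr (\<eta> - \<alpha>)) * ennreal (cmod (f z)) \<le> ennreal (cmod (f z))" if "z \<in> \<D>" for z
        proof -
          have "(1 - (cmod z)\<^sup>2) powr (\<eta> - \<alpha>) \<le> 1 powr (\<eta> - \<alpha>)"
            using one_minus_norm_bounds[of z] that \<eta> by (intro powr_mono2) auto
          then have "(1 - (cmod z)\<^sup>2) powr (\<eta> - \<alpha>) * cmod (f z) \<le> 1 * cmod (f z)"
            by (intro mult_right_mono) auto
          then show ?thesis by (simp add: ennreal_mult[symmetric] ennreal_leI)
        qed
        then show "ennreal c * (\<integral>\<^sup>+z. ennreal ((1 - (cmod z)\<^sup>2) powr (\<eta> - \<alpha>)) * ennreal (cmod (f z)) \<partial>weighted_area \<alpha>) \<le>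
            ennreal c * (\<integral>\<^sup>+z. ennreal (cmod (f z)) \<partial>weighted_area \<alpha>)"
          by (intro mult_left_mono nn_integral_mono) auto
      qed
      also have "\<dots> < \<infinity>" unfolding A(2) by (simp add: ennreal_mult_less_top)
      finally show "(\<integral>\<^sup>+z. ennreal (norm (f z)) \<partial>weighted_area \<eta>) < \<infinity>" .
    qed
    have f_le: "ennreal (cmod (f w)) \<le> ennreal c * (\<integral>\<^sup>+z. ennreal (cmod (f z) * k w z) \<partial>weighted_area \<alpha>)" if w: "w \<in> \<D>" for w
    proof -
      have w1: "cmod w < 1" using w by simp
      have km: "kernel (2 + \<eta>) w \<in> borel_measurable area_measure"
        by (rule borel_measurable_area_continuous[OF continuous_on_kernel2[OF w1]])
      have "ennreal (cmod (f w)) \<le> (\<integral>\<^sup>+z. ennreal (cmod (f z * kernel (2 + \<eta>) w z)) \<partial>weighted_area \<eta>)"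
      proof (cases "(\<integral>\<^sup>+z. ennreal (cmod (f z * kernel (2 + \<eta>) w z)) \<partial>weighted_area \<eta>)")
        case (real I)
        then show ?thesis
          using norm_integral_le[of "weighted_area \<eta>" "\<lambda>z. f z * kernel (2 + \<eta>) w z" I] bergman_reproducing[OF \<eta>(1) fh int\<eta> w1]
          by (simp add: ennreal_leI)
      qed simp
      also have "\<dots> = ennreal c * (\<integral>\<^sup>+z. ennreal ((1 - (cmod z)\<^sup>2) powr (\<eta> - \<alpha>)) * ennreal (cmod (f z * kernel (2 + \<eta>) w z)) \<partial>weighted_area \<alpha>)"
        by (rule shift) (use fa km in measurable)
      also have "\<dots> = ennreal c * (\<integral>\<^sup>+z. ennreal (cmod (f z) * k w z) \<partial>weighted_area \<alpha>)"
        by (simp add: k_def norm_mult ennreal_mult[symmetric] mult_ac)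
      finally show ?thesis .
    qed
    have main: "(\<integral>\<^sup>+w. ennreal (cmod (f w) powr s) \<partial>\<mu>) \<le> ennreal (C * (2 * c * A) powr s)"
    proof (cases "A = 0")
      \<comment> \<open>The Young parameter 1 / (2 c A) requires A > 0. For A = 0 the averages
        dominating |f| vanish, and f with them.\<close>
      case True
      have ae: "AE u in weighted_area \<alpha>. ennreal (cmod (f u)) = 0"
        by (subst nn_integral_0_iff_AE[symmetric]) (use A True in auto)
      have "f w = 0" if w: "w \<in> \<D>" for w
      proof -
        have "(\<integral>\<^sup>+z. ennreal (cmod (f z) * k w z) \<partial>weighted_area \<alpha>) = (\<integral>\<^sup>+z. 0 \<partial>weighted_area \<alpha>)"
          using ae by (intro nn_integral_cong_AE) (auto elim!: eventually_mono)
        then show ?thesis using f_le[OF w] by simp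
      qed
      then have "(\<integral>\<^sup>+w. ennreal (cmod (f w) powr s) \<partial>\<mu>) = (\<integral>\<^sup>+w. 0 \<partial>\<mu>)"
        by (intro nn_integral_cong) (simp add: space)
      then show ?thesis by simp
    next
      case False
      then have A0: "A > 0" using A(1) by simp
      define e where "e = 1 / (2 * c * A)"
      have e: "e > 0" using c A0 by (simp add: e_def)
      show ?thesis
      proof (rule nn_integral_le_of_trunc[OF \<mu>(2)])
        fix n
        let ?i = "\<lambda>w. indicator (ball 0 (rad n)) w :: real"
        have im [measurable]: "?i \<in> borel_measurable \<mu>"
          using \<mu>(2) by (simp add: measurable_restrict_space1 cong: measurable_cong_sets)
        obtain b where b: "b \<ge> 0" "\<And>w. w \<in> cball 0 (rad n) \<Longrightarrow> cmod (f w) \<le> b"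
        proof -
          have "compact (f ` cball 0 (rad n))"
            by (intro compact_continuous_image continuous_on_subset[OF fc]) (use rad(2)[of n] in auto)
          then have "bounded (f ` cball 0 (rad n))" by (rule compact_imp_bounded)
          then obtain b where "\<And>w. w \<in> cball 0 (rad n) \<Longrightarrow> cmod (f w) \<le> b" unfolding bounded_iff by blast
          then have "\<And>w. w \<in> cball 0 (rad n) \<Longrightarrow> cmod (f w) \<le> max 0 b" by (meson max.coboundedI2)
          then show thesis using that[of "max 0 b"] by simp
        qed
        define X where "X = (\<integral>w. ?i w * cmod (f w) powr s \<partial>\<mu>)"
        have X0: "X \<ge> 0" unfolding X_def by (rule integral_nonneg_AE) simp
        have X: "(\<integral>\<^sup>+w. ennreal (?i w * cmod (f w) powr s) \<partial>\<mu>) = ennreal X"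
          unfolding X_def
        proof (rule nn_integral_eq_integral[OF M.integrable_const_bound[of _ "b powr s"]])
          show "AE w in \<mu>. norm (?i w * cmod (f w) powr s) \<le> b powr s"
            using b s by (intro AE_I2) (auto simp: indicator_def intro!: powr_mono2)
        qed auto
        have pm [measurable]: "(\<lambda>(w, z). k w z) \<in> borel_measurable (\<mu> \<Otimes>\<^sub>M weighted_area \<alpha>)"
        proof -
          have [measurable]: "(\<lambda>(w, z). kernel (2 + \<eta>) w z) \<in> borel_measurable (\<mu> \<Otimes>\<^sub>M weighted_area \<alpha>)"
            by (rule borel_measurable_kernel_pair[OF \<mu>(2) sets_weighted_area])
          have [measurable]: "(\<lambda>z. (1 - (cmod z)\<^sup>2) powr (\<eta> - \<alpha>)) \<in> borel_measurable (weighted_area \<alpha>)"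
            by (rule borel_measurable_weighted_borel) measurable
          show ?thesis unfolding k_def by measurable
        qed
        \<comment> \<open>In |f w|^s one factor |f w| is replaced by its average over z; the
          remaining power |f w|^(s - 1) and k w z are then separated by Young's inequality for each
          fixed z.\<close>
        define Q where "Q w z = ?i w * cmod (f w) powr (s - 1) * (cmod (f z) * k w z)" for w z
        have Q0: "Q w z \<ge> 0" for w z by (simp add: Q_def k0)
        have Qm [measurable]: "(\<lambda>(w, z). ennreal (Q w z)) \<in> borel_measurable (\<mu> \<Otimes>\<^sub>M weighted_area \<alpha>)"
          unfolding Q_def by measurable
        have "ennreal X \<le> (\<integral>\<^sup>+w. ennreal c * (\<integral>\<^sup>+z. ennreal (Q w z) \<partial>weighted_area \<alpha>) \<partial>\<mu>)"
          unfolding X[symmetric]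
        proof (rule nn_integral_mono)
          fix w assume "w \<in> space \<mu>"
          then have w: "w \<in> \<D>" by (simp add: space)
          have km: "(\<lambda>z. ennreal (cmod (f z) * k w z)) \<in> borel_measurable (weighted_area \<alpha>)"
            using measurable_compose[OF measurable_Pair1'[of w \<mu> "weighted_area \<alpha>"] pm] w
            by (simp add: space)
          have "cmod (f w) powr s = cmod (f w) powr (s - 1) * cmod (f w)"
            using powr_add[of "cmod (f w)" "s - 1" 1] s by (cases "f w = 0") auto
          then have "ennreal (?i w * cmod (f w) powr s) = ennreal (?i w * cmod (f w) powr (s - 1)) * ennreal (cmod (f w))"
            by (simp add: ennreal_mult[symmetric] mult.assoc)
          also have "\<dots> \<le> ennreal (?i w * cmod (f w) powr (s - 1)) * (ennreal c * (\<integral>\<^sup>+z. ennreal (cmod (f z) * k w z) \<partial>weighted_area \<alpha>))"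
            by (rule mult_left_mono[OF f_le[OF w]]) simp
          also have "\<dots> = ennreal c * (ennreal (?i w * cmod (f w) powr (s - 1)) * (\<integral>\<^sup>+z. ennreal (cmod (f z) * k w z) \<partial>weighted_area \<alpha>))"
            by (simp only: mult_ac)
          also have "ennreal (?i w * cmod (f w) powr (s - 1)) * (\<integral>\<^sup>+z. ennreal (cmod (f z) * k w z) \<partial>weighted_area \<alpha>) =
             (\<integral>\<^sup>+z. ennreal (Q w z) \<partial>weighted_area \<alpha>)"
            using k0 by (subst nn_integral_cmult[OF km, symmetric]) (simp add: Q_def ennreal_mult[symmetric])
          finally show "ennreal (?i w * cmod (f w) powr s) \<le> ennreal c * (\<integral>\<^sup>+z. ennreal (Q w z) \<partial>weighted_area \<alpha>)" .
        qed
        also have "\<dots> = ennreal c * (\<integral>\<^sup>+w. (\<integral>\<^sup>+z. ennreal (Q w z) \<partial>weighted_area \<alpha>) \<partial>\<mu>)"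
          by (rule nn_integral_cmult) measurable
        also have "(\<integral>\<^sup>+w. (\<integral>\<^sup>+z. ennreal (Q w z) \<partial>weighted_area \<alpha>) \<partial>\<mu>) = (\<integral>\<^sup>+z. (\<integral>\<^sup>+w. ennreal (Q w z) \<partial>\<mu>) \<partial>weighted_area \<alpha>)"
          by (rule Fubini'[OF Qm, symmetric])
        also have "\<dots> \<le> ennreal ((e * X + e powr (1 - s) * C) * A)"
        proof (rule nn_integral_mult_ennreal_le)
          show "(\<integral>\<^sup>+z. ennreal (cmod (f z)) \<partial>weighted_area \<alpha>) \<le> ennreal A" by (simp add: A)
          show "e * X + e powr (1 - s) * C \<ge> 0" using e X0 C by simp
          fix z assume "z \<in> space (weighted_area \<alpha>)"
          then have z: "cmod z < 1" by simp
          have km [measurable]: "(\<lambda>w. k w z) \<in> borel_measurable \<mu>"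
            using measurable_compose[OF measurable_Pair2'[of z "weighted_area \<alpha>" \<mu>] pm] z by simp
          have "(\<integral>\<^sup>+w. ennreal (Q w z) \<partial>\<mu>) \<le>
            (\<integral>\<^sup>+w. ennreal (cmod (f z)) * (ennreal e * ennreal (?i w * cmod (f w) powr s) + ennreal (e powr (1 - s)) * ennreal (k w z powr s)) \<partial>\<mu>)"
          proof (rule nn_integral_mono)
            fix w
            have "?i w * (cmod (f w) powr (s - 1) * k w z) \<le> ?i w * (e * cmod (f w) powr s + e powr (1 - s) * k w z powr s)"
              by (rule mult_left_mono[OF Young_powr[OF _ k0 e s]]) auto
            also have "\<dots> \<le> e * (?i w * cmod (f w) powr s) + e powr (1 - s) * k w z powr s"
              by (simp add: indicator_def)
            finally have "cmod (f z) * (?i w * (cmod (f w) powr (s - 1) * k w z)) \<le>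
               cmod (f z) * (e * (?i w * cmod (f w) powr s) + e powr (1 - s) * k w z powr s)"
              by (rule mult_left_mono) simp
            then show "ennreal (Q w z) \<le> ennreal (cmod (f z)) * (ennreal e * ennreal (?i w * cmod (f w) powr s) + ennreal (e powr (1 - s)) * ennreal (k w z powr s))"
              using e by (simp add: Q_def ennreal_mult[symmetric] ennreal_plus[symmetric] ennreal_leI mult_ac del: ennreal_plus)
          qed
          also have "\<dots> = ennreal (cmod (f z)) * (ennreal e * (\<integral>\<^sup>+w. ennreal (?i w * cmod (f w) powr s) \<partial>\<mu>) +
              ennreal (e powr (1 - s)) * (\<integral>\<^sup>+w. ennreal (k w z powr s) \<partial>\<mu>))"
            by (simp add: nn_integral_cmult nn_integral_add)
          also have "\<dots> \<le> ennreal (cmod (f z)) * (ennreal e * ennreal X + ennreal (e powr (1 - s)) * ennreal C)"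
            unfolding X using int_k[OF z] by (intro mult_left_mono add_left_mono) auto
          also have "\<dots> = ennreal (e * X + e powr (1 - s) * C) * ennreal (cmod (f z))"
            using e X0 C by (simp add: ennreal_mult[symmetric] ennreal_plus[symmetric] mult_ac del: ennreal_plus)
          finally show "(\<integral>\<^sup>+w. ennreal (Q w z) \<partial>\<mu>) \<le> ennreal (e * X + e powr (1 - s) * C) * ennreal (cmod (f z))" .
        qed measurable
        finally have "ennreal X \<le> ennreal c * ennreal ((e * X + e powr (1 - s) * C) * A)"
          by (simp add: mult_left_mono)
        also have "\<dots> = ennreal (c * ((e * X + e powr (1 - s) * C) * A))"
          using c by (simp add: ennreal_mult')
        finally have "X \<le> c * ((e * X + e powr (1 - s) * C) * A)"
          using c e X0 C A by (simp add: ennreal_le_iff)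
        also have "\<dots> = (c * e * A) * X + c * A * (e powr (1 - s) * C)" by (simp add: algebra_simps)
        also have "c * e * A = 1 / 2" using c A0 by (simp add: e_def)
        finally have "X \<le> 2 * c * A * (e powr (1 - s) * C)" by simp
        also have "e powr (1 - s) = (2 * c * A) powr (s - 1)"
          using c A0 by (simp add: e_def powr_divide powr_minus_divide[symmetric] del: powr_mult)
        also have "2 * c * A * ((2 * c * A) powr (s - 1) * C) = C * (2 * c * A) powr s"
          using powr_add[of "2 * c * A" "s - 1" 1] c A0 by simp
        finally have "ennreal X \<le> ennreal (C * (2 * c * A) powr s)" by (rule ennreal_leI)
        moreover have "(\<integral>\<^sup>+w. indicator (ball 0 (rad n)) w * ennreal (cmod (f w) powr s) \<partial>\<mu>) = (\<integral>\<^sup>+w. ennreal (?i w * cmod (f w) powr s) \<partial>\<mu>)"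
          by (intro nn_integral_cong) (simp add: indicator_def)
        ultimately show "(\<integral>\<^sup>+w. indicator (ball 0 (rad n)) w * ennreal (cmod (f w) powr s) \<partial>\<mu>) \<le> ennreal (C * (2 * c * A) powr s)"
          using X by simp
      qed measurable
    qed
    also have "C * (2 * c * A) powr s = (C' * A) powr s"
      using C c A p by (simp add: C'_def powr_mult powr_powr s_def)
    finally have "Lp_norm s \<mu> f \<le> ennreal (C' * A)"
      using Lp_norm_le_iff[of s "C' * A" \<mu> f] s A c by (simp add: C'_def)
    then show ?thesis
      using A c by (simp add: Lp_norm_1 ennreal_mult C'_def)
  qed
  moreover have "C' > 0" using C c by (simp add: C'_def)
  ultimately show ?thesis
    unfolding carleson_measure_def s_def by blast
qed

section \<open>Necessity of the logarithmic condition\<close>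

lemma integral_weighted_area:
  fixes f :: "complex \<Rightarrow> complex"
  assumes "\<alpha> > -1" "f \<in> borel_measurable area_measure"
  shows "(\<integral>u. f u \<partial>weighted_area \<alpha>) = (\<integral>u. complex_of_real (weight \<alpha> u) * f u \<partial>area_measure)"
proof -
  have "(\<integral>u. f u \<partial>weighted_area \<alpha>) = (\<integral>u. weight \<alpha> u *\<^sub>R f u \<partial>area_measure)"
    unfolding weighted_area_def by (rule integral_density) (use assms weight_nonneg in auto)
  then show ?thesis by (simp add: scaleR_conv_of_real)
qed

lemma integral_weighted_area_Suc:
  fixes f :: "complex \<Rightarrow> complex"
  assumes "\<beta> > -1" "f \<in> borel_measurable area_measure"
  shows "(\<integral>u. complex_of_real (1 - (cmod u)\<^sup>2) * f u \<partial>weighted_area \<beta>) =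
    complex_of_real ((1 + \<beta>) / (2 + \<beta>)) * (\<integral>u. f u \<partial>weighted_area (\<beta> + 1))"
proof -
  have m: "(\<lambda>u. complex_of_real (1 - (cmod u)\<^sup>2) * f u) \<in> borel_measurable area_measure"
    by (intro borel_measurable_times assms borel_measurable_area_continuous continuous_intros)
  have "(\<integral>u. complex_of_real (1 - (cmod u)\<^sup>2) * f u \<partial>weighted_area \<beta>) =
      (\<integral>u. complex_of_real ((1 + \<beta>) / (2 + \<beta>)) * (complex_of_real (weight (\<beta> + 1) u) * f u) \<partial>area_measure)"
    unfolding integral_weighted_area[OF assms(1) m]
  proof (rule Bochner_Integration.integral_cong)
    fix u assume "u \<in> space area_measure"
    then have "1 - (cmod u)\<^sup>2 > 0" using one_minus_norm_bounds(1)[of u] by simp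
    then have "weight \<beta> u * (1 - (cmod u)\<^sup>2) = (1 + \<beta>) / (2 + \<beta>) * weight (\<beta> + 1) u"
      using assms(1) by (simp add: weight_def powr_add)
    then show "complex_of_real (weight \<beta> u) * (complex_of_real (1 - (cmod u)\<^sup>2) * f u) =
       complex_of_real ((1 + \<beta>) / (2 + \<beta>)) * (complex_of_real (weight (\<beta> + 1) u) * f u)"
      unfolding mult.assoc[symmetric] of_real_mult[symmetric] by simp
  qed simp
  also have "\<dots> = complex_of_real ((1 + \<beta>) / (2 + \<beta>)) * (\<integral>u. complex_of_real (weight (\<beta> + 1) u) * f u \<partial>area_measure)"
    by simp
  also have "(\<integral>u. complex_of_real (weight (\<beta> + 1) u) * f u \<partial>area_measure) = (\<integral>u. f u \<partial>weighted_area (\<beta> + 1))"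
    by (rule integral_weighted_area[symmetric]) (use assms in auto)
  finally show ?thesis .
qed

text \<open>Mercator's series at 1 - y, in which the alternating signs cancel.\<close>

lemma sums_ln_one_minus:
  assumes "0 \<le> y" "y < (1 :: real)"
  shows "(\<lambda>k. y ^ Suc k / real (Suc k)) sums ln (1 / (1 - y))"
proof -
  have S: "summable (\<lambda>k. y ^ Suc k / real (Suc k))"
  proof (rule summable_comparison_test')
    show "summable (\<lambda>k. y ^ k)" using assms by (simp add: summable_geometric)
    fix k :: nat
    have "y ^ Suc k / real (Suc k) \<le> y ^ Suc k / 1"
      using assms by (intro divide_left_mono) auto
    also have "\<dots> \<le> y ^ k" using assms by (simp add: mult_left_le_one_le)
    finally show "norm (y ^ Suc k / real (Suc k)) \<le> y ^ k" using assms by simp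
  qed
  have "(\<Sum>k. y ^ Suc k / real (Suc k)) = ln (1 / (1 - y))"
  proof -
    have "ln (1 - y) = (\<Sum>k. (- 1) ^ k * (1 / real (k + 1)) * ((1 - y) - 1) ^ Suc k)"
      using assms by (intro ln_series) auto
    also have "(\<lambda>k. (- 1) ^ k * (1 / real (k + 1)) * ((1 - y) - 1) ^ Suc k) = (\<lambda>k. - (y ^ Suc k / real (Suc k)))"
    proof
      fix k
      have "(- 1) ^ k * (1 / real (k + 1)) * ((1 - y) - 1) ^ Suc k = ((- 1) ^ k * (- y) ^ k) * (- y / real (Suc k))"
        by simp
      also have "(- 1) ^ k * (- y) ^ k = y ^ k"
        by (simp flip: power_mult_distrib)
      finally show "(- 1) ^ k * (1 / real (k + 1)) * ((1 - y) - 1) ^ Suc k = - (y ^ Suc k / real (Suc k))"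
        by simp
    qed
    also have "(\<Sum>k. - (y ^ Suc k / real (Suc k))) = - (\<Sum>k. y ^ Suc k / real (Suc k))"
      by (rule suminf_minus[OF S])
    finally show ?thesis using assms by (simp add: ln_div)
  qed
  then show ?thesis using S by (simp add: sums_iff)
qed

text \<open>The function \<open>(1 - \<bar>u\<bar>\<^sup>2) / (1 - u * cnj z)\<close> is bounded, but its Bergman projection grows
  logarithmically at \<open>z\<close>.\<close>

lemma projection_log_lower_bound:
  assumes \<beta>: "\<beta> > -1" and z: "cmod z < 1"
  shows "(1 + \<beta>) / (2 + \<beta>) * ln (1 / (1 - (cmod z)\<^sup>2)) \<le>
    cmod (\<integral>u. complex_of_real (1 - (cmod u)\<^sup>2) * kernel 1 u z * kernel (2 + \<beta>) z u \<partial>weighted_area \<beta>)"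
proof -
  define y where "y = (cmod z)\<^sup>2"
  have y: "0 \<le> y" "y < 1" using one_minus_norm_bounds(1)[OF z] by (auto simp: y_def)
  have k1: "(\<lambda>u. kernel 1 u z) \<in> borel_measurable area_measure"
    by (rule borel_measurable_area_continuous[OF continuous_on_kernel1]) (use z in simp)
  have k2: "kernel (2 + \<beta>) z \<in> borel_measurable area_measure"
    by (rule borel_measurable_area_continuous[OF continuous_on_kernel2[OF z]])
  have kk: "(\<lambda>u. kernel 1 u z * kernel (2 + \<beta>) z u) \<in> borel_measurable area_measure"
    using k1 k2 by simp
  \<comment> \<open>Parseval is used with the weight \<beta> + 1: the factor 1 - |u|^2 moves into
    the weight at the price of (1 + \<beta>) / (2 + \<beta>).\<close>
  define a where "a k = complex_of_real (pochhammer 1 k / fact k) * cnj z ^ k" for k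
  define b where "b k = complex_of_real (pochhammer (2 + \<beta>) k / fact k) * cnj z ^ k" for k
  have "(\<lambda>k. a k * cnj (b k) * trunc_moment (\<beta> + 1) 1 k) sums
    (\<integral>u. indicator (ball 0 1) u * ((\<Sum>k. a k * u ^ k) * cnj (\<Sum>k. b k * u ^ k)) \<partial>weighted_area (\<beta> + 1))"
    by (rule integral_weighted_area_power_series)
      (use summable_norm_kernel_power_series[OF z, of 1] summable_norm_kernel_power_series[OF z, of "2 + \<beta>"] \<beta> in \<open>auto simp: a_def b_def\<close>)
  also have "(\<integral>u. indicator (ball 0 1) u * ((\<Sum>k. a k * u ^ k) * cnj (\<Sum>k. b k * u ^ k)) \<partial>weighted_area (\<beta> + 1)) =
      (\<integral>u. kernel 1 u z * kernel (2 + \<beta>) z u \<partial>weighted_area (\<beta> + 1))"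
  proof (rule Bochner_Integration.integral_cong)
    fix u assume "u \<in> space (weighted_area (\<beta> + 1))"
    then have u: "cmod u < 1" by simp
    have "(\<Sum>k. a k * u ^ k) = kernel 1 u z" "(\<Sum>k. b k * u ^ k) = kernel (2 + \<beta>) u z"
      unfolding a_def b_def using kernel_power_series[OF z, of u] u by simp_all
    then show "indicator (ball 0 1) u * ((\<Sum>k. a k * u ^ k) * cnj (\<Sum>k. b k * u ^ k)) = kernel 1 u z * kernel (2 + \<beta>) z u"
      using u z cnj_kernel[of u z "2 + \<beta>"] by simp
  qed simp
  also have "(\<lambda>k. a k * cnj (b k) * trunc_moment (\<beta> + 1) 1 k) = (\<lambda>k. complex_of_real ((2 + \<beta>) / (2 + \<beta> + real k) * y ^ k))"
  proof
    fix k
    have "a k * cnj (b k) * trunc_moment (\<beta> + 1) 1 k =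
      complex_of_real (pochhammer (2 + \<beta>) k / fact k * trunc_moment (\<beta> + 1) 1 k) * (z * cnj z) ^ k"
      by (simp add: a_def b_def pochhammer_fact[symmetric] power_mult_distrib)
    also have "(z * cnj z) ^ k = complex_of_real (y ^ k)"
      by (simp only: complex_norm_square[symmetric] y_def of_real_power)
    \<comment> \<open>The Pochhammer symbols of 2 + \<beta> and 3 + \<beta> share all but their
      first and last factors.\<close>
    also have "pochhammer (2 + \<beta>) k / fact k * trunc_moment (\<beta> + 1) 1 k = (2 + \<beta>) / (2 + \<beta> + real k)"
    proof -
      have "\<beta> + 1 > -1" using \<beta> by simp
      have "pochhammer (2 + \<beta>) (Suc k) = (2 + \<beta>) * pochhammer (2 + \<beta> + 1) k" by (rule pochhammer_rec)
      then have "pochhammer (2 + \<beta>) k * (2 + \<beta> + real k) = (2 + \<beta>) * pochhammer (\<beta> + 1 + 2) k"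
        by (simp add: pochhammer_Suc add_ac)
      moreover have "pochhammer (\<beta> + 1 + 2) k > 0" using \<beta> by (intro pochhammer_pos) auto
      moreover have "2 + \<beta> + real k > 0" using \<beta> by simp
      ultimately show ?thesis
        unfolding trunc_moment_1[OF \<open>\<beta> + 1 > -1\<close>] by (simp add: frac_eq_eq)
    qed
    finally show "a k * cnj (b k) * trunc_moment (\<beta> + 1) 1 k = complex_of_real ((2 + \<beta>) / (2 + \<beta> + real k) * y ^ k)"
      by (simp only: of_real_mult)
  qed
  finally have S: "(\<lambda>k. complex_of_real ((2 + \<beta>) / (2 + \<beta> + real k) * y ^ k)) sums
      (\<integral>u. kernel 1 u z * kernel (2 + \<beta>) z u \<partial>weighted_area (\<beta> + 1))" .
  have S': "summable (\<lambda>k. (2 + \<beta>) / (2 + \<beta> + real k) * y ^ k)"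
    using sums_summable[OF S] by (simp only: summable_of_real_iff)
  \<comment> \<open>The coefficients dominate 1 / (k + 1) because k (1 + \<beta>) \<ge> 0. The
    logarithm has y^(k + 1) where this series has y^k, which only helps for y < 1.\<close>
  have "ln (1 / (1 - y)) \<le> (\<Sum>k. (2 + \<beta>) / (2 + \<beta> + real k) * y ^ k)"
    unfolding sums_unique[OF sums_ln_one_minus[OF y]]
  proof (rule suminf_le[OF _ sums_summable[OF sums_ln_one_minus[OF y]] S'])
    fix k
    have "y ^ Suc k / real (Suc k) \<le> y ^ k / real (Suc k)"
      using y by (intro divide_right_mono) (auto simp: mult_left_le_one_le)
    also have "\<dots> = 1 / real (Suc k) * y ^ k" by simp
    also have "\<dots> \<le> (2 + \<beta>) / (2 + \<beta> + real k) * y ^ k"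
    proof (rule mult_right_mono)
      have "0 \<le> real k * (1 + \<beta>)" using \<beta> by simp
      then have "2 + \<beta> + real k \<le> (2 + \<beta>) * real (Suc k)" by (simp add: algebra_simps)
      then show "1 / real (Suc k) \<le> (2 + \<beta>) / (2 + \<beta> + real k)"
        using \<beta> by (simp add: divide_le_eq le_divide_eq mult.commute del: of_nat_Suc)
    qed (use y in simp)
    finally show "y ^ Suc k / real (Suc k) \<le> (2 + \<beta>) / (2 + \<beta> + real k) * y ^ k" .
  qed
  also have "\<dots> \<le> cmod (\<integral>u. kernel 1 u z * kernel (2 + \<beta>) z u \<partial>weighted_area (\<beta> + 1))"
    using sums_unique2[OF S sums_of_real[OF summable_sums[OF S']]] by (simp only: norm_of_real)
  finally have "(1 + \<beta>) / (2 + \<beta>) * ln (1 / (1 - y)) \<le>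
      (1 + \<beta>) / (2 + \<beta>) * cmod (\<integral>u. kernel 1 u z * kernel (2 + \<beta>) z u \<partial>weighted_area (\<beta> + 1))"
    using \<beta> by (intro mult_left_mono) auto
  also have "\<dots> = cmod (\<integral>u. complex_of_real (1 - (cmod u)\<^sup>2) * (kernel 1 u z * kernel (2 + \<beta>) z u) \<partial>weighted_area \<beta>)"
    unfolding integral_weighted_area_Suc[OF \<beta> kk] norm_mult norm_of_real using \<beta> by simp
  finally show ?thesis by (simp add: y_def mult.assoc)
qed

text \<open>Here |g'(z)| = t |J|, where J is the \<mu>-integral of f(w) = w times the kernel of
  order t + 1 at z. Pairing f with a projection h and freezing h at z, which the Carleson property
  allows at cost O(1 / (1 - |z|^2)), bounds |h(z)| |J| by the same order. An h of logarithmic size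
  at z then yields the extra decay of J.\<close>

lemma toeplitz_bounded_LB1:
  assumes \<mu>: "finite_measure \<mu>" "sets \<mu> = sets (restrict_space borel \<D>)"
    and p: "0 < p" "p \<le> 1" and \<alpha>: "\<alpha> > -1" and \<beta>: "\<beta> > -1"
    and T: "toeplitz_bounded \<mu> p \<alpha> 1 \<beta>" and carl: "carleson_measure \<mu> (1 / p) 1 \<alpha>"
  shows "toeplitz \<mu> ((2 + \<alpha>) / p - 2) (\<lambda>_. 1) \<in> LB1"
proof -
  define t where "t = (2 + \<alpha>) / p"
  have t0: "t > 0" using p \<alpha> by (simp add: t_def)
  define g where "g = toeplitz \<mu> (t - 2) (\<lambda>_. 1)"
  have space: "space \<mu> = \<D>" by (rule space_disk_measure[OF \<mu>(2)])
  obtain C1 where C1: "C1 > 0" "\<And>P f S A \<phi> K r. (\<And>n u. u \<in> \<D> \<Longrightarrow> cmod (poly (P n) u) \<le> S) \<Longrightarrow>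
    (\<And>u. u \<in> \<D> \<Longrightarrow> (\<lambda>n. poly (P n) u) \<longlonglongrightarrow> f u) \<Longrightarrow> A \<ge> 0 \<Longrightarrow>
    (\<integral>\<^sup>+u. ennreal (cmod (f u) powr p) \<partial>weighted_area \<alpha>) \<le> ennreal (A powr p) \<Longrightarrow>
    \<phi> \<in> borel_measurable (weighted_area \<beta>) \<Longrightarrow> (\<And>u. u \<in> \<D> \<Longrightarrow> cmod (\<phi> u) \<le> K) \<Longrightarrow> 0 < r \<Longrightarrow> r < 1 \<Longrightarrow>
    (\<And>u. r \<le> cmod u \<Longrightarrow> \<phi> u = 0) \<Longrightarrow>
    cmod (\<integral>w. f w * cnj (\<integral>u. \<phi> u * kernel (2 + \<beta>) w u \<partial>weighted_area \<beta>) \<partial>\<mu>) \<le> C1 * K * A"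
    using toeplitz_bounded_pairing[OF \<mu> p \<alpha> \<beta> T] by blast
  obtain C2 where C2: "C2 > 0" "\<And>z. cmod z < 1 \<Longrightarrow>
    (\<integral>\<^sup>+u. ennreal (cmod (kernel (t + 1) u z) powr p) \<partial>weighted_area \<alpha>) \<le>
    ennreal ((C2 * (1 - (cmod z)\<^sup>2) powr - 1) powr p)"
    using nn_integral_kernel_powr_le[OF \<alpha> p(1), of 1] unfolding t_def by auto
  obtain L where L: "L > 0" "\<And>\<phi> h. \<phi> \<in> borel_measurable (weighted_area \<beta>) \<Longrightarrow> (\<And>u. u \<in> \<D> \<Longrightarrow> cmod (\<phi> u) \<le> 1) \<Longrightarrow>
    h = (\<lambda>w. \<integral>u. \<phi> u * kernel (2 + \<beta>) w u \<partial>weighted_area \<beta>) \<Longrightarrow>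
    Bloch_bounded L h \<and> cmod (h 0) \<le> 1"
    using bergman_projection_Bloch[OF \<beta>] by blast
  obtain C3 where C3: "C3 > 0" "\<And>h z. Bloch_bounded L h \<Longrightarrow>
    cmod z < 1 \<Longrightarrow>
    (\<integral>\<^sup>+w. ennreal (cmod (h w - h z) * cmod (kernel (t + 1) z w)) \<partial>\<mu>) \<le> ennreal (C3 / (1 - (cmod z)\<^sup>2))"
    using carleson_measure_Bloch[OF carl \<mu>(2) p \<alpha> less_imp_le[OF L(1)]] unfolding t_def by blast
  obtain C4 where C4: "C4 > 0" "\<And>z. cmod z < 1 \<Longrightarrow>
    (\<integral>\<^sup>+w. ennreal (cmod (kernel (t + 1) z w)) \<partial>\<mu>) \<le> ennreal (C4 * (1 - (cmod z)\<^sup>2) powr - 1)"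
    using carleson_measure_kernel[OF carl p(1) \<alpha>, of 1] unfolding t_def by auto
  \<comment> \<open>The factor 2 undoes the halving in \<open>\<phi>\<close>, and the quotient
    inverts the constant of \<open>projection_log_lower_bound\<close>.\<close>
  define c where "c = 2 * ((2 + \<beta>) / (1 + \<beta>))"
  have c: "c > 0" using \<beta> by (simp add: c_def)
  \<comment> \<open>From ln (2 / x) = ln 2 + ln (1 / x): the projection controls only ln (1 / x),
    which vanishes at z = 0, and the kernel estimate with C4 takes care of ln 2.\<close>
  define G where "G = t * (ln 2 * C4 + c * (C1 * C2 + C3))"
  have bound: "(1 - (cmod z)\<^sup>2) * ln (2 / (1 - (cmod z)\<^sup>2)) * cmod (deriv g z) \<le> G" if "z \<in> \<D>" for z
  proof -
    have z: "cmod z < 1" using that by simp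
    define x where "x = 1 - (cmod z)\<^sup>2"
    have x: "0 < x" "x \<le> 1" using one_minus_norm_bounds[OF z] by (auto simp: x_def)
    \<comment> \<open>The factor u is the conjugate of the cnj w that differentiating the kernel in
      z produces.\<close>
    define f where "f u = u * kernel (t + 1) u z" for u
    define J where "J = (\<integral>w. f w \<partial>\<mu>)"
    have z': "cmod z \<le> 1" using z by simp
    have km: "kernel (t + 1) z \<in> borel_measurable \<mu>"
      by (rule borel_measurable_disk_continuous[OF \<mu>(2) continuous_on_kernel2[OF z]])
    have fc: "continuous_on \<D> f"
      unfolding f_def by (intro continuous_intros continuous_on_kernel1 z')
    have fm [measurable]: "f \<in> borel_measurable \<mu>" by (rule borel_measurable_disk_continuous[OF \<mu>(2) fc])
    have f_le: "cmod (f w) \<le> cmod (kernel (t + 1) z w)" if "w \<in> \<D>" for w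
      using that mult_right_mono[of "cmod w" 1 "cmod (kernel (t + 1) z w)"]
      by (simp add: f_def norm_mult norm_kernel_commute[of _ w])
    have f_nn: "(\<integral>\<^sup>+w. ennreal (cmod (f w)) \<partial>\<mu>) \<le> ennreal (C4 / x)"
    proof -
      have "(\<integral>\<^sup>+w. ennreal (cmod (f w)) \<partial>\<mu>) \<le> (\<integral>\<^sup>+w. ennreal (cmod (kernel (t + 1) z w)) \<partial>\<mu>)"
        by (intro nn_integral_mono ennreal_leI f_le) (simp add: space)
      also note C4(2)[OF z]
      also have "C4 * (1 - (cmod z)\<^sup>2) powr - 1 = C4 / x"
        using x by (simp add: x_def powr_neg_one)
      finally show ?thesis .
    qed
    have f_int: "integrable \<mu> f"
      by (rule integrableI_bounded[OF fm]) (use order_le_less_trans[OF f_nn] in auto)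
    have J_le: "cmod J \<le> C4 / x"
      unfolding J_def by (rule norm_integral_le[OF f_nn]) (use C4 x in simp)
    have deriv_g: "cmod (deriv g z) = t * cmod J"
    proof -
      have "deriv g z = t * (\<integral>w. cnj w * kernel (t + 1) z w \<partial>\<mu>)"
        using DERIV_imp_deriv[OF toeplitz_one_derivative[OF \<mu> _ z, of "t - 2"]] t0 by (simp add: g_def)
      also have "(\<integral>w. cnj w * kernel (t + 1) z w \<partial>\<mu>) = (\<integral>w. cnj (f w) \<partial>\<mu>)"
        by (rule Bochner_Integration.integral_cong) (use cnj_kernel[OF _ z'] in \<open>auto simp: f_def space\<close>)
      also have "\<dots> = cnj J" unfolding J_def by simp
      finally show ?thesis using t0 by (simp add: norm_mult)
    qed
    obtain P S where PS: "\<And>n u. u \<in> \<D> \<Longrightarrow> cmod (poly (P n) u) \<le> S" "\<And>u. u \<in> \<D> \<Longrightarrow> (\<lambda>n. poly (P n) u) \<longlonglongrightarrow> kernel (t + 1) u z"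
      using kernel_poly_limit[OF z, of "t + 1"] t0 by auto
    \<comment> \<open>As |1 - u cnj z| \<ge> 1 - |u| and 1 - |u|^2 \<le> 2 (1 - |u|), the halving
      makes \<phi> bounded by 1, as the choice of L requires.\<close>
    define \<phi> where "\<phi> u = complex_of_real ((1 - (cmod u)\<^sup>2) / 2) * kernel 1 u z" for u
    have \<phi>1: "cmod (\<phi> u) \<le> 1" if u: "u \<in> \<D>" for u
    proof -
      have u1: "cmod u < 1" using u by simp
      have "cmod (kernel 1 u z) \<le> (1 - cmod u) powr - 1"
        by (rule norm_kernel_le[OF u1 z']) simp
      also have "\<dots> = 1 / (1 - cmod u)" using u1 by (simp add: powr_neg_one)
      finally have "(1 - (cmod u)\<^sup>2) / 2 * cmod (kernel 1 u z) \<le> (1 - cmod u) * (1 / (1 - cmod u))"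
        using one_minus_norm_bounds[OF u1] by (intro mult_mono) auto
      also have "\<dots> = 1" using u1 by simp
      finally show ?thesis
        unfolding \<phi>_def norm_mult norm_of_real using one_minus_norm_bounds(1)[OF u1] by simp
    qed
    have \<phi>c: "continuous_on \<D> \<phi>"
      unfolding \<phi>_def by (intro continuous_intros continuous_on_kernel1 z') auto
    have \<phi>m: "\<phi> \<in> borel_measurable (weighted_area \<beta>)" by (rule borel_measurable_weighted_continuous[OF \<phi>c])
    define h where "h n = (\<lambda>w. \<integral>u. (indicator (ball 0 (rad n)) u * \<phi> u) * kernel (2 + \<beta>) w u \<partial>weighted_area \<beta>)" for n
    have im: "(\<lambda>u. indicator (ball 0 r) u * \<phi> u) \<in> borel_measurable (weighted_area \<beta>)" for r
      by (intro borel_measurable_times \<phi>m borel_measurable_weighted_borel borel_measurable_indicator) auto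
    have i1: "cmod (indicator (ball 0 r) u * \<phi> u) \<le> 1" if "u \<in> \<D>" for u r
      using \<phi>1[OF that] by (auto simp: indicator_def)
    \<comment> \<open>The pairing is available only for the cut-off \<phi>, hence the index n; the
      bound is free of n and passes to the full projection at z.\<close>
    have step: "cmod (h n z) * cmod J \<le> (C1 * C2 + C3) / x" for n
    proof -
      have h: "Bloch_bounded L (h n)"
        using L(2)[OF im i1 h_def] by auto
      have hm [measurable]: "h n \<in> borel_measurable \<mu>"
        by (rule borel_measurable_disk_continuous[OF \<mu>(2) holomorphic_on_imp_continuous_on[OF Bloch_boundedD(1)[OF h]]])
      have pair: "cmod (\<integral>w. f w * cnj (h n w) \<partial>\<mu>) \<le> C1 * 1 * (C2 / x)"
        unfolding h_def
      \<comment> \<open>\<open>pCons 0\<close> multiplies the Taylor polynomials of the kernel by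
        the variable, giving polynomials for f with the same bound S.\<close>
      proof (rule C1(2)[of "\<lambda>n. pCons 0 (P n)" "S" f "C2 / x" _ 1 "rad n"])
        fix n u assume u: "u \<in> \<D>"
        have "cmod u * cmod (poly (P n) u) \<le> 1 * S" using u PS(1)[OF u, of n] by (intro mult_mono) auto
        then show "cmod (poly (pCons 0 (P n)) u) \<le> S" by (simp add: norm_mult)
        show "(\<lambda>n. poly (pCons 0 (P n)) u) \<longlonglongrightarrow> f u"
          using tendsto_mult[OF tendsto_const[of u] PS(2)[OF u]] by (simp add: f_def)
      next
        have "(\<integral>\<^sup>+u. ennreal (cmod (f u) powr p) \<partial>weighted_area \<alpha>) \<le>
          (\<integral>\<^sup>+u. ennreal (cmod (kernel (t + 1) u z) powr p) \<partial>weighted_area \<alpha>)"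
          using f_le p by (intro nn_integral_mono ennreal_leI powr_mono2) (auto simp: norm_kernel_commute[of _ z])
        also have "\<dots> \<le> ennreal ((C2 / x) powr p)"
          using C2(2)[OF z] x by (simp add: x_def powr_neg_one)
        finally show "(\<integral>\<^sup>+u. ennreal (cmod (f u) powr p) \<partial>weighted_area \<alpha>) \<le> ennreal ((C2 / x) powr p)" .
        show "indicator (ball 0 (rad n)) u * \<phi> u = 0" if "rad n \<le> cmod u" for u using that by simp
      qed (use im i1 rad(1,2)[of n] C2(1) x in auto)
      have diff: "(\<integral>\<^sup>+w. ennreal (cmod (f w * cnj (h n w - h n z))) \<partial>\<mu>) \<le> ennreal (C3 / x)"
      proof -
        have "(\<integral>\<^sup>+w. ennreal (cmod (f w * cnj (h n w - h n z))) \<partial>\<mu>) \<le>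
          (\<integral>\<^sup>+w. ennreal (cmod (h n w - h n z) * cmod (kernel (t + 1) z w)) \<partial>\<mu>)"
        proof (intro nn_integral_mono ennreal_leI)
          fix w assume "w \<in> space \<mu>"
          then have "cmod (h n w - h n z) * cmod (f w) \<le> cmod (h n w - h n z) * cmod (kernel (t + 1) z w)"
            using f_le[of w] by (intro mult_left_mono) (auto simp: space)
          then show "cmod (f w * cnj (h n w - h n z)) \<le> cmod (h n w - h n z) * cmod (kernel (t + 1) z w)"
            unfolding norm_mult complex_mod_cnj by (simp only: mult.commute)
        qed
        also note C3(2)[OF h z]
        finally show ?thesis by (simp add: x_def)
      qed
      have int2: "integrable \<mu> (\<lambda>w. f w * cnj (h n w - h n z))"
      proof (rule integrableI_bounded)
        show "(\<integral>\<^sup>+w. ennreal (norm (f w * cnj (h n w - h n z))) \<partial>\<mu>) < \<infinity>"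
          by (rule order_le_less_trans[OF diff]) simp
      qed measurable
      have "(\<integral>w. f w * cnj (h n w) \<partial>\<mu>) = (\<integral>w. f w * cnj (h n w - h n z) + f w * cnj (h n z) \<partial>\<mu>)"
        by (simp add: algebra_simps)
      also have "\<dots> = (\<integral>w. f w * cnj (h n w - h n z) \<partial>\<mu>) + J * cnj (h n z)"
        unfolding J_def using int2 f_int by (subst Bochner_Integration.integral_add) auto
      finally have "J * cnj (h n z) = (\<integral>w. f w * cnj (h n w) \<partial>\<mu>) - (\<integral>w. f w * cnj (h n w - h n z) \<partial>\<mu>)"
        by simp
      then have "cmod (J * cnj (h n z)) \<le> cmod (\<integral>w. f w * cnj (h n w) \<partial>\<mu>) + cmod (\<integral>w. f w * cnj (h n w - h n z) \<partial>\<mu>)"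
        by (metis norm_triangle_ineq4)
      also have "\<dots> \<le> C1 * 1 * (C2 / x) + C3 / x"
        using norm_integral_le[OF diff] C3(1) x by (intro add_mono pair) auto
      finally show ?thesis by (simp add: norm_mult mult.commute add_divide_distrib)
    qed
    define hz where "hz = (\<integral>u. \<phi> u * kernel (2 + \<beta>) z u \<partial>weighted_area \<beta>)"
    have "(\<lambda>n. h n z) \<longlonglongrightarrow> hz"
    proof -
      have "integrable (weighted_area \<beta>) (\<lambda>u. \<phi> u * kernel (2 + \<beta>) z u)"
        by (rule has_field_derivative_integral_kernel(2)[OF finite_measure_weighted_area[OF \<beta>] sets_weighted_area \<phi>m \<phi>1])
          (use \<beta> z in auto)
      from integral_indicator_ball_rad_tendsto[OF sets_weighted_area this]
      show ?thesis by (simp add: h_def hz_def mult.assoc)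
    qed
    then have "(\<lambda>n. cmod (h n z) * cmod J) \<longlonglongrightarrow> cmod hz * cmod J"
      by (intro tendsto_intros)
    then have hzJ: "cmod hz * cmod J \<le> (C1 * C2 + C3) / x"
      by (rule LIMSEQ_le_const2) (use step in blast)
    have "(1 + \<beta>) / (2 + \<beta>) * ln (1 / x) \<le> 2 * cmod hz"
    proof -
      have "complex_of_real (1 - (cmod u)\<^sup>2) * kernel 1 u z * kernel (2 + \<beta>) z u = 2 * (\<phi> u * kernel (2 + \<beta>) z u)" for u
        by (simp add: \<phi>_def)
      then have "(\<integral>u. complex_of_real (1 - (cmod u)\<^sup>2) * kernel 1 u z * kernel (2 + \<beta>) z u \<partial>weighted_area \<beta>) = 2 * hz"
        by (simp only: hz_def integral_mult_right_zero)
      then show ?thesis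
        using projection_log_lower_bound[OF \<beta> z] by (simp add: x_def norm_mult)
    qed
    then have "((2 + \<beta>) / (1 + \<beta>)) * ((1 + \<beta>) / (2 + \<beta>) * ln (1 / x)) \<le> ((2 + \<beta>) / (1 + \<beta>)) * (2 * cmod hz)"
      using \<beta> by (intro mult_left_mono) auto
    moreover have "((2 + \<beta>) / (1 + \<beta>)) * ((1 + \<beta>) / (2 + \<beta>) * ln (1 / x)) = ln (1 / x)"
      using \<beta> by simp
    moreover have "((2 + \<beta>) / (1 + \<beta>)) * (2 * cmod hz) = c * cmod hz"
      by (simp add: c_def)
    ultimately have ln_le: "ln (1 / x) \<le> c * cmod hz" by simp
    have "x * (ln (1 / x) * cmod J) \<le> x * (c * cmod hz * cmod J)"
      using ln_le x by (intro mult_left_mono mult_right_mono) auto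
    also have "\<dots> = c * (x * (cmod hz * cmod J))" by simp
    also have "\<dots> \<le> c * (C1 * C2 + C3)"
      using hzJ x c by (intro mult_left_mono) (auto simp: field_simps)
    finally have 1: "x * (ln (1 / x) * cmod J) \<le> c * (C1 * C2 + C3)" .
    have "ln 2 * (x * cmod J) \<le> ln 2 * C4"
      using J_le x by (intro mult_left_mono) (auto simp: field_simps)
    moreover have "ln (2 / x) = ln 2 + ln (1 / x)"
      using x by (simp add: ln_div)
    then have "x * (ln (2 / x) * cmod J) = ln 2 * (x * cmod J) + x * (ln (1 / x) * cmod J)"
      by (simp add: algebra_simps)
    ultimately have "x * (ln (2 / x) * cmod J) \<le> ln 2 * C4 + c * (C1 * C2 + C3)"
      using 1 by linarith
    from mult_left_mono[OF this less_imp_le[OF t0]]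
    show ?thesis
      unfolding deriv_g G_def x_def[symmetric] by (simp only: mult_ac)
  qed
  have "g holomorphic_on \<D>"
    unfolding g_def by (rule holomorphic_toeplitz[OF \<mu>, where B = 1]) (use t0 in auto)
  moreover have "(SUP z\<in>\<D>. ennreal ((1 - (cmod z)\<^sup>2) * ln (2 / (1 - (cmod z)\<^sup>2)) * cmod (deriv g z))) \<le> ennreal G"
    by (intro SUP_least ennreal_leI bound)
  then have "(SUP z\<in>\<D>. ennreal ((1 - (cmod z)\<^sup>2) * ln (2 / (1 - (cmod z)\<^sup>2)) * cmod (deriv g z))) < \<infinity>"
    by (rule order_le_less_trans) simp
  ultimately show ?thesis
    unfolding g_def[unfolded t_def, symmetric] LB1_def by (simp add: ennreal_add_less_top)
qed

theorem theorem1p1: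
  fixes \<mu> :: "complex measure" and p \<alpha> \<beta> :: real
  assumes "finite_borel_measure_on_disk \<mu>"
    and "0 < p" and "p \<le> 1" and "-1 < \<alpha>" and "-1 < \<beta>"
  shows "toeplitz_bounded \<mu> p \<alpha> 1 \<beta> \<longleftrightarrow>
    carleson_measure \<mu> (1 / p) 1 \<alpha> \<and> toeplitz \<mu> ((2 + \<alpha>) / p - 2) (\<lambda>_. 1) \<in> LB1"
proof -
  have \<mu>: "finite_measure \<mu>" "sets \<mu> = sets (restrict_space borel \<D>)"
    using assms(1) by (auto simp: finite_borel_measure_on_disk_def)
  note params = assms(2-5)
  \<comment> \<open>The Carleson property comes first, since the necessity of the logarithmic
    condition relies on it.\<close>
  have "carleson_measure \<mu> (1 / p) 1 \<alpha>" if T: "toeplitz_bounded \<mu> p \<alpha> 1 \<beta>"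
  proof -
    define t where "t = (2 + \<alpha>) / p"
    obtain C where "C > 0" "\<And>z. cmod z < 1 \<Longrightarrow>
      (\<integral>\<^sup>+w. ennreal (cmod (kernel (2 * (t + 1)) z w)) \<partial>\<mu>) \<le> ennreal (C * (1 - (cmod z)\<^sup>2) powr - (t + 2))"
      using toeplitz_bounded_kernel[OF \<mu> params T t_def] by blast
    then show ?thesis
      by (rule carleson_measure_if_kernel_bound[OF \<mu> params(1-3) t_def])
  qed
  then show ?thesis
    using toeplitz_bounded_LB1[OF \<mu> params] toeplitz_bounded_if_carleson_LB1[OF \<mu> params] by blast
qed

end
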